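(* In the setting described in the context, for parameters $Q,K<N^{1/2}$, $$\int_{W_{Q,K}}|S_N(\theta)|^2\,d\theta\ll\log N\left(N^{\delta+\delta\sigma}\sup_{\theta\in W_{Q,K}}|S_N(\theta)|+N^{2\delta+1-\sigma}\right).$$
   Context: Let $\Gamma<\mathrm{SL}(2,\mathbb{Z})$ be a finitely generated free group with no parabolic elements, fixed with a free generating set, and let $\delta>5/6$ be the Hausdorff dimension of its limit set. Fix primitive $v_0,w_0\in\mathbb{Z}^2$ and a parameter $0<\sigma<1/4$. Let $\|\cdot\|$ be the Frobenius norm and $e(x)=e^{2\pi i x}$. For large $N$: let $\Xi\subset\Gamma$ be a set of elements $\xi$ with $\|\xi\|<N^{1/2}$ whose reduced words in the generators all end with the same letter, with $|\Xi|\gg N^{\delta}$; let $\Pi\subset\Gamma$ be a set of elements $\varpi$ with $\|\varpi\|<N^{1/2-\sigma}$ whose reduced words all start with the same letter, not the inverse of the last letter of the elements of $\Xi$, with $|\Pi|\gg N^{\delta(1-2\sigma)}$. Define $S_N(\theta)=\sum_{\xi\in\Xi}\sum_{\varpi\in\Pi}\sum_{\gamma\in\Gamma,\|\gamma\|<N^{\sigma}}e(\langle v_0\gamma\xi\varpi,w_0\rangle\theta)$. Define $W_{Q,K}=\{\theta=\frac aq+\beta\in[0,1]:(a,q)=1,\ q\sim Q,\ |\beta|\sim K/N\}$, where $x\sim X$ means $\frac12X\le x<X$. *)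

theory Defs
  imports "HOL-Analysis.Analysis" "HOL-Algebra.Group"
begin

definition SL2Z :: "(int^2^2) monoid" where
  "SL2Z = \<lparr>carrier = {A. det A = 1}, mult = (**), one = mat 1\<rparr>"

definition parabolic :: "int^2^2 \<Rightarrow> bool" where
  "parabolic A \<longleftrightarrow> \<bar>trace A\<bar> = 2 \<and> A \<noteq> mat 1 \<and> A \<noteq> - mat 1"

definition frob_norm :: "int^2^2 \<Rightarrow> real" where
  "frob_norm A = sqrt (\<Sum>i\<in>UNIV. \<Sum>j\<in>UNIV. (real_of_int (A $ i $ j))\<^sup>2)"

lemma group_SL2Z: "group SL2Z"
proof (rule groupI)
  fix A assume "A \<in> carrier SL2Z"
  hence d: "A$1$1 * A$2$2 - A$1$2 * A$2$1 = 1"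
    by (simp add: SL2Z_def det_2)
  define B :: "int^2^2" where "B = vector [vector [A$2$2, - A$1$2], vector [- A$2$1, A$1$1]]"
  have "det B = 1"
    using d by (simp add: B_def det_2 mult.commute)
  moreover have "B ** A = mat 1"
    using d by (simp add: B_def vec_eq_iff forall_2 matrix_matrix_mult_def mat_def sum_2 algebra_simps)
  ultimately show "\<exists>B\<in>carrier SL2Z. B \<otimes>\<^bsub>SL2Z\<^esub> A = \<one>\<^bsub>SL2Z\<^esub>"
    by (auto simp: SL2Z_def)
qed (auto simp: SL2Z_def det_mul matrix_mul_assoc)

text \<open>A letter \<open>(s, True)\<close> stands for the generator \<open>s\<close>, and \<open>(s, False)\<close> for its inverse.\<close>

type_synonym 'a letter = "'a \<times> bool"

definition inv_letter :: "'a letter \<Rightarrow> 'a letter" where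
  "inv_letter x = (fst x, \<not> snd x)"

definition reduced_words :: "'a set \<Rightarrow> 'a letter list set" where
  "reduced_words S = {w \<in> lists (S \<times> UNIV). successively (\<lambda>x y. y \<noteq> inv_letter x) w}"

definition letter_val :: "('a, 'b) monoid_scheme \<Rightarrow> 'a letter \<Rightarrow> 'a" where
  "letter_val G x = (if snd x then fst x else inv\<^bsub>G\<^esub> (fst x))"

definition word_val :: "('a, 'b) monoid_scheme \<Rightarrow> 'a letter list \<Rightarrow> 'a" where
  "word_val G w = foldr (\<lambda>x g. letter_val G x \<otimes>\<^bsub>G\<^esub> g) w \<one>\<^bsub>G\<^esub>"

text \<open>The subgroup \<open>H\<close> of \<open>G\<close> is free on \<open>S\<close>: every element of \<open>H\<close> is the value of
  exactly one reduced word in \<open>S\<close>.\<close>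

definition free_generating_set :: "('a, 'b) monoid_scheme \<Rightarrow> 'a set \<Rightarrow> 'a set \<Rightarrow> bool" where
  "free_generating_set G H S \<longleftrightarrow> S \<subseteq> H \<and> bij_betw (word_val G) (reduced_words S) H"

definition reduced_word :: "('a, 'b) monoid_scheme \<Rightarrow> 'a set \<Rightarrow> 'a \<Rightarrow> 'a letter list" where
  "reduced_word G S g = (THE w. w \<in> reduced_words S \<and> word_val G w = g)"

definition starts_with_letter ::
    "('a, 'b) monoid_scheme \<Rightarrow> 'a set \<Rightarrow> 'a letter \<Rightarrow> 'a \<Rightarrow> bool" where
  "starts_with_letter G S x g \<longleftrightarrow> reduced_word G S g \<noteq> [] \<and> hd (reduced_word G S g) = x"

definition ends_with_letter ::
    "('a, 'b) monoid_scheme \<Rightarrow> 'a set \<Rightarrow> 'a letter \<Rightarrow> 'a \<Rightarrow> bool" where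
  "ends_with_letter G S x g \<longleftrightarrow> reduced_word G S g \<noteq> [] \<and> last (reduced_word G S g) = x"

definition hausdorff_premeasure :: "real \<Rightarrow> real \<Rightarrow> 'a::metric_space set \<Rightarrow> ennreal" where
  "hausdorff_premeasure s \<epsilon> A =
    (INF U \<in> {U :: nat \<Rightarrow> 'a set. A \<subseteq> (\<Union>i. U i) \<and> (\<forall>i. bounded (U i) \<and> diameter (U i) \<le> \<epsilon>)}.
      \<Sum>i. ennreal (diameter (U i) powr s))"

definition hausdorff_measure :: "real \<Rightarrow> 'a::metric_space set \<Rightarrow> ennreal" where
  "hausdorff_measure s A = (SUP \<epsilon>\<in>{0<..}. hausdorff_premeasure s \<epsilon> A)"

text \<open>Only exponents \<open>s > 0\<close> are used (so \<open>0 powr 0 = 0\<close> plays no role); dropping \<open>s = 0\<close>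
  does not change the infimum.\<close>

definition hausdorff_dim :: "'a::metric_space set \<Rightarrow> ereal" where
  "hausdorff_dim A = (INF s \<in> {s. 0 < s \<and> hausdorff_measure s A = 0}. ereal s)"

definition moebius_act :: "int^2^2 \<Rightarrow> complex \<Rightarrow> complex" where
  "moebius_act A = moebius (of_int (A$1$1)) (of_int (A$1$2)) (of_int (A$2$1)) (of_int (A$2$2))"

text \<open>The Cayley transform takes the upper half plane to the unit disc, and its boundary
  (the real line with the point at infinity) to the unit circle.\<close>

definition cayley :: "complex \<Rightarrow> complex" where
  "cayley z = (z - \<i>) / (z + \<i>)"

text \<open>The set of boundary points at which the orbit of \<open>\<i>\<close> accumulates, in the disc model, so that
  the point at infinity needs no special treatment and the metric is that of the circle.\<close>

definition limit_set :: "(int^2^2) set \<Rightarrow> complex set" where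
  "limit_set \<Gamma> = {\<zeta> \<in> sphere 0 1. \<zeta> islimpt ((\<lambda>\<gamma>. cayley (moebius_act \<gamma> \<i>)) ` \<Gamma>)}"

definition primitive_vec :: "int^2 \<Rightarrow> bool" where
  "primitive_vec v \<longleftrightarrow> coprime (v $ 1) (v $ 2)"

definition int_dot :: "int^2 \<Rightarrow> int^2 \<Rightarrow> int" where
  "int_dot v w = (\<Sum>i\<in>UNIV. v $ i * w $ i)"

definition unit_exp :: "real \<Rightarrow> complex" where
  "unit_exp x = exp (2 * of_real pi * \<i> * of_real x)"

definition exp_sum :: "(int^2^2) set \<Rightarrow> int^2 \<Rightarrow> int^2 \<Rightarrow> real \<Rightarrow> real
    \<Rightarrow> (int^2^2) set \<Rightarrow> (int^2^2) set \<Rightarrow> real \<Rightarrow> complex" where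
  "exp_sum \<Gamma> v\<^sub>0 w\<^sub>0 \<sigma> N \<Xi> P \<theta> =
    (\<Sum>\<xi>\<in>\<Xi>. \<Sum>\<omega>\<in>P. \<Sum>\<gamma>\<in>{\<gamma>\<in>\<Gamma>. frob_norm \<gamma> < N powr \<sigma>}.
      unit_exp (real_of_int (int_dot (v\<^sub>0 v* (\<gamma> ** \<xi> ** \<omega>)) w\<^sub>0) * \<theta>))"

definition dyadic :: "real \<Rightarrow> real \<Rightarrow> bool" where
  "dyadic x X \<longleftrightarrow> X / 2 \<le> x \<and> x < X"

definition W_region :: "real \<Rightarrow> real \<Rightarrow> real \<Rightarrow> real set" where
  "W_region N Q K = {\<theta> \<in> {0..1}. \<exists>(a::int) (q::nat) \<beta>. \<theta> = of_int a / of_nat q + \<beta> \<and> 0 < q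
      \<and> coprime a (int q) \<and> dyadic (real q) Q \<and> dyadic \<bar>\<beta>\<bar> (K / N)}"

text \<open>The set \<open>W_region N Q K\<close> can be empty (for instance if \<open>Q \<le> 1\<close>); the supremum of a
  nonnegative function over the empty set is taken to be \<open>0\<close>.\<close>

definition sup_norm_on :: "real set \<Rightarrow> (real \<Rightarrow> complex) \<Rightarrow> real" where
  "sup_norm_on A f = (if A = {} then 0 else SUP \<theta>\<in>A. cmod (f \<theta>))"

end

theory Submission
  imports Defs "HOL-Analysis.Harmonic_Numbers" "HOL-Real_Asymp.Real_Asymp"
begin

text \<open>Averaging over the shifts of a grid of mesh about \<open>1 / N\<close> reduces the integral to sums over finite
  sets \<open>\<Theta>\<close> of separated points. Write \<open>S\<^sub>N(\<theta>) = \<Sum>\<^sub>x \<mu>(x) \<Sum>\<^sub>y e(\<langle>x, y\<rangle> \<theta>)\<close> with \<open>x = v\<^sub>0 \<gamma> \<xi>\<close> and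
  \<open>y = \<omega> w\<^sub>0\<close>. By duality and a large sieve on the torus, the square of the sum of \<open>|S\<^sub>N|\<^sup>2\<close> over \<open>\<Theta>\<close> is
  bounded by \<open>\<Sum> \<mu>\<^sup>2\<close> times the number of near coincidences \<open>y \<theta> \<approx> y' \<theta>'\<close>, weighted by
  \<open>|S\<^sub>N(\<theta>) S\<^sub>N(\<theta>')|\<close>. A near coincidence puts \<open>(y \<and> y') \<theta>\<close> close to an integer, so for given \<open>y, \<theta>\<close> it is
  counted by means of a Dirichlet approximation \<open>a / q\<close> of \<open>\<theta>\<close>. Where \<open>q\<close> is large, the weights are
  removed by Schur's test; where \<open>q\<close> is small, by the supremum of \<open>|S\<^sub>N|\<close>.

  The sum \<open>\<Sum> \<mu>\<^sup>2\<close> counts the solutions of \<open>\<gamma> \<xi> = \<gamma>' \<xi>'\<close>. Since \<open>\<Gamma>\<close> has no parabolic elements, the norm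
  is multiplicative up to constants along reduced words, which is seen from the number of Farey edges that
  separate the two ends of a path; this makes a common product determine \<open>\<gamma>\<close> up to a short word. The
  elements of \<open>\<Gamma>\<close> are counted through the Poincare series at an exponent \<open>s\<close> slightly above \<open>\<delta>\<close>, which
  converges because the limit set has covers of arbitrarily small \<open>s\<close>-dimensional size. The resulting
  loss of a small power of \<open>N\<close> is absorbed, as all other steps leave room.\<close>

section \<open>Integer matrices of determinant one\<close>

text \<open>The obstacle is that the norm of a product in SL(2, Z) falls far below the product of
  the norms when the path of the word makes an excursion into a cusp. Such an excursion crosses a
  long fan of Farey edges with a common end, and two edges of a fan met in equivalent positions
  would differ by a parabolic element of \<Gamma>. This bounds the excursions by a finite count,
  with integer matrices only. The same count, for the fan at the cusp of a fixed primitive vector w,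
  shows that \<gamma> w is as long as \<gamma>, so that nothing is lost in passing from matrices to
  vectors. In the analytic part neither way of removing the weights would do alone. Where \<theta>
  has a small denominator q, the row sums of the kernel are too large for Schur's test; there the
  supremum is affordable, because only the sum of 1 / q over the points enters, and few points are
  close to fractions with small denominators.\<close>

definition mat22 :: "int \<Rightarrow> int \<Rightarrow> int \<Rightarrow> int \<Rightarrow> int^2^2" where
  "mat22 a b c d = vector [vector [a, b], vector [c, d]]"

lemma mat22_nth [simp]:
  "mat22 a b c d $ 1 $ 1 = a" "mat22 a b c d $ 1 $ 2 = b"
  "mat22 a b c d $ 2 $ 1 = c" "mat22 a b c d $ 2 $ 2 = d"
  by (simp_all add: mat22_def)

lemma mat22_eq_iff:
  fixes A B :: "int^2^2"
  shows "A = B \<longleftrightarrow> A$1$1 = B$1$1 \<and> A$1$2 = B$1$2 \<and> A$2$1 = B$2$1 \<and> A$2$2 = B$2$2"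
  by (auto simp: vec_eq_iff forall_2)

lemma mult22_nth [simp]:
  fixes A B :: "int^2^2"
  shows "(A ** B) $ 1 $ 1 = A$1$1 * B$1$1 + A$1$2 * B$2$1"
    "(A ** B) $ 1 $ 2 = A$1$1 * B$1$2 + A$1$2 * B$2$2"
    "(A ** B) $ 2 $ 1 = A$2$1 * B$1$1 + A$2$2 * B$2$1"
    "(A ** B) $ 2 $ 2 = A$2$1 * B$1$2 + A$2$2 * B$2$2"
  by (simp_all add: matrix_matrix_mult_def sum_2)

lemma mat1_nth [simp]:
  "(mat 1 :: int^2^2) $ 1 $ 1 = 1" "(mat 1 :: int^2^2) $ 1 $ 2 = 0"
  "(mat 1 :: int^2^2) $ 2 $ 1 = 0" "(mat 1 :: int^2^2) $ 2 $ 2 = 1"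
  by (simp_all add: mat_def)

text \<open>The adjugate serves as the inverse at determinant 1. It is a total integral polynomial
  expression, so identities between inverses reduce to algebra in the entries.\<close>

definition adj2 :: "int^2^2 \<Rightarrow> int^2^2" where
  "adj2 A = mat22 (A$2$2) (- A$1$2) (- A$2$1) (A$1$1)"

lemma adj2_nth [simp]:
  "adj2 A $ 1 $ 1 = A$2$2" "adj2 A $ 1 $ 2 = - A$1$2"
  "adj2 A $ 2 $ 1 = - A$2$1" "adj2 A $ 2 $ 2 = A$1$1"
  by (simp_all add: adj2_def)

lemma det_adj2 [simp]: "det (adj2 A) = det A"
  by (simp add: det_2 algebra_simps)

lemma adj2_adj2 [simp]: "adj2 (adj2 A) = A"
  by (simp add: mat22_eq_iff)

lemma adj2_mat1 [simp]: "adj2 (mat 1) = mat 1"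
  by (simp add: mat22_eq_iff)

lemma adj2_mult: "adj2 (A ** B) = adj2 B ** adj2 A"
  by (simp add: mat22_eq_iff algebra_simps)

lemma adj2_left: "det A = 1 \<Longrightarrow> adj2 A ** A = mat 1"
  by (simp add: mat22_eq_iff det_2 algebra_simps)

lemma adj2_right: "det A = 1 \<Longrightarrow> A ** adj2 A = mat 1"
  by (simp add: mat22_eq_iff det_2 algebra_simps)

lemma adj2_cancel:
  "det A = 1 \<Longrightarrow> adj2 A ** (A ** B) = B" "det A = 1 \<Longrightarrow> A ** (adj2 A ** B) = B"
  by (simp_all add: matrix_mul_assoc adj2_left adj2_right)

lemma left_mult_cancel:
  assumes "det A = 1" "A ** B = A ** C" shows "B = (C :: int^2^2)"
  by (metis adj2_cancel(1) assms)

lemma carrier_SL2Z: "A \<in> carrier SL2Z \<longleftrightarrow> det A = 1"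
  by (simp add: SL2Z_def)

lemma mult_SL2Z [simp]: "mult SL2Z A B = A ** B"
  by (simp add: SL2Z_def)

lemma one_SL2Z [simp]: "one SL2Z = mat 1"
  by (simp add: SL2Z_def)

lemma inv_SL2Z:
  assumes "det A = 1" shows "m_inv SL2Z A = adj2 A"
  using group.inv_equality[OF group_SL2Z, of "adj2 A" A] assms
  by (simp add: carrier_SL2Z adj2_left)

text \<open>The square of \<open>frob_norm\<close>, kept as an integer so that finiteness and gaps
  between values are immediate.\<close>

definition nsq :: "int^2^2 \<Rightarrow> int" where
  "nsq A = (A$1$1)\<^sup>2 + (A$1$2)\<^sup>2 + (A$2$1)\<^sup>2 + (A$2$2)\<^sup>2"

lemma nsq_nonneg [simp]: "nsq A \<ge> 0"
  by (simp add: nsq_def)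

lemma nsq_adj2 [simp]: "nsq (adj2 A) = nsq A"
  by (simp add: nsq_def)

lemma frob_norm_sq: "(frob_norm A)\<^sup>2 = real_of_int (nsq A)"
  unfolding frob_norm_def nsq_def by (simp add: sum_2 add_nonneg_nonneg)

lemma frob_norm_nonneg [simp]: "frob_norm A \<ge> 0"
  by (simp add: frob_norm_def sum_nonneg)

lemma frob_norm_eq_sqrt: "frob_norm A = sqrt (real_of_int (nsq A))"
  using frob_norm_sq frob_norm_nonneg by (metis real_sqrt_unique)

lemma frob_norm_adj2 [simp]: "frob_norm (adj2 A) = frob_norm A"
  by (simp add: frob_norm_eq_sqrt)

lemma two_prod_le_squares: "2 * x * y \<le> x\<^sup>2 + (y::int)\<^sup>2"
  using zero_le_power2[of "x - y"] by (simp add: power2_eq_square algebra_simps)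

lemma nsq_ge_2:
  assumes "det A = 1" shows "nsq A \<ge> 2"
proof -
  have "2 * (A$1$1 * A$2$2 - A$1$2 * A$2$1) \<le> nsq A"
    using two_prod_le_squares[of "A$1$1" "A$2$2"] two_prod_le_squares[of "A$1$2" "- (A$2$1)"]
    by (simp add: nsq_def)
  with assms show ?thesis by (simp add: det_2)
qed

lemma frob_norm_ge_1: "det A = 1 \<Longrightarrow> frob_norm A \<ge> 1"
  using nsq_ge_2[of A] by (simp add: frob_norm_eq_sqrt)

lemma frob_norm_pos: "det A = 1 \<Longrightarrow> frob_norm A > 0"
  using frob_norm_ge_1[of A] by linarith

lemma cauchy2_int: "(a * x + b * y)\<^sup>2 \<le> (a\<^sup>2 + b\<^sup>2) * (x\<^sup>2 + (y::int)\<^sup>2)"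
proof -
  have "(a\<^sup>2 + b\<^sup>2) * (x\<^sup>2 + y\<^sup>2) - (a * x + b * y)\<^sup>2 = (a * y - b * x)\<^sup>2"
    by (simp add: power2_eq_square algebra_simps)
  then show ?thesis by (smt (verit) zero_le_power2)
qed

lemma nsq_mult: "nsq (A ** B) \<le> nsq A * nsq B"
proof -
  have "nsq (A ** B) \<le> ((A$1$1)\<^sup>2 + (A$1$2)\<^sup>2) * ((B$1$1)\<^sup>2 + (B$2$1)\<^sup>2)
    + ((A$1$1)\<^sup>2 + (A$1$2)\<^sup>2) * ((B$1$2)\<^sup>2 + (B$2$2)\<^sup>2)
    + ((A$2$1)\<^sup>2 + (A$2$2)\<^sup>2) * ((B$1$1)\<^sup>2 + (B$2$1)\<^sup>2)
    + ((A$2$1)\<^sup>2 + (A$2$2)\<^sup>2) * ((B$1$2)\<^sup>2 + (B$2$2)\<^sup>2)"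
    unfolding nsq_def mult22_nth by (intro add_mono cauchy2_int)
  also have "\<dots> = nsq A * nsq B" by (simp add: nsq_def algebra_simps)
  finally show ?thesis .
qed

lemma frob_norm_mult: "frob_norm (A ** B) \<le> frob_norm A * frob_norm B"
proof -
  have "real_of_int (nsq (A ** B)) \<le> real_of_int (nsq A * nsq B)"
    using nsq_mult of_int_le_iff by blast
  then show ?thesis
    unfolding frob_norm_eq_sqrt real_sqrt_mult[symmetric] by simp
qed

lemma frob_norm_mult_ge:
  assumes "det A = 1" shows "frob_norm B \<le> frob_norm A * frob_norm (A ** B)"
  using frob_norm_mult[of "adj2 A" "A ** B"] assms by (simp add: adj2_cancel)

lemma abs_le_square_int: "\<bar>x\<bar> \<le> (x::int)\<^sup>2"
proof (cases "x = 0")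
  case False
  then have "1 \<le> \<bar>x\<bar>" by linarith
  then have "\<bar>x\<bar> * 1 \<le> \<bar>x\<bar> * \<bar>x\<bar>" by (intro mult_left_mono) auto
  then show ?thesis by (simp add: power2_eq_square)
qed simp

lemma finite_nsq_le: "finite {A. nsq A \<le> K}"
proof -
  let ?I = "{-K..K}"
  have "{A. nsq A \<le> K} \<subseteq> (\<lambda>(a,b,c,d). mat22 a b c d) ` (?I \<times> ?I \<times> ?I \<times> ?I)"
  proof
    fix A assume "A \<in> {A. nsq A \<le> K}"
    then have "nsq A \<le> K" by simp
    then have "\<bar>A$1$1\<bar> \<le> K" "\<bar>A$1$2\<bar> \<le> K" "\<bar>A$2$1\<bar> \<le> K" "\<bar>A$2$2\<bar> \<le> K"
      using abs_le_square_int[of "A$1$1"] abs_le_square_int[of "A$1$2"]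
        abs_le_square_int[of "A$2$1"] abs_le_square_int[of "A$2$2"]
        zero_le_power2[of "A$1$1"] zero_le_power2[of "A$1$2"]
        zero_le_power2[of "A$2$1"] zero_le_power2[of "A$2$2"]
      unfolding nsq_def by linarith+
    then have "(A$1$1, A$1$2, A$2$1, A$2$2) \<in> ?I \<times> ?I \<times> ?I \<times> ?I" by auto
    moreover have "A = (\<lambda>(a,b,c,d). mat22 a b c d) (A$1$1, A$1$2, A$2$1, A$2$2)"
      by (simp add: mat22_eq_iff)
    ultimately show "A \<in> (\<lambda>(a,b,c,d). mat22 a b c d) ` (?I \<times> ?I \<times> ?I \<times> ?I)"
      by (rule rev_image_eqI)
  qed
  then show ?thesis by (rule finite_subset) auto
qed

lemma finite_frob_norm_le: "finite {A. frob_norm A \<le> T}"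
proof -
  have "{A. frob_norm A \<le> T} \<subseteq> {A. nsq A \<le> \<lceil>T\<^sup>2\<rceil>}"
  proof safe
    fix A assume "frob_norm A \<le> T"
    then have "(frob_norm A)\<^sup>2 \<le> T\<^sup>2" by (intro power_mono) auto
    then have "real_of_int (nsq A) \<le> T\<^sup>2" by (simp add: frob_norm_sq)
    then show "nsq A \<le> \<lceil>T\<^sup>2\<rceil>" by linarith
  qed
  then show ?thesis using finite_nsq_le finite_subset by blast
qed

lemma finite_frob_norm_less: "finite {A. A \<in> G \<and> frob_norm A < T}"
  by (rule finite_subset[OF _ finite_frob_norm_le[of T]]) auto

section \<open>Separation by edges of the Farey tessellation\<close>

text \<open>Let \<open>\<rho> = exp (\<i> \<pi> / 3)\<close>, the centre of the ideal triangle \<open>0, 1, \<infinity>\<close>. The sign of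
  \<open>side A\<close> tells on which side of the geodesic from \<open>0\<close> to \<open>\<infinity>\<close> the point \<open>A \<rho>\<close> lies, so that
  \<open>sep h g g'\<close> says that the Farey edge \<open>h (0, \<infinity>)\<close> separates \<open>g \<rho>\<close> from \<open>g' \<rho>\<close>.
  In terms of the form \<open>2 (x\<^sup>2 + x y + y\<^sup>2)\<close>, the numbers \<open>gram1 A\<close>, \<open>gram2 A\<close>, \<open>side A\<close> are the
  entries of the Gram matrix of the rows of \<open>A\<close>.\<close>

definition side :: "int^2^2 \<Rightarrow> int" where
  "side A = 2 * (A$1$1 * A$2$1 + A$1$2 * A$2$2) + A$1$1 * A$2$2 + A$1$2 * A$2$1"

definition gram1 :: "int^2^2 \<Rightarrow> int" where
  "gram1 A = 2 * ((A$1$1)\<^sup>2 + A$1$1 * A$1$2 + (A$1$2)\<^sup>2)"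

definition gram2 :: "int^2^2 \<Rightarrow> int" where
  "gram2 A = 2 * ((A$2$1)\<^sup>2 + A$2$1 * A$2$2 + (A$2$2)\<^sup>2)"

definition sep :: "int^2^2 \<Rightarrow> int^2^2 \<Rightarrow> int^2^2 \<Rightarrow> bool" where
  "sep h g g' \<longleftrightarrow> (side (adj2 h ** g) > 0) \<noteq> (side (adj2 h ** g') > 0)"

text \<open>At determinant 1 the number \<open>side A\<close> is odd. This is the reason for the
  base point \<rho>: no point of its orbit lies on a Farey edge, and \<open>sep\<close> has no
  boundary case.\<close>

lemma side_nonzero: assumes "det A = 1" shows "side A \<noteq> 0"
proof
  assume "side A = 0"
  moreover have "side A = 2 * (A$1$1 * A$2$1 + A$1$2 * A$2$2 + A$1$2 * A$2$1) + 1"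
    using assms by (simp add: side_def det_2)
  ultimately show False by presburger
qed

text \<open>The matrix of the form has determinant 3.\<close>

lemma gram_det: assumes "det A = 1" shows "gram1 A * gram2 A = 3 + (side A)\<^sup>2"
proof -
  have "gram1 A * gram2 A - (side A)\<^sup>2 = 3 * (det A)\<^sup>2"
    by (simp add: gram1_def gram2_def side_def det_2 power2_eq_square algebra_simps)
  with assms show ?thesis by simp
qed

lemma form_nonneg: "x\<^sup>2 + x * y + y\<^sup>2 \<ge> (0::int)"
proof -
  have "2 * (x\<^sup>2 + x * y + y\<^sup>2) = x\<^sup>2 + y\<^sup>2 + (x + y)\<^sup>2"
    by (simp add: power2_eq_square algebra_simps)
  then show ?thesis by (smt (verit) zero_le_power2)
qed

lemma gram_ge_2:
  assumes "det A = 1" shows "gram1 A \<ge> 2" "gram2 A \<ge> 2"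
proof -
  have p: "gram1 A * gram2 A > 0" using gram_det[OF assms] by (smt (verit) zero_le_power2)
  have "gram1 A \<ge> 0" "gram2 A \<ge> 0" unfolding gram1_def gram2_def by (intro mult_nonneg_nonneg form_nonneg; simp)+
  with p have "gram1 A > 0" "gram2 A > 0" by (auto simp: zero_less_mult_iff)
  moreover have "even (gram1 A)" "even (gram2 A)" by (simp_all add: gram1_def gram2_def)
  ultimately show "gram1 A \<ge> 2" "gram2 A \<ge> 2" by presburger+
qed

lemma gram_ge_nsq: "nsq A \<le> gram1 A + gram2 A"
proof -
  have "gram1 A + gram2 A = nsq A + (A$1$1 + A$1$2)\<^sup>2 + (A$2$1 + A$2$2)\<^sup>2"
    by (simp add: nsq_def gram1_def gram2_def power2_eq_square algebra_simps)
  then show ?thesis by (smt (verit) zero_le_power2)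
qed

lemma gram_le_nsq: "gram1 A + gram2 A \<le> 3 * nsq A"
  using two_prod_le_squares[of "A$1$1" "A$1$2"] two_prod_le_squares[of "A$2$1" "A$2$2"]
  by (simp add: nsq_def gram1_def gram2_def)

text \<open>The form is nonnegative at the difference and at the sum of the two rows.\<close>

lemma side_le_gram: "2 * \<bar>side A\<bar> \<le> gram1 A + gram2 A"
proof -
  have "gram1 A + gram2 A - 2 * side A
      = 2 * ((A$1$1 - A$2$1)\<^sup>2 + (A$1$1 - A$2$1) * (A$1$2 - A$2$2) + (A$1$2 - A$2$2)\<^sup>2)"
    by (simp add: side_def gram1_def gram2_def power2_eq_square algebra_simps)
  moreover have "gram1 A + gram2 A + 2 * side A
      = 2 * ((A$1$1 + A$2$1)\<^sup>2 + (A$1$1 + A$2$1) * (A$1$2 + A$2$2) + (A$1$2 + A$2$2)\<^sup>2)"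
    by (simp add: side_def gram1_def gram2_def power2_eq_square algebra_simps)
  ultimately have "gram1 A + gram2 A - 2 * side A \<ge> 0" "gram1 A + gram2 A + 2 * side A \<ge> 0"
    by (simp_all only: mult_nonneg_nonneg form_nonneg zero_le_numeral)
  then show ?thesis by linarith
qed

text \<open>Both sides are the trace of the adjugate of the Gram matrix of \<open>A\<close> times
  the Gram matrix of \<open>B\<close>. At determinant 1 this is 6 cosh of the hyperbolic distance
  between A \<rho> and B \<rho>.\<close>

lemma gram_quotient_identity:
  "2 * gram1 (adj2 A ** B) + 2 * gram2 (adj2 A ** B) - 2 * side (adj2 A ** B)
    = gram2 A * gram1 B + gram1 A * gram2 B - 2 * (side A * side B)"
  by (simp add: side_def gram1_def gram2_def power2_eq_square algebra_simps)

lemma gram_quotient_le: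
  "gram2 A * gram1 B + gram1 A * gram2 B - 2 * (side A * side B) \<le> 9 * nsq (adj2 A ** B)"
  using gram_quotient_identity[of A B] gram_le_nsq[of "adj2 A ** B"] side_le_gram[of "adj2 A ** B"]
  by linarith

lemma sep_side_mult:
  assumes "det h = 1" "det g = 1" "det g' = 1"
  shows "sep h g g' \<longleftrightarrow> side (adj2 h ** g) * side (adj2 h ** g') < 0"
proof -
  have "side (adj2 h ** g) \<noteq> 0" "side (adj2 h ** g') \<noteq> 0"
    by (intro side_nonzero; simp add: det_mul assms)+
  then show ?thesis unfolding sep_def by (auto simp: mult_less_0_iff)
qed

lemma sep_mult_left:
  assumes "det k = 1" shows "sep (k ** h) (k ** g) (k ** g') \<longleftrightarrow> sep h g g'"
  unfolding sep_def adj2_mult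
  by (simp add: matrix_mul_assoc[symmetric] adj2_cancel assms)

text \<open>An edge is represented by four matrices here, since \<open>h\<close> may change its sign
  and its orientation.\<close>

definition seps :: "int^2^2 \<Rightarrow> int^2^2 \<Rightarrow> (int^2^2) set" where
  "seps g g' = {h. det h = 1 \<and> sep h g g'}"

text \<open>When the two values of \<open>side\<close> have opposite signs, no term of the quotient
  formula is negative, so the Gram trace of the inverse of \<open>h\<close> is bounded by the norm
  of \<open>g\<close>. Hence only finitely many edges separate two points.\<close>

lemma seps_nsq_le:
  assumes "h \<in> seps (mat 1) g" "det g = 1" shows "2 * nsq h \<le> 9 * nsq g"
proof -
  let ?A = "adj2 h" and ?B = "adj2 h ** g"
  from assms have d: "det h = 1" "det ?A = 1" "det ?B = 1" by (auto simp: seps_def det_mul)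
  have neg: "side ?A * side ?B < 0"
    using assms d sep_side_mult[of h "mat 1" g] by (simp add: seps_def)
  have g: "adj2 ?A ** ?B = g" using d by (simp add: adj2_cancel)
  have "2 * (gram1 ?A + gram2 ?A) = gram2 ?A * 2 + gram1 ?A * 2" by simp
  also have "\<dots> \<le> gram2 ?A * gram1 ?B + gram1 ?A * gram2 ?B"
    using gram_ge_2[OF d(2)] gram_ge_2[OF d(3)] by (intro add_mono mult_left_mono; simp)
  also have "\<dots> \<le> gram2 ?A * gram1 ?B + gram1 ?A * gram2 ?B - 2 * (side ?A * side ?B)"
    using neg by simp
  also have "\<dots> \<le> 9 * nsq g"
    using gram_quotient_le[of ?A ?B] unfolding g .
  finally have "2 * (gram1 ?A + gram2 ?A) \<le> 9 * nsq g" .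
  with gram_ge_nsq[of ?A] show ?thesis by simp
qed

lemma finite_seps_1: assumes "det g = 1" shows "finite (seps (mat 1) g)"
proof (rule finite_subset[OF _ finite_nsq_le[of "9 * nsq g"]])
  show "seps (mat 1) g \<subseteq> {A. nsq A \<le> 9 * nsq g}"
  proof
    fix h assume "h \<in> seps (mat 1) g"
    with seps_nsq_le[OF this assms] nsq_nonneg[of h] show "h \<in> {A. nsq A \<le> 9 * nsq g}"
      by (smt (verit) mem_Collect_eq)
  qed
qed

lemma seps_mult_left:
  assumes "det k = 1" shows "seps (k ** g) (k ** g') = (**) k ` seps g g'"
proof
  show "(**) k ` seps g g' \<subseteq> seps (k ** g) (k ** g')"
    using assms by (auto simp: seps_def sep_mult_left det_mul)
  show "seps (k ** g) (k ** g') \<subseteq> (**) k ` seps g g'"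
  proof
    fix h assume h: "h \<in> seps (k ** g) (k ** g')"
    then have "h = k ** (adj2 k ** h)" using assms by (simp add: adj2_cancel)
    moreover from h have "adj2 k ** h \<in> seps g g'"
      using assms sep_mult_left[OF assms, of "adj2 k ** h" g g']
      by (simp add: seps_def det_mul adj2_cancel)
    ultimately show "h \<in> (**) k ` seps g g'" by blast
  qed
qed

lemma inj_on_mult_left: "det k = 1 \<Longrightarrow> inj_on ((**) k) (X :: (int^2^2) set)"
  by (rule inj_onI) (rule left_mult_cancel)

lemma card_seps_mult_left:
  "det k = 1 \<Longrightarrow> card (seps (k ** g) (k ** g')) = card (seps g g')"
  by (subst seps_mult_left) (auto intro: card_image inj_on_mult_left)

text \<open>\<open>matS\<close> reverses the edge from 0 to \<infinity>, and \<open>matU\<close>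
  fixes \<rho> and permutes the three sides of its triangle.\<close>

definition matS :: "int^2^2" where "matS = mat22 0 (-1) 1 0"
definition matU :: "int^2^2" where "matU = mat22 1 (-1) 1 0"

lemma det_matS [simp]: "det matS = 1" and det_matU [simp]: "det matU = 1"
  by (simp_all add: matS_def matU_def det_2)

lemma side_matU: "side (A ** matU) = side A"
  by (simp add: side_def matU_def algebra_simps)

lemma sep_matS: assumes "det h = 1" "det g = 1" "det g' = 1"
  shows "sep (h ** matS) g g' \<longleftrightarrow> sep h g g'"
proof -
  have *: "side (adj2 (h ** matS) ** k) = - side (adj2 h ** k)" for k
    by (simp add: side_def matS_def algebra_simps)
  have "sep (h ** matS) g g' \<longleftrightarrow> side (adj2 (h ** matS) ** g) * side (adj2 (h ** matS) ** g') < 0"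
    by (rule sep_side_mult) (simp_all add: assms det_mul)
  also have "\<dots> \<longleftrightarrow> sep h g g'" unfolding * by (simp add: sep_side_mult assms)
  finally show ?thesis .
qed

lemma sep_minus: "sep (- h) g g' \<longleftrightarrow> sep h g g'"
proof -
  have "side (adj2 (- h) ** k) = side (adj2 h ** k)" for k
    by (simp add: side_def algebra_simps)
  then show ?thesis by (simp add: sep_def)
qed

text \<open>The triangles of \<rho> and of its image under \<open>matS\<close> share one edge, with
  exactly these four representatives. With a, b, c, d the entries of the inverse of
  \<open>h\<close>, the sign condition reads 4 (ac + bd)^2 < (ad + bc)^2 = 1 + 4 (ac)(bd), which
  leaves only ac = bd = 0.\<close>

lemma seps_1_S: assumes "h \<in> seps (mat 1) matS"
  shows "h \<in> {mat 1, - mat 1, matS, - matS}"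
proof -
  define a b c d where "a = h$2$2" "b = - h$1$2" "c = - h$2$1" "d = h$1$1"
  note abcd = this
  have det: "a * d - b * c = 1"
    using assms by (simp add: seps_def det_2 abcd algebra_simps)
  have "side (adj2 h) * side (adj2 h ** matS) < 0"
    using assms sep_side_mult[of h "mat 1" matS] by (simp add: seps_def)
  moreover have "side (adj2 h) = 2 * (a*c + b*d) + (a*d + b*c)"
    by (simp add: side_def abcd)
  moreover have "side (adj2 h ** matS) = 2 * (a*c + b*d) - (a*d + b*c)"
    by (simp add: side_def matS_def abcd algebra_simps)
  ultimately have "(2 * (a*c + b*d) + (a*d + b*c)) * (2 * (a*c + b*d) - (a*d + b*c)) < 0"
    by simp
  then have lt: "4 * (a*c + b*d)\<^sup>2 < (a*d + b*c)\<^sup>2"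
    by (simp add: power2_eq_square algebra_simps)
  have "(a*d + b*c)\<^sup>2 = (a*d - b*c)\<^sup>2 + 4 * ((a*c) * (b*d))"
    by (simp add: power2_eq_square algebra_simps)
  with lt det have "4 * (a*c + b*d)\<^sup>2 < 1 + 4 * ((a*c) * (b*d))" by simp
  moreover have "4 * (a*c + b*d)\<^sup>2 = 2 * (a*c + b*d)\<^sup>2 + 2 * (a*c)\<^sup>2 + 2 * (b*d)\<^sup>2 + 4 * ((a*c) * (b*d))"
    by (simp add: power2_eq_square algebra_simps)
  ultimately have "2 * (a*c)\<^sup>2 + 2 * (b*d)\<^sup>2 < 1"
    using zero_le_power2[of "a*c + b*d"] by linarith
  then have "(a*c)\<^sup>2 = 0" "(b*d)\<^sup>2 = 0"
    using zero_le_power2[of "a*c"] zero_le_power2[of "b*d"] by linarith+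
  then have ac: "a = 0 \<or> c = 0" and bd: "b = 0 \<or> d = 0" by auto
  have "(a = 0 \<and> d = 0 \<and> b * c = -1) \<or> (b = 0 \<and> c = 0 \<and> a * d = 1)"
    using ac bd det by auto
  then show ?thesis
  proof
    assume *: "a = 0 \<and> d = 0 \<and> b * c = -1"
    then have "b * (- c) = 1" by simp
    then have "(b = 1 \<and> - c = 1) \<or> (b = -1 \<and> - c = -1)" by (simp only: zmult_eq_1_iff)
    with * show ?thesis by (auto simp: abcd mat22_eq_iff matS_def)
  next
    assume *: "b = 0 \<and> c = 0 \<and> a * d = 1"
    then have "(a = 1 \<and> d = 1) \<or> (a = -1 \<and> d = -1)" by (simp add: zmult_eq_1_iff)
    with * show ?thesis by (auto simp: abcd mat22_eq_iff)
  qed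
qed

text \<open>If no side of the triangle of \<rho> separates, then g \<rho> lies in this triangle. In
  numbers, the three signs say that \<open>side g\<close> is positive and less than
  \<open>gram1 g\<close> and \<open>gram2 g\<close>, and \<open>gram_det\<close> then forces
  \<open>side g\<close> = 1.\<close>

lemma nsq_le_4_if_not_sep:
  assumes "det g = 1" "\<not> sep (mat 1) (mat 1) g" "\<not> sep matU (mat 1) g"
    "\<not> sep (matU ** matU) (mat 1) g"
  shows "nsq g \<le> 4"
proof -
  have 1: "side g > 0" using assms(2) by (simp add: sep_def side_def)
  have 2: "side (adj2 matU ** g) > 0" using assms(3) by (simp add: sep_def) (simp add: side_def matU_def)
  have 3: "side (adj2 (matU ** matU) ** g) > 0"
    using assms(4) by (simp add: sep_def) (simp add: side_def matU_def)
  have e2: "side (adj2 matU ** g) = gram2 g - side g"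
    by (simp add: side_def gram2_def matU_def power2_eq_square algebra_simps)
  have e3: "side (adj2 (matU ** matU) ** g) = gram1 g - side g"
    by (simp add: side_def gram1_def matU_def power2_eq_square algebra_simps)
  have "(side g + 1) * (side g + 1) \<le> gram1 g * gram2 g"
    using 1 2 3 e2 e3 by (intro mult_mono) auto
  with gram_det[OF assms(1)] have "side g \<le> 1" by (simp add: power2_eq_square algebra_simps)
  with 1 have "side g = 1" by simp
  with gram_det[OF assms(1)] have p: "gram1 g * gram2 g = 4" by simp
  have "gram1 g * 2 \<le> gram1 g * gram2 g" "2 * gram2 g \<le> gram1 g * gram2 g"
    using gram_ge_2[OF assms(1)] by (intro mult_left_mono mult_right_mono; simp)+
  with p gram_ge_nsq[of g] show ?thesis by linarith
qed

text \<open>Crossing the side of the central triangle that faces g \<rho> leads to the neighbouring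
  centre t \<rho>, and the crossed edge is the only one between the two centres. So every edge that
  separates t \<rho> from g \<rho> also separates \<rho> from g \<rho>, while the crossed edge is
  lost.\<close>

lemma card_seps_step:
  assumes "det g = 1" "nsq g > 4"
  obtains t where "t \<in> {matS, matU ** matS, matU ** matU ** matS}"
    "card (seps (mat 1) (adj2 t ** g)) < card (seps (mat 1) g)"
proof -
  obtain h where h: "h \<in> {mat 1, matU, matU ** matU}" "sep h (mat 1) g"
    using nsq_le_4_if_not_sep[OF assms(1)] assms(2) by force
  have d: "det h = 1" using h by (auto simp: det_mul)
  define t where "t = h ** matS"
  have dt: "det t = 1" by (simp add: t_def det_mul d)
  have "side (adj2 h) > 0"
    using h by (auto simp: side_def matU_def)
  moreover have "side (adj2 h ** t) < 0" unfolding t_def adj2_cancel(1)[OF d]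
    by (simp add: side_def matS_def)
  ultimately have ht: "sep h (mat 1) t" by (simp add: sep_def)
  have sides: "(side (adj2 k ** h) > 0) = (side (adj2 k) > 0)" for k
    using h by (auto simp: side_matU matrix_mul_assoc)
  have all: "sep k (mat 1) g" if "k \<in> seps (mat 1) t" for k
  proof -
    have "sep k (h ** mat 1) (h ** matS)"
      using that sides[of k] by (simp add: seps_def sep_def t_def)
    then have "sep (h ** (adj2 h ** k)) (h ** mat 1) (h ** matS)" by (simp add: adj2_cancel d)
    then have "sep (adj2 h ** k) (mat 1) matS" by (simp only: sep_mult_left[OF d])
    then have "adj2 h ** k \<in> seps (mat 1) matS"
      using that d by (simp add: seps_def det_mul)
    then have "adj2 h ** k \<in> {mat 1, - mat 1, matS, - matS}" by (rule seps_1_S)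
    then have "k \<in> {h ** mat 1, h ** (- mat 1), h ** matS, h ** (- matS)}"
      using adj2_cancel(2)[OF d, of k] by auto
    moreover have "h ** (- mat 1) = - h" "h ** (- matS) = - (h ** matS)"
      by (simp_all add: mat22_eq_iff)
    ultimately show ?thesis
      using h(2) sep_matS[OF d, of "mat 1" g] assms(1) by (auto simp: sep_minus)
  qed
  have sub: "seps t g \<subset> seps (mat 1) g"
  proof
    show "seps t g \<subseteq> seps (mat 1) g"
    proof
      fix k assume k: "k \<in> seps t g"
      show "k \<in> seps (mat 1) g"
      proof (rule ccontr)
        assume n: "k \<notin> seps (mat 1) g"
        with k have "k \<in> seps (mat 1) t" by (auto simp: seps_def sep_def)
        with all n k show False by (auto simp: seps_def)
      qed
    qed
    have "h \<in> seps (mat 1) g" "h \<notin> seps t g"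
      using h(2) ht d by (auto simp: seps_def sep_def)
    then show "seps t g \<noteq> seps (mat 1) g" by blast
  qed
  have "card (seps (mat 1) (adj2 t ** g)) = card (seps t g)"
    using card_seps_mult_left[OF dt, of "mat 1" "adj2 t ** g"] by (simp add: adj2_cancel dt)
  also have "\<dots> < card (seps (mat 1) g)"
    by (rule psubset_card_mono[OF finite_seps_1[OF assms(1)] sub])
  finally have "card (seps (mat 1) (adj2 t ** g)) < card (seps (mat 1) g)" .
  moreover have "t \<in> {matS, matU ** matS, matU ** matU ** matS}" using h t_def by auto
  ultimately show ?thesis using that by blast
qed

text \<open>One crossing changes the norm by at most a bounded factor, so a matrix of large norm is
  many crossings away from the identity.\<close>

lemma card_seps_large: "\<exists>T. \<forall>g. det g = 1 \<longrightarrow> nsq g > T \<longrightarrow> card (seps (mat 1) g) \<ge> C"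
proof (induction C)
  case (Suc C)
  then obtain T where T: "\<And>g. det g = 1 \<Longrightarrow> nsq g > T \<Longrightarrow> card (seps (mat 1) g) \<ge> C" by blast
  have "card (seps (mat 1) g) \<ge> Suc C" if g: "det g = 1" "nsq g > max 4 (10 * \<bar>T\<bar>)" for g
  proof -
    obtain t where t: "t \<in> {matS, matU ** matS, matU ** matU ** matS}"
      "card (seps (mat 1) (adj2 t ** g)) < card (seps (mat 1) g)"
      using card_seps_step[OF g(1)] g(2) by auto
    have dt: "det t = 1" and nt: "nsq t \<le> 10"
      using t(1) by (auto simp: det_mul) (auto simp: nsq_def matS_def matU_def)
    have "nsq g \<le> nsq t * nsq (adj2 t ** g)"
      using nsq_mult[of t "adj2 t ** g"] by (simp add: adj2_cancel dt)
    also have "\<dots> \<le> 10 * nsq (adj2 t ** g)" using nt by (intro mult_right_mono) auto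
    finally have "nsq (adj2 t ** g) > T" using g(2) by linarith
    with T[of "adj2 t ** g"] dt g(1) t(2) show ?thesis by (simp add: det_mul)
  qed
  then show ?case by blast
qed auto

section \<open>Free subgroups without parabolic elements\<close>

definition matR :: "int \<Rightarrow> int^2^2" where "matR n = mat22 1 n 0 1"

lemma det_matR [simp]: "det (matR n) = 1"
  by (simp add: matR_def det_2)

lemma side_matR: "side (adj2 (h ** matR n) ** k) = side (adj2 h ** k) - n * gram2 (adj2 h ** k)"
  by (simp add: side_def gram2_def matR_def power2_eq_square algebra_simps)

text \<open>\<open>side A\<close> / \<open>gram2 A\<close> is the real part and
  \<open>gram1 A\<close> / \<open>gram2 A\<close> the squared modulus of A \<rho>, and its imaginary
  part is below 1 because \<open>gram2 A\<close> \<ge> 2.\<close>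

lemma gram_bound_if_side_bound:
  assumes "det A = 1" "\<bar>side A\<bar> \<le> m * gram2 A"
  shows "gram1 A \<le> (1 + m\<^sup>2) * gram2 A"
proof -
  have g: "gram2 A \<ge> 2" by (rule gram_ge_2(2)[OF assms(1)])
  have "(side A)\<^sup>2 \<le> (m * gram2 A)\<^sup>2" using assms(2)
    by (rule abs_le_square_iff[THEN iffD1, OF order_trans[OF _ abs_ge_self]])
  moreover have "2 * 2 \<le> gram2 A * gram2 A" using g by (intro mult_mono) auto
  ultimately have "gram1 A * gram2 A \<le> ((1 + m\<^sup>2) * gram2 A) * gram2 A"
    using gram_det[OF assms(1)] by (simp add: power2_eq_square algebra_simps)
  then show ?thesis using g by (simp add: mult_le_cancel_right)
qed

lemma bounded_on_finite: "finite F \<Longrightarrow> \<exists>K>0. \<forall>x\<in>F. f x \<le> (K::real)"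
proof -
  assume "finite F"
  then obtain K where "\<forall>x\<in>F. f x \<le> K" using bdd_above_finite[of "f ` F"] by (auto simp: bdd_above_def)
  then show ?thesis by (intro exI[of _ "max K 1"]) (auto intro: order_trans)
qed

text \<open>1 is an eigenvalue, and at determinant 1 the characteristic polynomial has the value 2 -
  trace at 1.\<close>

lemma trace2_if_fixes:
  fixes x y :: int
  assumes "p * s - q * r = 1" "p * x + q * y = x" "r * x + s * y = y" "x \<noteq> 0 \<or> y \<noteq> 0"
  shows "p + s = 2"
proof -
  have "((p - 1) * (s - 1) - q * r) * x = 0" "((p - 1) * (s - 1) - q * r) * y = 0"
  proof -
    have e: "(p - 1) * x = - q * y" "r * x = (1 - s) * y" "(s - 1) * y = - r * x" "q * y = (1 - p) * x"
      using assms(2,3) by (simp_all add: algebra_simps)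
    have "((p - 1) * (s - 1) - q * r) * x = (s - 1) * ((p - 1) * x) - q * (r * x)"
      by (simp add: algebra_simps)
    also have "\<dots> = 0" unfolding e(1,2) by (simp add: algebra_simps)
    finally show "((p - 1) * (s - 1) - q * r) * x = 0" .
    have "((p - 1) * (s - 1) - q * r) * y = (p - 1) * ((s - 1) * y) - r * (q * y)"
      by (simp add: algebra_simps)
    also have "\<dots> = 0" unfolding e(3,4) by (simp add: algebra_simps)
    finally show "((p - 1) * (s - 1) - q * r) * y = 0" .
  qed
  with assms(4) have "(p - 1) * (s - 1) - q * r = 0" by auto
  with assms(1) show ?thesis by (simp add: algebra_simps)
qed

lemma trace_int2: "trace (A :: int^2^2) = A$1$1 + A$2$2"
  by (simp add: trace_def sum_2)

locale free_nonparabolic =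
  fixes \<Gamma> S :: "(int^2^2) set"
  assumes subgroup_\<Gamma>: "subgroup \<Gamma> SL2Z"
    and finite_S: "finite S"
    and free_S: "free_generating_set SL2Z \<Gamma> S"
    and not_parabolic: "\<gamma> \<in> \<Gamma> \<Longrightarrow> \<not> parabolic \<gamma>"
begin

abbreviation val :: "(int^2^2) letter list \<Rightarrow> int^2^2" where "val \<equiv> word_val SL2Z"
abbreviation red :: "(int^2^2) letter list set" where "red \<equiv> reduced_words S"
abbreviation letters :: "(int^2^2) letter set" where "letters \<equiv> S \<times> UNIV"

lemma \<Gamma>_det: "\<gamma> \<in> \<Gamma> \<Longrightarrow> det \<gamma> = 1"
  using subgroup.mem_carrier[OF subgroup_\<Gamma>] by (simp add: carrier_SL2Z)

lemma \<Gamma>_mult: "\<gamma> \<in> \<Gamma> \<Longrightarrow> \<gamma>' \<in> \<Gamma> \<Longrightarrow> \<gamma> ** \<gamma>' \<in> \<Gamma>"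
  using subgroup.m_closed[OF subgroup_\<Gamma>] by simp

lemma \<Gamma>_one: "mat 1 \<in> \<Gamma>"
  using subgroup.one_closed[OF subgroup_\<Gamma>] by simp

lemma \<Gamma>_adj2: "\<gamma> \<in> \<Gamma> \<Longrightarrow> adj2 \<gamma> \<in> \<Gamma>"
  using subgroup.m_inv_closed[OF subgroup_\<Gamma>] by (metis \<Gamma>_det inv_SL2Z)

lemma S_subset: "S \<subseteq> \<Gamma>"
  using free_S by (simp add: free_generating_set_def)

lemma trace2_imp_one: assumes "\<gamma> \<in> \<Gamma>" "trace \<gamma> = 2" shows "\<gamma> = mat 1"
proof -
  have "trace (- mat 1 :: int^2^2) \<noteq> 2" by (simp add: trace_int2)
  then show ?thesis using not_parabolic[OF assms(1)] assms(2) by (auto simp: parabolic_def)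
qed

lemma letter_val_\<Gamma>: "x \<in> letters \<Longrightarrow> letter_val SL2Z x \<in> \<Gamma>"
  using S_subset \<Gamma>_adj2 \<Gamma>_det by (auto simp: letter_val_def inv_SL2Z)

lemma val_Nil [simp]: "val [] = mat 1" and val_Cons: "val (x # w) = letter_val SL2Z x ** val w"
  by (simp_all add: word_val_def)

lemma val_append: "val (u @ v) = val u ** val v"
  by (induction u) (simp_all add: val_Cons matrix_mul_assoc)

lemma val_\<Gamma>: "w \<in> lists letters \<Longrightarrow> val w \<in> \<Gamma>"
  by (induction rule: lists.induct) (auto simp: \<Gamma>_one val_Cons intro!: \<Gamma>_mult letter_val_\<Gamma>)

lemma red_lists: "w \<in> red \<Longrightarrow> w \<in> lists letters"
  by (simp add: reduced_words_def)

lemma val_red_\<Gamma>: "w \<in> red \<Longrightarrow> val w \<in> \<Gamma>"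
  by (intro val_\<Gamma> red_lists)

lemma inj_on_val: "inj_on val red" and val_image_red: "val ` red = \<Gamma>"
  using free_S by (auto simp: free_generating_set_def bij_betw_def)

lemma obtain_word: assumes "\<gamma> \<in> \<Gamma>" obtains w where "w \<in> red" "\<gamma> = val w"
  using assms val_image_red by blast

lemma red_append: assumes "u @ v \<in> red" shows "u \<in> red" "v \<in> red"
  using assms by (auto simp: reduced_words_def successively_append_iff)

lemma red_take: "w \<in> red \<Longrightarrow> take n w \<in> red" and red_drop: "w \<in> red \<Longrightarrow> drop n w \<in> red"
  using red_append[of "take n w" "drop n w"] by auto

lemma finite_letters: "finite letters"
  using finite_S by simp

lemma finite_red_length: "finite {w \<in> red. length w \<le> n}"
  by (rule finite_subset[OF _ finite_lists_length_le[OF finite_letters, of n]])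
    (auto dest: red_lists)

lemma finite_red_val: "finite F \<Longrightarrow> finite {w \<in> red. val w \<in> F}"
  using finite_vimage_IntI[OF _ inj_on_val, of F] by (simp add: vimage_def Int_def conj_commute)

text \<open>Distinct reduced words have distinct values. Through this lemma discreteness enters:
  whatever confines the value to a finite set bounds the length of the word.\<close>

lemma red_length_bound:
  assumes "finite F" obtains L where "\<And>w. w \<in> red \<Longrightarrow> val w \<in> F \<Longrightarrow> length w \<le> L"
proof -
  obtain K where "\<forall>w\<in>{w \<in> red. val w \<in> F}. real (length w) \<le> K"
    using bounded_on_finite[OF finite_red_val[OF assms], of "\<lambda>w. real (length w)"] by blast
  then have "length w \<le> nat \<lfloor>K\<rfloor>" if "w \<in> red" "val w \<in> F" for w
    using that by (auto simp: le_nat_floor)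
  then show ?thesis using that by blast
qed

section \<open>Edges crossed by the path of a word\<close>

definition step_edges :: "(int^2^2) set" where
  "step_edges = (\<Union>x\<in>letters. seps (mat 1) (letter_val SL2Z x))"

lemma finite_step_edges: "finite step_edges"
  unfolding step_edges_def using letter_val_\<Gamma> \<Gamma>_det
  by (intro finite_UN_I finite_letters finite_seps_1) blast

text \<open>The side of the edge \<open>h\<close> on which the prefixes lie changes at some step j,
  and the inverse of the j-th prefix carries \<open>h\<close> to an edge crossed by a single
  letter.\<close>

lemma crossing:
  assumes "w \<in> lists letters" "i \<le> k" "k \<le> length w" "det h = 1"
    and "sep h (val (take i w)) (val (take k w))"
  shows "\<exists>j\<in>{i..<k}. adj2 (val (take j w)) ** h \<in> step_edges"
  using assms(2,3,5)
proof (induction k rule: dec_induct)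
  case base
  then show ?case by (simp add: sep_def)
next
  case (step k)
  show ?case
  proof (cases "sep h (val (take i w)) (val (take k w))")
    case True
    moreover have "k \<le> length w" using step.prems(1) by simp
    ultimately obtain j where "j \<in> {i..<k}" "adj2 (val (take j w)) ** h \<in> step_edges"
      using step.IH by blast
    then show ?thesis by (intro bexI[of _ j]) auto
  next
    case False
    let ?g = "val (take k w)" and ?x = "letter_val SL2Z (w ! k)"
    have "w ! k \<in> set w" using step.prems(1) by (intro nth_mem) simp
    then have x: "w ! k \<in> letters" using assms(1) by blast
    have "take k w \<in> lists letters" using assms(1) by (blast dest: in_set_takeD)
    then have g: "det ?g = 1" by (intro \<Gamma>_det val_\<Gamma>)
    have "val (take (Suc k) w) = ?g ** ?x"
      using step.prems(1) by (simp add: take_Suc_conv_app_nth val_append val_Cons)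
    with False step.prems(2) have "sep h ?g (?g ** ?x)" unfolding sep_def by simp
    then have "sep (adj2 ?g ** h) (mat 1) ?x"
      using sep_mult_left[OF g, of "adj2 ?g ** h" "mat 1" ?x] by (simp add: adj2_cancel g)
    then have "adj2 ?g ** h \<in> seps (mat 1) ?x" unfolding seps_def mem_Collect_eq
      by (simp only: det_mul det_adj2 g assms(4)) simp
    with x have "adj2 ?g ** h \<in> step_edges" unfolding step_edges_def by (intro UN_I)
    with step.hyps show ?thesis by (intro bexI[of _ k]) auto
  qed
qed

text \<open>The edges \<open>h (matR n) (0, \<infinity>)\<close> form the fan at the cusp \<open>h \<infinity>\<close>. As no element of \<open>\<Gamma>\<close> except \<open>1\<close> fixes
  a cusp, no two edges of a fan are in the same orbit of \<open>\<Gamma>\<close>.\<close>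

lemma fan_card:
  assumes "\<gamma> \<in> \<Gamma>" "det h = 1" "\<And>n. n \<in> J \<Longrightarrow> sep (h ** matR n) (mat 1) \<gamma>"
  shows "card J \<le> card step_edges"
proof -
  obtain w where w: "w \<in> red" "\<gamma> = val w" using assms(1) by (rule obtain_word)
  have "\<forall>n\<in>J. \<exists>j. adj2 (val (take j w)) ** (h ** matR n) \<in> step_edges"
    using crossing[of w 0 "length w" "h ** matR _"] assms w red_lists
    by (fastforce simp: det_mul)
  then obtain j where j: "\<And>n. n \<in> J \<Longrightarrow> adj2 (val (take (j n) w)) ** (h ** matR n) \<in> step_edges"
    by metis
  have "inj_on (\<lambda>n. adj2 (val (take (j n) w)) ** (h ** matR n)) J"
  proof (rule inj_onI)
    fix m n
    let ?a = "val (take (j m) w)" and ?b = "val (take (j n) w)"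
    assume eq: "adj2 ?a ** (h ** matR m) = adj2 ?b ** (h ** matR n)"
    have ab: "?a \<in> \<Gamma>" "?b \<in> \<Gamma>" by (intro val_red_\<Gamma> red_take w)+
    then have det: "det ?a = 1" "det ?b = 1" by (auto intro: \<Gamma>_det)
    let ?g = "?b ** adj2 ?a"
    have g: "?g \<in> \<Gamma>" using ab by (intro \<Gamma>_mult \<Gamma>_adj2)
    have "?g ** (h ** matR m) = ?b ** (adj2 ?b ** (h ** matR n))"
      by (simp add: eq matrix_mul_assoc[symmetric])
    then have "?g ** (h ** matR m) = h ** matR n" by (simp add: adj2_cancel det)
    then have "?g ** ((h ** matR m) ** adj2 (h ** matR m)) = h ** matR n ** adj2 (h ** matR m)"
      by (simp only: matrix_mul_assoc)
    then have g_eq: "?g = h ** matR n ** adj2 (h ** matR m)"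
      by (subst (asm) adj2_right) (simp_all add: det_mul assms(2))
    have "trace ?g = 2 * det h"
      unfolding g_eq by (simp add: trace_int2 matR_def det_2 algebra_simps)
    with g assms(2) have "?g = mat 1" by (intro trace2_imp_one) auto
    with g_eq have "h ** matR n ** adj2 (h ** matR m) = mat 1" by simp
    then have "(h ** matR n) ** (adj2 (h ** matR m) ** (h ** matR m)) = h ** matR m"
      by (simp add: matrix_mul_assoc)
    then have "h ** matR n = h ** matR m"
      by (subst (asm) adj2_left) (simp_all add: det_mul assms(2))
    then have "matR n = matR m" by (rule left_mult_cancel[OF assms(2)])
    then have "matR n $ 1 $ 2 = matR m $ 1 $ 2" by simp
    then show "m = n" by (simp add: matR_def)
  qed
  with j show ?thesis by (intro card_inj_on_le[OF _ _ finite_step_edges]) auto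
qed

text \<open>The range of k has one element more than \<open>fan_card\<close> allows.\<close>

lemma fan_contradiction:
  assumes "\<gamma> \<in> \<Gamma>" "det h = 1" "\<And>k. 0 \<le> k \<Longrightarrow> k \<le> int (card step_edges) \<Longrightarrow> sep (h ** matR (f k)) (mat 1) \<gamma>"
    and "inj f"
  shows False
proof -
  have "card (f ` {0..int (card step_edges)}) \<le> card step_edges"
    using assms by (intro fan_card[OF assms(1,2)]) auto
  moreover have "card (f ` {0..int (card step_edges)}) = card {0..int (card step_edges)}"
    using assms(4) by (intro card_image) (auto intro: inj_on_subset)
  ultimately show False by simp
qed

text \<open>In the coordinate of \<open>h\<close> the edges of the fan are the vertical lines at the
  integers: passing to \<open>h ** matR n\<close> lowers the real part \<open>side\<close> /
  \<open>gram2\<close> by n.\<close>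

lemma sep_matR_iff:
  assumes "det h = 1" "det g = 1"
  shows "sep (h ** matR n) (mat 1) g \<longleftrightarrow>
    (side (adj2 h) - n * gram2 (adj2 h)) * (side (adj2 h ** g) - n * gram2 (adj2 h ** g)) < 0"
proof -
  have "sep (h ** matR n) (mat 1) g \<longleftrightarrow>
      side (adj2 (h ** matR n) ** mat 1) * side (adj2 (h ** matR n) ** g) < 0"
    by (rule sep_side_mult) (simp_all add: det_mul assms)
  then show ?thesis unfolding side_matR by simp
qed

text \<open>In the coordinate of \<open>h\<close> the two points have real parts a / ga and b / gb
  of opposite signs. If one of them exceeded m in absolute value, the lines at 0, 1, ..., m on its
  side would all separate the points, and these are m + 1 edges of one fan.\<close>

lemma fan_bound:
  assumes "\<gamma> \<in> \<Gamma>" "det h = 1" "sep h (mat 1) \<gamma>"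
  defines "m \<equiv> int (card step_edges)"
  shows "\<bar>side (adj2 h)\<bar> \<le> m * gram2 (adj2 h)" "\<bar>side (adj2 h ** \<gamma>)\<bar> \<le> m * gram2 (adj2 h ** \<gamma>)"
proof -
  define a b ga gb where "a = side (adj2 h)" "b = side (adj2 h ** \<gamma>)"
    "ga = gram2 (adj2 h)" "gb = gram2 (adj2 h ** \<gamma>)"
  note defs = this
  have \<gamma>: "det \<gamma> = 1" by (rule \<Gamma>_det[OF assms(1)])
  have pos: "ga \<ge> 2" "gb \<ge> 2"
    unfolding defs by (intro gram_ge_2; simp add: det_mul assms(2) \<gamma>)+
  have ab: "a * b < 0" using assms(2,3) sep_side_mult[of h "mat 1" \<gamma>] \<gamma> by (simp add: defs)
  have sepI: "sep (h ** matR n) (mat 1) \<gamma>"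
    if "(a - n * ga < 0 \<and> b - n * gb > 0) \<or> (a - n * ga > 0 \<and> b - n * gb < 0)" for n
    using that sep_matR_iff[OF assms(2) \<gamma>, of n] by (auto simp: defs mult_less_0_iff)
  have le: "k * ga \<le> m * ga" "k * gb \<le> m * gb" "0 \<le> k * ga" "0 \<le> k * gb"
    if "0 \<le> k" "k \<le> m" for k
    using that pos by (auto intro: mult_right_mono)
  have inj: "inj (\<lambda>k::int. k)" "inj (\<lambda>k::int. - k)" by (auto intro: injI)
  have "\<bar>a\<bar> \<le> m * ga"
  proof (rule ccontr)
    assume *: "\<not> \<bar>a\<bar> \<le> m * ga"
    show False
    proof (cases "a < 0")
      case True
      with ab have sg: "b > 0" by (simp add: mult_less_0_iff)
      have "sep (h ** matR (- k)) (mat 1) \<gamma>" if "0 \<le> k" "k \<le> m" for k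
        using * sg True le[OF that] by (intro sepI) (auto simp: algebra_simps)
      then show False
        by (intro fan_contradiction[OF assms(1,2) _ inj(2)]) (auto simp: m_def)
    next
      case False
      with ab have sg: "a > 0" "b < 0" by (auto simp: mult_less_0_iff)
      have "sep (h ** matR (k)) (mat 1) \<gamma>" if "0 \<le> k" "k \<le> m" for k
        using * sg le[OF that] by (intro sepI) (auto simp: algebra_simps)
      then show False
        by (intro fan_contradiction[OF assms(1,2) _ inj(1)]) (auto simp: m_def)
    qed
  qed
  moreover have "\<bar>b\<bar> \<le> m * gb"
  proof (rule ccontr)
    assume *: "\<not> \<bar>b\<bar> \<le> m * gb"
    show False
    proof (cases "b < 0")
      case True
      with ab have sg: "a > 0" by (simp add: mult_less_0_iff)
      have "sep (h ** matR (- k)) (mat 1) \<gamma>" if "0 \<le> k" "k \<le> m" for k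
        using * sg True le[OF that] by (intro sepI) (auto simp: algebra_simps)
      then show False
        by (intro fan_contradiction[OF assms(1,2) _ inj(2)]) (auto simp: m_def)
    next
      case False
      with ab have sg: "b > 0" "a < 0" by (auto simp: mult_less_0_iff)
      have "sep (h ** matR (k)) (mat 1) \<gamma>" if "0 \<le> k" "k \<le> m" for k
        using * sg le[OF that] by (intro sepI) (auto simp: algebra_simps)
      then show False
        by (intro fan_contradiction[OF assms(1,2) _ inj(1)]) (auto simp: m_def)
    qed
  qed
  ultimately show "\<bar>side (adj2 h)\<bar> \<le> m * gram2 (adj2 h)"
    "\<bar>side (adj2 h ** \<gamma>)\<bar> \<le> m * gram2 (adj2 h ** \<gamma>)" by (simp_all add: defs)
qed

text \<open>A reverse triangle inequality for an edge between the two points. The fan at h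
  \<infinity> shows that \<open>gram2 ?A\<close> dominates the Gram matrix of \<open>?A\<close>, and
  the fan at h 0 shows that \<open>gram1 ?B\<close> dominates that of \<open>?B\<close>. The product
  of these two entries is a term of the quotient formula, whose other terms are nonnegative by the
  signs.\<close>

lemma sep_norm_bound:
  obtains C where "C > 0" "\<And>\<gamma> h. \<gamma> \<in> \<Gamma> \<Longrightarrow> det h = 1 \<Longrightarrow> sep h (mat 1) \<gamma> \<Longrightarrow>
    frob_norm h * frob_norm (adj2 h ** \<gamma>) \<le> C * frob_norm \<gamma>"
proof -
  define m where "m = int (card step_edges)"
  define K where "K = 2 + m\<^sup>2"
  have K: "K > 0" unfolding K_def by (smt (verit) zero_le_power2)
  have "frob_norm h * frob_norm (adj2 h ** \<gamma>) \<le> (3 * real_of_int K) * frob_norm \<gamma>"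
    if \<gamma>: "\<gamma> \<in> \<Gamma>" and h: "det h = 1" and s: "sep h (mat 1) \<gamma>" for \<gamma> h
  proof -
    let ?A = "adj2 h" and ?B = "adj2 h ** \<gamma>"
    have d: "det ?A = 1" "det ?B = 1" "det \<gamma> = 1" "det (h ** matS) = 1"
      using h \<Gamma>_det[OF \<gamma>] by (simp_all add: det_mul)
    \<comment> \<open>Reversing the edge exchanges its two cusps, so that \<open>fan_bound\<close>
      also applies at the other end.\<close>
    have s': "sep (h ** matS) (mat 1) \<gamma>" using s by (simp add: sep_matS h d)
    have swap: "gram2 (adj2 (h ** matS) ** k) = gram1 (adj2 h ** k)"
      "side (adj2 (h ** matS) ** k) = - side (adj2 h ** k)"
      "gram1 (adj2 (h ** matS) ** k) = gram2 (adj2 h ** k)" for k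
      by (simp_all add: gram1_def gram2_def side_def matS_def power2_eq_square algebra_simps)
    have 1: "gram1 ?A \<le> (1 + m\<^sup>2) * gram2 ?A"
      using fan_bound[OF \<gamma> h s] d by (intro gram_bound_if_side_bound) (simp_all add: m_def)
    have B': "det (adj2 (h ** matS) ** \<gamma>) = 1" using d by (simp add: det_mul)
    have "gram1 (adj2 (h ** matS) ** \<gamma>) \<le> (1 + m\<^sup>2) * gram2 (adj2 (h ** matS) ** \<gamma>)"
      using fan_bound[OF \<gamma> d(4) s'] by (intro gram_bound_if_side_bound B') (simp_all add: m_def)
    then have 2: "gram2 ?B \<le> (1 + m\<^sup>2) * gram1 ?B" by (simp add: swap)
    have neg: "side ?A * side ?B < 0" using s h sep_side_mult[of h "mat 1" \<gamma>] d by simp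
    have "nsq h * nsq ?B = nsq ?A * nsq ?B" by simp
    also have "\<dots> \<le> (gram1 ?A + gram2 ?A) * (gram1 ?B + gram2 ?B)"
      using gram_ge_2[OF d(1)] by (intro mult_mono gram_ge_nsq) auto
    also have "\<dots> \<le> (K * gram2 ?A) * (K * gram1 ?B)"
      using 1 2 gram_ge_2[OF d(1)] gram_ge_2[OF d(2)] K
      by (intro mult_mono) (auto simp: K_def algebra_simps)
    also have "\<dots> = K\<^sup>2 * (gram2 ?A * gram1 ?B)" by (simp add: power2_eq_square algebra_simps)
    also have "\<dots> \<le> K\<^sup>2 * (gram2 ?A * gram1 ?B + gram1 ?A * gram2 ?B - 2 * (side ?A * side ?B))"
    proof (rule mult_left_mono)
      have "0 \<le> gram1 ?A * gram2 ?B" using gram_ge_2[OF d(1)] gram_ge_2[OF d(2)] by simp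
      then show "gram2 ?A * gram1 ?B \<le> gram2 ?A * gram1 ?B + gram1 ?A * gram2 ?B - 2 * (side ?A * side ?B)"
        using neg by simp
    qed simp
    also have "\<dots> \<le> K\<^sup>2 * (9 * nsq (adj2 ?A ** ?B))"
      by (intro mult_left_mono gram_quotient_le) simp
    also have "adj2 ?A ** ?B = \<gamma>" by (simp add: adj2_cancel h)
    finally have "nsq h * nsq ?B \<le> (3 * K)\<^sup>2 * nsq \<gamma>" by (simp add: power2_eq_square)
    then have "real_of_int (nsq h * nsq ?B) \<le> real_of_int ((3 * K)\<^sup>2 * nsq \<gamma>)" by (simp only: of_int_le_iff)
    then have "sqrt (real_of_int (nsq h * nsq ?B)) \<le> sqrt (real_of_int ((3 * K)\<^sup>2 * nsq \<gamma>))" by simp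
    also have "\<dots> = (3 * real_of_int K) * frob_norm \<gamma>"
      using K by (simp add: frob_norm_eq_sqrt real_sqrt_mult)
    finally show ?thesis by (simp add: frob_norm_eq_sqrt real_sqrt_mult)
  qed
  then show ?thesis using K that[of "3 * real_of_int K"] by simp
qed

text \<open>If the inverses of the prefixes at times j and k carry one edge to step edges e and e',
  then the subword between these times has the value \<open>e ** adj2 e'\<close>, one of finitely
  many.\<close>

lemma crossing_close:
  obtains R where "\<And>w j k h. w \<in> red \<Longrightarrow> j \<le> k \<Longrightarrow> k \<le> length w \<Longrightarrow> det h = 1 \<Longrightarrow>
    adj2 (val (take j w)) ** h \<in> step_edges \<Longrightarrow> adj2 (val (take k w)) ** h \<in> step_edges \<Longrightarrow> k \<le> j + R"
proof -
  let ?D = "(\<lambda>(e, e'). e ** adj2 e') ` (step_edges \<times> step_edges)"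
  have "finite ?D" using finite_step_edges by simp
  then obtain R where R: "\<And>w. w \<in> red \<Longrightarrow> val w \<in> ?D \<Longrightarrow> length w \<le> R" using red_length_bound by blast
  have "k \<le> j + R" if w: "w \<in> red" and jk: "j \<le> k" "k \<le> length w" and h: "det h = 1"
    and e: "adj2 (val (take j w)) ** h \<in> step_edges" "adj2 (val (take k w)) ** h \<in> step_edges"
  for w j k h
  proof -
    let ?z = "drop j (take k w)"
    have z: "?z \<in> red" by (intro red_take red_drop w)
    have "take k w = take j w @ ?z" using jk by (metis append_take_drop_id min.absorb1 take_take)
    then have "val (take k w) = val (take j w) ** val ?z" by (metis val_append)
    moreover have "det (val (take j w)) = 1" by (intro \<Gamma>_det val_red_\<Gamma> red_take w)
    ultimately have "val ?z = adj2 (val (take j w)) ** val (take k w)" by (simp add: adj2_cancel)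
    also have "\<dots> = (adj2 (val (take j w)) ** h) ** adj2 (adj2 (val (take k w)) ** h)"
      by (simp add: adj2_mult matrix_mul_assoc[symmetric] adj2_cancel h)
    finally have "val ?z \<in> ?D" using e by (intro image_eqI[OF _ SigmaI[OF e]]) simp
    with R z have "length ?z \<le> R" by blast
    with jk show ?thesis by simp
  qed
  then show ?thesis using that by blast
qed

text \<open>Reduced words are quasi-geodesics: an edge that is crossed near the end of \<open>u\<close>, but not near
  other times, separates the two ends of the path of \<open>u @ v\<close>.\<close>

lemma quasi_mult:
  obtains C where "C > 0"
    "\<And>u v. u @ v \<in> red \<Longrightarrow> frob_norm (val u) * frob_norm (val v) \<le> C * frob_norm (val (u @ v))"
proof -
  obtain R where R: "\<And>w j k h. w \<in> red \<Longrightarrow> j \<le> k \<Longrightarrow> k \<le> length w \<Longrightarrow> det h = 1 \<Longrightarrow>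
    adj2 (val (take j w)) ** h \<in> step_edges \<Longrightarrow> adj2 (val (take k w)) ** h \<in> step_edges \<Longrightarrow> k \<le> j + R"
    using crossing_close by blast
  obtain C0 where C0: "C0 > 0" "\<And>\<gamma> h. \<gamma> \<in> \<Gamma> \<Longrightarrow> det h = 1 \<Longrightarrow> sep h (mat 1) \<gamma> \<Longrightarrow>
    frob_norm h * frob_norm (adj2 h ** \<gamma>) \<le> C0 * frob_norm \<gamma>" using sep_norm_bound by blast
  \<comment> \<open>More than the number of edges in \<open>bad\<close> below, which is at most 2 R
    \<open>card step_edges\<close>.\<close>
  define n where "n = Suc (2 * (Suc R * card step_edges))"
  obtain T where T: "\<And>g. det g = 1 \<Longrightarrow> nsq g > T \<Longrightarrow> card (seps (mat 1) g) \<ge> n"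
    using card_seps_large by blast
  obtain L where L: "\<And>w. w \<in> red \<Longrightarrow> val w \<in> {g. nsq g \<le> T} \<Longrightarrow> length w \<le> L"
    using red_length_bound[OF finite_nsq_le[of T]] by blast
  obtain K1 where K1: "K1 > 0" "\<And>z. z \<in> red \<Longrightarrow> length z \<le> Suc L \<Longrightarrow> frob_norm (val z) \<le> K1"
    using bounded_on_finite[OF finite_red_length[of "Suc L"], of "\<lambda>z. frob_norm (val z)"] by auto
  obtain K2 where K2: "K2 > 0" "\<And>e. e \<in> step_edges \<Longrightarrow> frob_norm e \<le> K2"
    using bounded_on_finite[OF finite_step_edges, of frob_norm] by blast
  define K where "K = K1 * K2"
  have K: "K > 0" using K1 K2 by (simp add: K_def)
  have main: "frob_norm (val u) * frob_norm (val v) \<le> max (K1\<^sup>2) (K\<^sup>2 * C0) * frob_norm (val (u @ v))"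
    if w: "u @ v \<in> red" for u v
  proof (cases "length u \<le> L")
    case True
    have u: "u \<in> red" and v: "v \<in> red" using red_append[OF w] by auto
    have du: "det (val u) = 1" by (intro \<Gamma>_det val_red_\<Gamma> u)
    have "frob_norm (val u) * frob_norm (val v) \<le> K1 * (K1 * frob_norm (val (u @ v)))"
    proof (intro mult_mono)
      show uK: "frob_norm (val u) \<le> K1" using True by (intro K1 u) simp
      show "frob_norm (val v) \<le> K1 * frob_norm (val (u @ v))"
        using frob_norm_mult_ge[OF du, of "val v"] mult_right_mono[OF uK frob_norm_nonneg[of "val (u @ v)"]]
        by (simp add: val_append)
    qed (use K1 in auto)
    also have "\<dots> = K1\<^sup>2 * frob_norm (val (u @ v))" by (simp add: power2_eq_square)
    also have "\<dots> \<le> max (K1\<^sup>2) (K\<^sup>2 * C0) * frob_norm (val (u @ v))" by (intro mult_right_mono) auto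
    finally show ?thesis .
  next
    case False
    let ?w = "u @ v" and ?m = "length u" and ?i = "length u - Suc L"
    have u: "u \<in> red" and v: "v \<in> red" using red_append[OF w] by auto
    have i: "?i \<le> ?m" by simp
    define P where "P j = val (take j ?w)" for j
    have P_red: "P j \<in> \<Gamma>" for j unfolding P_def by (intro val_red_\<Gamma> red_take w)
    have P_det: "det (P j) = 1" for j by (rule \<Gamma>_det[OF P_red])
    let ?z = "drop ?i u"
    have z: "?z \<in> red" by (intro red_drop u)
    have Pz: "P ?m = P ?i ** val ?z" by (simp add: P_def flip: val_append)
    have "\<not> length ?z \<le> L" using False by simp
    then have "nsq (val ?z) > T" using L[OF z] by fastforce
    then have "card (seps (mat 1) (val ?z)) \<ge> n" using T \<Gamma>_det[OF val_red_\<Gamma>[OF z]] by blast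
    then have cardn: "card (seps (P ?i) (P ?m)) \<ge> n"
      using card_seps_mult_left[OF P_det[of ?i], of "mat 1" "val ?z"] Pz by simp
    \<comment> \<open>An edge that is crossed between the times \<open>?i\<close> and
      \<open>?m\<close> and also outside this range is crossed within R steps of the range, hence is
      bad. So an edge outside \<open>bad\<close> that separates the ends of the last L + 1 letters
      of \<open>u\<close> separates the ends of the whole path.\<close>
    define bad where "bad = (\<Union>j\<in>{?i - R..<?i} \<union> {?m..<?m + R}. (**) (P j) ` step_edges)"
    have fin_bad: "finite bad" unfolding bad_def by (intro finite_UN_I) (auto simp: finite_step_edges)
    have "card bad \<le> (\<Sum>j\<in>{?i - R..<?i} \<union> {?m..<?m + R}. card ((**) (P j) ` step_edges))"
      unfolding bad_def by (intro card_UN_le) auto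
    also have "\<dots> \<le> (\<Sum>j\<in>{?i - R..<?i} \<union> {?m..<?m + R}. card step_edges)"
      by (intro sum_mono card_image_le finite_step_edges)
    also have "\<dots> = card ({?i - R..<?i} \<union> {?m..<?m + R}) * card step_edges" by simp
    also have "\<dots> \<le> (R + R) * card step_edges"
      by (intro mult_right_mono order_trans[OF card_Un_le]) auto
    also have "\<dots> < n" unfolding n_def by (simp add: add_mult_distrib)
    finally have "card bad < n" .
    then have "\<not> seps (P ?i) (P ?m) \<subseteq> bad"
      using card_mono[OF fin_bad, of "seps (P ?i) (P ?m)"] cardn by linarith
    then obtain h where h: "h \<in> seps (P ?i) (P ?m)" "h \<notin> bad" by (auto simp del: One_nat_def)
    have dh: "det h = 1" using h by (simp add: seps_def)
    have mem_bad: "h \<in> bad" if "adj2 (P j) ** h \<in> step_edges" "j \<in> {?i - R..<?i} \<union> {?m..<?m + R}" for j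
    proof -
      have "h = P j ** (adj2 (P j) ** h)" by (simp add: adj2_cancel P_det)
      with that show ?thesis unfolding bad_def by blast
    qed
    have wl: "?w \<in> lists letters" by (rule red_lists[OF w])
    have cross: "\<exists>j\<in>{i..<k}. adj2 (P j) ** h \<in> step_edges"
      if "i \<le> k" "k \<le> length ?w" "sep h (P i) (P k)" for i k
      using crossing[OF wl that(1,2) dh] that(3) unfolding P_def by blast
    have close: "k \<le> j + R" if "j \<le> k" "k \<le> length ?w"
      "adj2 (P j) ** h \<in> step_edges" "adj2 (P k) ** h \<in> step_edges" for j k
      using R[OF w that(1,2) dh] that(3,4) unfolding P_def by blast
    have him: "sep h (P ?i) (P ?m)" using h by (simp add: seps_def)
    have mw: "?m \<le> length ?w" by simp
    obtain j where j: "j \<in> {?i..<?m}" "adj2 (P j) ** h \<in> step_edges"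
      using cross[OF i mw him] by (rule bexE)
    have jm: "?i \<le> j" "j < ?m" using j(1) unfolding atLeastLessThan_iff by (rule conjunct1, rule conjunct2)
    have "\<not> sep h (P 0) (P ?i)"
    proof
      assume "sep h (P 0) (P ?i)"
      then obtain k where k: "k \<in> {0..<?i}" "adj2 (P k) ** h \<in> step_edges"
        using cross[OF le0 order_trans[OF i mw]] by blast
      then have ki: "k < ?i" using k(1) by simp
      have "k \<le> j" "j \<le> length ?w" using ki jm mw by linarith+
      then have "j \<le> k + R" using k(2) j(2) by (rule close)
      with ki jm have "k \<in> {?i - R..<?i}" by simp
      then show False using mem_bad[OF k(2)] h(2) by blast
    qed
    moreover have "\<not> sep h (P ?m) (P (length ?w))"
    proof
      assume "sep h (P ?m) (P (length ?w))"
      then obtain k where k: "k \<in> {?m..<length ?w}" "adj2 (P k) ** h \<in> step_edges"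
        using cross[OF mw order_refl] by blast
      then have km: "?m \<le> k" "k < length ?w" using k(1) by simp_all
      have "j \<le> k" "k \<le> length ?w" using km jm by linarith+
      then have "k \<le> j + R" using j(2) k(2) by (rule close)
      with km jm have "k \<in> {?m..<?m + R}" by simp
      then show False using mem_bad[OF k(2)] h(2) by blast
    qed
    moreover have "P 0 = mat 1" "P (length ?w) = val ?w" by (simp_all add: P_def)
    ultimately have "sep h (mat 1) (val ?w)" using him by (simp add: sep_def)
    then have hC: "frob_norm h * frob_norm (adj2 h ** val ?w) \<le> C0 * frob_norm (val ?w)"
      by (intro C0 dh val_red_\<Gamma> w)
    \<comment> \<open>\<open>h\<close> differs by a step edge from the prefix at time j, which
      differs from \<open>u\<close> by at most L + 1 letters. So the norms of \<open>h\<close> and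
      \<open>val u\<close> are comparable.\<close>
    define e where "e = adj2 (P j) ** h"
    have he: "h = P j ** e" by (simp add: e_def adj2_cancel P_det)
    let ?y = "drop j u"
    have y: "?y \<in> red" by (rule red_drop[OF u])
    have ly: "length ?y \<le> Suc L" using jm(1) by simp
    have "take j ?w = take j u" using jm(2) by simp
    then have yj: "val u = P j ** val ?y"
      unfolding P_def by (simp only: val_append[symmetric] append_take_drop_id)
    have "frob_norm (adj2 h ** val u) \<le> frob_norm (adj2 e) * frob_norm (val ?y)"
      using frob_norm_mult[of "adj2 e" "val ?y"]
      by (simp add: he yj adj2_mult matrix_mul_assoc[symmetric] adj2_cancel P_det)
    also have "\<dots> \<le> K2 * K1"
      using K2(2)[of e] K1(2)[OF y ly] j(2) K2(1) by (intro mult_mono) (auto simp: e_def)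
    finally have hu: "frob_norm (adj2 h ** val u) \<le> K" by (simp add: K_def mult.commute)
    have dhu: "det (adj2 h ** val u) = 1" using dh \<Gamma>_det[OF val_red_\<Gamma>[OF u]] by (simp add: det_mul)
    have "frob_norm (val u) = frob_norm (h ** (adj2 h ** val u))" by (simp add: adj2_cancel dh)
    also have "\<dots> \<le> frob_norm h * frob_norm (adj2 h ** val u)" by (rule frob_norm_mult)
    also have "\<dots> \<le> frob_norm h * K" using hu by (intro mult_left_mono) auto
    finally have 1: "frob_norm (val u) \<le> frob_norm h * K" .
    have "frob_norm (val v) \<le> frob_norm (adj2 h ** val u) * frob_norm (adj2 h ** val u ** val v)"
      by (rule frob_norm_mult_ge[OF dhu])
    also have "\<dots> \<le> K * frob_norm (adj2 h ** val ?w)"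
      using hu by (auto simp: val_append matrix_mul_assoc intro: mult_right_mono)
    finally have 2: "frob_norm (val v) \<le> K * frob_norm (adj2 h ** val ?w)" .
    have "frob_norm (val u) * frob_norm (val v) \<le> (frob_norm h * K) * (K * frob_norm (adj2 h ** val ?w))"
      using 1 2 K by (intro mult_mono) auto
    also have "\<dots> = K\<^sup>2 * (frob_norm h * frob_norm (adj2 h ** val ?w))" by (simp add: power2_eq_square)
    also have "\<dots> \<le> K\<^sup>2 * (C0 * frob_norm (val ?w))" using hC by (intro mult_left_mono) auto
    also have "\<dots> = (K\<^sup>2 * C0) * frob_norm (val ?w)" by simp
    also have "\<dots> \<le> max (K1\<^sup>2) (K\<^sup>2 * C0) * frob_norm (val ?w)" by (intro mult_right_mono) auto
    finally show ?thesis .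
  qed
  have "max (K1\<^sup>2) (K\<^sup>2 * C0) > 0" using K1 by (auto simp: less_max_iff_disj)
  with main that show ?thesis by blast
qed

end

section \<open>Integer vectors, inverse words and the disc model\<close>

definition vsq :: "int^2 \<Rightarrow> int" where "vsq y = (y$1)\<^sup>2 + (y$2)\<^sup>2"

lemma mult_vec22_nth [simp]:
  fixes A :: "int^2^2"
  shows "(A *v y) $ 1 = A$1$1 * y$1 + A$1$2 * y$2" "(A *v y) $ 2 = A$2$1 * y$1 + A$2$2 * y$2"
  by (simp_all add: matrix_vector_mult_def sum_2)

lemma vec_mult22_nth [simp]:
  fixes A :: "int^2^2"
  shows "(y v* A) $ 1 = y$1 * A$1$1 + y$2 * A$2$1" "(y v* A) $ 2 = y$1 * A$1$2 + y$2 * A$2$2"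
  by (simp_all add: vector_matrix_mult_def sum_2 mult.commute)

lemma inv_letter_inv_letter [simp]: "inv_letter (inv_letter x) = x"
  by (simp add: inv_letter_def)

lemma inv_letter_neq [simp]: "inv_letter x \<noteq> x" "x \<noteq> inv_letter x"
  by (auto simp: inv_letter_def prod_eq_iff)

definition inv_word :: "'a letter list \<Rightarrow> 'a letter list" where
  "inv_word w = rev (map inv_letter w)"

lemma inv_word_simps [simp]:
  "inv_word [] = []" "inv_word (u @ v) = inv_word v @ inv_word u" "length (inv_word w) = length w"
  "inv_word (inv_word w) = w" "inv_word w = [] \<longleftrightarrow> w = []"
  by (simp_all add: inv_word_def rev_map comp_def)

lemma inv_word_Cons: "inv_word (x # w) = inv_word w @ [inv_letter x]"
  by (simp add: inv_word_def)

lemma last_inv_word: "w \<noteq> [] \<Longrightarrow> last (inv_word w) = inv_letter (hd w)"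
  by (simp add: inv_word_def last_rev hd_map)

lemma reduced_words_append:
  "u @ v \<in> reduced_words S \<longleftrightarrow> u \<in> reduced_words S \<and> v \<in> reduced_words S \<and>
    (u = [] \<or> v = [] \<or> hd v \<noteq> inv_letter (last u))"
  unfolding reduced_words_def mem_Collect_eq successively_append_iff append_in_lists_conv by blast

lemma reduced_words_Nil [simp]: "[] \<in> reduced_words S"
  by (simp add: reduced_words_def)

lemma reduced_inv_word: assumes "w \<in> reduced_words S" shows "inv_word w \<in> reduced_words S"
proof -
  have "w \<in> lists (S \<times> UNIV)" "successively (\<lambda>x y. y \<noteq> inv_letter x) w"
    using assms by (simp_all add: reduced_words_def)
  then have "inv_word w \<in> lists (S \<times> UNIV)"
    by (force simp: inv_word_def inv_letter_def)
  moreover have "successively (\<lambda>x y. y \<noteq> inv_letter x) (inv_word w)"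
    using \<open>successively _ w\<close> unfolding inv_word_def successively_rev successively_map
    by (rule successively_mono) (metis inv_letter_inv_letter)
  ultimately show ?thesis by (simp add: reduced_words_def)
qed

definition disc_pt :: "int^2^2 \<Rightarrow> complex" where
  "disc_pt g = cayley (moebius_act g \<i>)"

text \<open>Numerator and, below, denominator of \<open>disc_pt g\<close> after clearing the factor
  c \<i> + d, where (c, d) is the second row of \<open>g\<close>. Their moduli depend only on
  \<open>nsq g\<close>.\<close>

definition disc_num :: "int^2^2 \<Rightarrow> complex" where
  "disc_num g = Complex (of_int (g$1$2 + g$2$1)) (of_int (g$1$1 - g$2$2))"

definition disc_den :: "int^2^2 \<Rightarrow> complex" where
  "disc_den g = Complex (of_int (g$1$2 - g$2$1)) (of_int (g$1$1 + g$2$2))"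

lemma disc_den_sq: "det g = 1 \<Longrightarrow> (cmod (disc_den g))\<^sup>2 = real_of_int (nsq g + 2)"
proof -
  assume "det g = 1"
  then have "nsq g + 2 = (g$1$2 - g$2$1)\<^sup>2 + (g$1$1 + g$2$2)\<^sup>2"
    by (simp add: nsq_def det_2 power2_eq_square algebra_simps)
  then show ?thesis by (simp add: disc_den_def cmod_power2)
qed

lemma disc_num_sq: "det g = 1 \<Longrightarrow> (cmod (disc_num g))\<^sup>2 = real_of_int (nsq g - 2)"
proof -
  assume "det g = 1"
  then have "nsq g - 2 = (g$1$2 + g$2$1)\<^sup>2 + (g$1$1 - g$2$2)\<^sup>2"
    by (simp add: nsq_def det_2 power2_eq_square algebra_simps)
  then show ?thesis by (simp add: disc_num_def cmod_power2)
qed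

lemma disc_den_nonzero: assumes "det g = 1" shows "disc_den g \<noteq> 0"
proof
  assume "disc_den g = 0"
  with disc_den_sq[OF assms] have "real_of_int (nsq g + 2) = 0" by simp
  with nsq_nonneg[of g] show False by linarith
qed

lemma disc_pt_eq: assumes "det g = 1" shows "disc_pt g = disc_num g / disc_den g"
proof -
  let ?a = "of_int (g$1$1) :: complex" and ?b = "of_int (g$1$2) :: complex"
    and ?c = "of_int (g$2$1) :: complex" and ?d = "of_int (g$2$2) :: complex"
  have cd: "?c * \<i> + ?d \<noteq> 0"
  proof
    assume "?c * \<i> + ?d = 0"
    then have "g$2$1 = 0" "g$2$2 = 0" by (auto simp: complex_eq_iff)
    with assms show False by (simp add: det_2)
  qed
  have num: "disc_num g = (?a * \<i> + ?b) - \<i> * (?c * \<i> + ?d)"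
    and den: "disc_den g = (?a * \<i> + ?b) + \<i> * (?c * \<i> + ?d)"
    by (simp_all add: disc_num_def disc_den_def complex_eq_iff)
  have "disc_pt g = ((?a * \<i> + ?b) / (?c * \<i> + ?d) - \<i>) / ((?a * \<i> + ?b) / (?c * \<i> + ?d) + \<i>)"
    by (simp add: disc_pt_def cayley_def moebius_act_def moebius_def)
  also have "\<dots> = (((?a * \<i> + ?b) - \<i> * (?c * \<i> + ?d)) / (?c * \<i> + ?d)) /
      (((?a * \<i> + ?b) + \<i> * (?c * \<i> + ?d)) / (?c * \<i> + ?d))"
    using cd by (simp add: diff_divide_distrib add_divide_distrib)
  also have "\<dots> = disc_num g / disc_den g" using cd by (simp add: num den)
  finally show ?thesis .
qed

lemma disc_cross:
  "(cmod (disc_num g * disc_den g' - disc_num g' * disc_den g))\<^sup>2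
    = real_of_int (4 * (nsq (adj2 g ** g') - 2 * (det g * det g')))"
  unfolding cmod_power2
  by (simp add: disc_num_def disc_den_def nsq_def det_2 power2_eq_square algebra_simps)

text \<open>The formula sinh^2 (d / 2) = |z - w|^2 / ((1 - |z|^2) (1 - |w|^2)) of the disc model, in
  which \<open>nsq g\<close> is 2 cosh of the hyperbolic distance from \<i> to g \<i>.\<close>

lemma disc_pt_dist:
  assumes "det g = 1" "det g' = 1"
  shows "(dist (disc_pt g) (disc_pt g'))\<^sup>2
    = 4 * real_of_int (nsq (adj2 g ** g') - 2) / (real_of_int (nsq g + 2) * real_of_int (nsq g' + 2))"
proof -
  have "disc_pt g - disc_pt g' = (disc_num g * disc_den g' - disc_num g' * disc_den g) / (disc_den g * disc_den g')"
    using assms by (simp add: disc_pt_eq disc_den_nonzero diff_frac_eq)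
  then have "(dist (disc_pt g) (disc_pt g'))\<^sup>2 =
      (cmod (disc_num g * disc_den g' - disc_num g' * disc_den g))\<^sup>2
        / ((cmod (disc_den g))\<^sup>2 * (cmod (disc_den g'))\<^sup>2)"
    by (simp add: dist_norm norm_divide norm_mult power_divide power_mult_distrib)
  then show ?thesis by (simp only: disc_cross disc_den_sq assms) simp
qed

lemma disc_pt_norm:
  assumes "det g = 1"
  shows "(cmod (disc_pt g))\<^sup>2 = 1 - 4 / real_of_int (nsq g + 2)"
proof -
  have "real_of_int (nsq g + 2) > 0" using nsq_nonneg[of g] by linarith
  then show ?thesis using assms
    by (simp only: disc_pt_eq norm_divide power_divide disc_num_sq disc_den_sq) (simp add: field_simps)
qed

text \<open>\<open>nsq g\<close> - 2 is the sum of squares (a - d)^2 + (b + c)^2, so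
  \<open>g\<close> is a rotation about \<i> with integer entries.\<close>

lemma nsq_2_power4:
  assumes "det g = 1" "nsq g = 2" shows "g ** g ** (g ** g) = mat 1"
proof -
  define a b c d where "a = g$1$1" "b = g$1$2" "c = g$2$1" "d = g$2$2"
  note defs = this
  have 1: "a * d - b * c = 1" using assms(1) by (simp add: defs det_2)
  have 2: "a\<^sup>2 + b\<^sup>2 + c\<^sup>2 + d\<^sup>2 = 2" using assms(2) by (simp add: defs nsq_def)
  have "(a - d)\<^sup>2 + (b + c)\<^sup>2 = (a\<^sup>2 + b\<^sup>2 + c\<^sup>2 + d\<^sup>2) - 2 * (a * d - b * c)"
    by (simp add: power2_eq_square algebra_simps)
  then have 0: "(a - d)\<^sup>2 + (b + c)\<^sup>2 = 0" using 1 2 by simp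
  then have d: "d = a" and c: "c = - b"
    using sum_power2_eq_zero_iff[of "a - d" "b + c"] by auto
  have ab: "a * a + b * b = 1" using 1 by (simp add: d c)
  have "a = 0 \<or> b = 0"
  proof (rule ccontr)
    assume "\<not> (a = 0 \<or> b = 0)"
    then have "0 < a * a" "0 < b * b" by (auto simp: zero_less_mult_iff)
    with ab show False by linarith
  qed
  with ab have "(a = 0 \<and> b * b = 1) \<or> (b = 0 \<and> a * a = 1)" by auto
  then show ?thesis
    by (auto simp: mat22_eq_iff simp flip: defs simp: d c algebra_simps)
qed

context free_nonparabolic
begin

text \<open>\<open>w\<close> is the first column of \<open>h\<close>, so h \<infinity> is the cusp
  of \<open>w\<close>. The fan at this cusp bounds the real part of \<gamma>^-1 \<rho> in the
  coordinate of \<open>h\<close>, which bounds the norm of \<open>B\<close> in terms of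
  \<open>gram2 B\<close>, and that is a definite quadratic form in \<gamma> w.\<close>

lemma column_bound:
  assumes "coprime (w$1) (w$2)"
  obtains C where "C > 0" "\<And>\<gamma>. \<gamma> \<in> \<Gamma> \<Longrightarrow> nsq \<gamma> \<le> C * vsq (\<gamma> *v w)"
proof -
  from bezout_int[of "w$1" "w$2"] obtain x y where "x * w$1 + y * w$2 = gcd (w$1) (w$2)" by blast
  then have xy: "x * w$1 + y * w$2 = 1" using assms by simp
  define h where "h = mat22 (w$1) (- y) (w$2) x"
  have h: "det h = 1" using xy by (simp add: h_def det_2 algebra_simps)
  define a ga where "a = side (adj2 h)" "ga = gram2 (adj2 h)"
  note a_def = this
  have ga: "ga \<ge> 2" unfolding a_def by (rule gram_ge_2(2)) (simp add: h)
  \<comment> \<open>The summand |a| + 1 moves the lines of the fan beyond \<rho>, whose real part a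
    / ga is at most |a| in absolute value; here \<open>h\<close> itself may fail to
    separate.\<close>
  define m where "m = int (card step_edges) + \<bar>a\<bar> + 1"
  define K where "K = 2 + m\<^sup>2"
  have K: "K \<ge> 2" by (simp add: K_def)
  have "nsq \<gamma> \<le> (3 * K * nsq h) * vsq (\<gamma> *v w)" if \<gamma>: "\<gamma> \<in> \<Gamma>" for \<gamma>
  proof -
    define B where "B = adj2 h ** adj2 \<gamma>"
    have d: "det \<gamma> = 1" "det (adj2 \<gamma>) = 1" using \<Gamma>_det[OF \<gamma>] by simp_all
    have dB: "det B = 1" by (simp add: B_def det_mul h d)
    have \<gamma>': "adj2 \<gamma> \<in> \<Gamma>" by (rule \<Gamma>_adj2[OF \<gamma>])
    have gB: "gram2 B \<ge> 2" by (rule gram_ge_2(2)[OF dB])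
    have sepI: "sep (h ** matR n) (mat 1) (adj2 \<gamma>)"
      if "(a - n * ga < 0 \<and> side B - n * gram2 B > 0) \<or> (a - n * ga > 0 \<and> side B - n * gram2 B < 0)" for n
      using that sep_matR_iff[OF h d(2), of n] by (auto simp: a_def B_def mult_less_0_iff)
    have le: "\<bar>a\<bar> + 1 \<le> n * ga" "n * gram2 B \<le> m * gram2 B" if "\<bar>a\<bar> + 1 \<le> n" "n \<le> m" for n
    proof -
      have "(\<bar>a\<bar> + 1) * 1 \<le> n * ga" using that ga by (intro mult_mono) auto
      then show "\<bar>a\<bar> + 1 \<le> n * ga" by simp
      show "n * gram2 B \<le> m * gram2 B" using that gB by (intro mult_right_mono) auto
    qed
    have "\<bar>side B\<bar> \<le> m * gram2 B"
    proof (rule ccontr)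
      assume *: "\<not> \<bar>side B\<bar> \<le> m * gram2 B"
      have range: "\<bar>a\<bar> + 1 \<le> \<bar>a\<bar> + 1 + k" "\<bar>a\<bar> + 1 + k \<le> m" if "0 \<le> k" "k \<le> int (card step_edges)" for k
        using that by (simp_all add: m_def)
      show False
      proof (cases "side B > 0")
        case True
        have "sep (h ** matR (\<bar>a\<bar> + 1 + k)) (mat 1) (adj2 \<gamma>)" if "0 \<le> k" "k \<le> int (card step_edges)" for k
          using le[OF range[OF that]] * True by (intro sepI disjI1 conjI) linarith+
        then show False by (rule fan_contradiction[OF \<gamma>' h]) (auto intro: injI)
      next
        case False
        have "sep (h ** matR (- (\<bar>a\<bar> + 1 + k))) (mat 1) (adj2 \<gamma>)" if "0 \<le> k" "k \<le> int (card step_edges)" for k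
        proof -
          let ?n = "\<bar>a\<bar> + 1 + k"
          have "a + ?n * ga > 0" "side B + ?n * gram2 B < 0"
            using le[OF range[OF that]] * False by linarith+
          then show ?thesis using sepI[of "- ?n"] by (simp only: mult_minus_left diff_minus_eq_add) blast
        qed
        then show False by (rule fan_contradiction[OF \<gamma>' h]) (auto intro: injI)
      qed
    qed
    then have "gram1 B \<le> (1 + m\<^sup>2) * gram2 B" by (rule gram_bound_if_side_bound[OF dB])
    then have nB: "nsq B \<le> K * gram2 B" using gram_ge_nsq[of B] by (simp add: K_def algebra_simps)
    have "gram2 B = 2 * (((\<gamma> *v w)$1)\<^sup>2 - (\<gamma> *v w)$1 * (\<gamma> *v w)$2 + ((\<gamma> *v w)$2)\<^sup>2)"
      by (simp add: gram2_def B_def h_def power2_eq_square algebra_simps)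
    also have "\<dots> \<le> 3 * vsq (\<gamma> *v w)"
    proof -
      have "2 * (p\<^sup>2 - p * q + q\<^sup>2) \<le> 3 * (p\<^sup>2 + q\<^sup>2)" for p q :: int
        using zero_le_power2[of "p + q"] by (simp add: power2_eq_square algebra_simps)
      then show ?thesis unfolding vsq_def .
    qed
    finally have g3: "gram2 B \<le> 3 * vsq (\<gamma> *v w)" .
    have "nsq \<gamma> = nsq (adj2 \<gamma>)" by simp
    also have "adj2 \<gamma> = h ** B" by (simp add: B_def adj2_cancel h)
    also have "nsq (h ** B) \<le> nsq h * nsq B" by (rule nsq_mult)
    also have "\<dots> \<le> nsq h * (K * (3 * vsq (\<gamma> *v w)))"
      using K g3 by (intro mult_left_mono order_trans[OF nB]) auto
    finally show ?thesis by (simp add: mult_ac)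
  qed
  moreover have "3 * K * nsq h > 0" using K nsq_ge_2[OF h] by simp
  ultimately show ?thesis using that by blast
qed

text \<open>The quotient of the two elements has the eigenvalue 1, hence trace 2, which in \<Gamma>
  only the identity has.\<close>

lemma column_inj:
  assumes "\<gamma> \<in> \<Gamma>" "\<gamma>' \<in> \<Gamma>" "\<gamma> *v w = \<gamma>' *v w" "coprime (w$1) (w$2)"
  shows "\<gamma> = \<gamma>'"
proof -
  let ?g = "adj2 \<gamma> ** \<gamma>'"
  have g: "?g \<in> \<Gamma>" using assms by (intro \<Gamma>_mult \<Gamma>_adj2)
  have "?g *v w = adj2 \<gamma> *v (\<gamma> *v w)" by (simp only: assms(3) matrix_vector_mul_assoc)
  also have "\<dots> = w" using \<Gamma>_det[OF assms(1)] by (simp add: matrix_vector_mul_assoc adj2_left)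
  finally have fixed: "?g$1$1 * w$1 + ?g$1$2 * w$2 = w$1" "?g$2$1 * w$1 + ?g$2$2 * w$2 = w$2"
    by (metis mult_vec22_nth)+
  have "w$1 \<noteq> 0 \<or> w$2 \<noteq> 0" using assms(4) by auto
  moreover have "?g$1$1 * ?g$2$2 - ?g$1$2 * ?g$2$1 = 1" using \<Gamma>_det[OF g] by (simp only: det_2)
  ultimately have "?g$1$1 + ?g$2$2 = 2" using fixed by (intro trace2_if_fixes)
  then have "?g = mat 1" by (intro trace2_imp_one g) (simp only: trace_int2)
  then have "\<gamma> ** ?g = \<gamma>" by simp
  then show ?thesis using \<Gamma>_det[OF assms(1)] by (simp only: adj2_cancel)
qed

lemma row_inj:
  assumes "\<gamma> \<in> \<Gamma>" "\<gamma>' \<in> \<Gamma>" "w v* \<gamma> = w v* \<gamma>'" "coprime (w$1) (w$2)"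
  shows "\<gamma> = \<gamma>'"
proof -
  let ?g = "\<gamma>' ** adj2 \<gamma>"
  have g: "?g \<in> \<Gamma>" using assms by (intro \<Gamma>_mult \<Gamma>_adj2)
  have "w v* ?g = (w v* \<gamma>) v* adj2 \<gamma>" by (simp only: assms(3) vector_matrix_mul_assoc)
  also have "\<dots> = w" using \<Gamma>_det[OF assms(1)] by (simp add: vector_matrix_mul_assoc adj2_right)
  finally have fixed: "w$1 * ?g$1$1 + w$2 * ?g$2$1 = w$1" "w$1 * ?g$1$2 + w$2 * ?g$2$2 = w$2"
    by (metis vec_mult22_nth)+
  have "w$1 \<noteq> 0 \<or> w$2 \<noteq> 0" using assms(4) by auto
  moreover have "?g$1$1 * ?g$2$2 - ?g$2$1 * ?g$1$2 = 1"
    using \<Gamma>_det[OF g] by (simp only: det_2 mult.commute)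
  ultimately have "?g$1$1 + ?g$2$2 = 2" using fixed
    by (intro trace2_if_fixes[of _ _ "?g$2$1" "?g$1$2" "w$1" "w$2"]) (simp_all only: mult.commute)
  then have "?g = mat 1" by (intro trace2_imp_one g) (simp only: trace_int2)
  then have "?g ** \<gamma> = \<gamma>" by simp
  then show ?thesis using \<Gamma>_det[OF assms(1)] by (simp add: matrix_mul_assoc[symmetric] adj2_left)
qed

lemma val_inv_word: "w \<in> lists letters \<Longrightarrow> val (inv_word w) = adj2 (val w)"
proof (induction w)
  case (Cons x w)
  then have x: "x \<in> letters" and w: "w \<in> lists letters" by auto
  have "letter_val SL2Z (inv_letter x) = adj2 (letter_val SL2Z x)"
  proof (cases x)
    case (Pair s b)
    then have "det s = 1" using x S_subset \<Gamma>_det by auto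
    then show ?thesis using Pair by (simp add: letter_val_def inv_letter_def inv_SL2Z)
  qed
  with Cons.IH[OF w] show ?case by (simp add: inv_word_Cons val_append val_Cons adj2_mult)
qed simp

text \<open>\<open>\<alpha>\<close> is the part that cancels in the product of the two words, of
  which \<open>c @ b\<close> is the reduced word.\<close>

lemma cancellation:
  assumes "g \<in> red" "h \<in> red"
  shows "\<exists>c \<alpha> b. g = c @ \<alpha> \<and> h = inv_word \<alpha> @ b \<and> c @ b \<in> red"
  using assms
proof (induction g arbitrary: h rule: rev_induct)
  case Nil
  then show ?case by (intro exI[of _ "[]"] exI[of _ h]) simp
next
  case (snoc x g)
  show ?case
  proof (cases "h \<noteq> [] \<and> hd h = inv_letter x")
    case True
    then have "h = inv_letter x # tl h" by (metis list.collapse)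
    then obtain h' where h: "h = [inv_letter x] @ h'" by (metis append_Cons append_Nil)
    have "g \<in> red" "h' \<in> red"
      using red_append(1)[OF snoc.prems(1)] red_append(2)[OF snoc.prems(2)[unfolded h]] .
    from snoc.IH[OF this] obtain c \<alpha> b where "g = c @ \<alpha>" "h' = inv_word \<alpha> @ b" "c @ b \<in> red" by blast
    then show ?thesis
      by (intro exI[of _ c] exI[of _ "\<alpha> @ [x]"] exI[of _ b]) (simp add: h inv_word_Cons)
  next
    case False
    then have "(g @ [x]) @ h \<in> red"
      unfolding reduced_words_append[of "g @ [x]" h S] using snoc.prems by (metis last_snoc)
    then show ?thesis by (intro exI[of _ "g @ [x]"] exI[of _ "[]"] exI[of _ h]) simp
  qed
qed

text \<open>The fourfold repetition of a cyclically reduced word is reduced, and any other word is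
  shortened by conjugation with its first letter. The exponent 4 is that of
  \<open>nsq_2_power4\<close>.\<close>

lemma torsion_free:
  assumes "z \<in> red" "val z ** val z ** (val z ** val z) = mat 1" shows "z = []"
  using assms
proof (induction "length z" arbitrary: z rule: less_induct)
  case less
  show ?case
  proof (rule ccontr)
    assume z: "z \<noteq> []"
    show False
    proof (cases "hd z = inv_letter (last z)")
      case False
      then have "z @ z \<in> red" using less.prems(1) by (simp add: reduced_words_append)
      then have "(z @ z) @ (z @ z) \<in> red" using False z by (simp add: reduced_words_append)
      moreover have "val ((z @ z) @ (z @ z)) = val []" using less.prems(2) by (simp only: val_append val_Nil)
      ultimately have "(z @ z) @ (z @ z) = []" by (intro inj_onD[OF inj_on_val]) simp_all
      with z show False by simp
    next
      case True
      obtain x y where zx: "z = x # y" using z by (cases z) auto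
      with True have "y \<noteq> []" by auto
      then obtain y' l where y: "y = y' @ [l]" by (cases y rule: rev_cases) auto
      have x: "x = inv_letter l" using True by (simp add: zx y)
      have zeq: "z = [x] @ (y' @ [l])" by (simp add: zx y)
      have y': "y' \<in> red" and l: "[l] \<in> red" and xr: "[x] \<in> red"
        using less.prems(1) unfolding zeq reduced_words_append by blast+
      have "y' \<noteq> []"
      proof
        assume "y' = []"
        then have "[x] @ [l] \<in> red" using less.prems(1) by (simp add: zeq)
        then show False unfolding reduced_words_append by (simp add: x)
      qed
      define X where "X = val [x]"
      have dX: "det X = 1" unfolding X_def by (intro \<Gamma>_det val_red_\<Gamma> xr)
      have "val [l] = val (inv_word [x])" by (simp add: inv_word_def x)
      also have "\<dots> = adj2 X" unfolding X_def by (rule val_inv_word[OF red_lists[OF xr]])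
      finally have "val z = X ** (val y' ** adj2 X)" unfolding zeq val_append X_def by simp
      then have "val y' = adj2 X ** val z ** X"
        by (simp add: matrix_mul_assoc[symmetric] adj2_cancel adj2_left dX)
      then have "val y' ** val y' ** (val y' ** val y') = adj2 X ** (val z ** val z ** (val z ** val z)) ** X"
        by (simp add: matrix_mul_assoc[symmetric] adj2_cancel dX)
      also have "\<dots> = mat 1" by (simp add: less.prems(2) adj2_left dX)
      finally have "y' = []" using less.hyps[of y'] y' by (simp add: zeq)
      with \<open>y' \<noteq> []\<close> show False by simp
    qed
  qed
qed

text \<open>Keeps \<open>nsq\<close> - 2, the numerator of the distance in the disc, away from
  0.\<close>

lemma nsq_ge_3: assumes "z \<in> red" "z \<noteq> []" shows "nsq (val z) \<ge> 3"
proof -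
  have d: "det (val z) = 1" by (intro \<Gamma>_det val_red_\<Gamma> assms)
  have "nsq (val z) \<noteq> 2" using torsion_free[OF assms(1) nsq_2_power4[OF d]] assms(2) by blast
  with nsq_ge_2[OF d] show ?thesis by linarith
qed

text \<open>Words longer than \<open>L0\<close> have norm above 2 C, so by the inequality of
  \<open>quasi_mult\<close> every block of \<open>L\<close> letters at least doubles the
  norm.\<close>

lemma length_le_log:
  obtains C where "C > 0" "\<And>w. w \<in> red \<Longrightarrow> real (length w) \<le> C * (1 + ln (frob_norm (val w)))"
proof -
  obtain C where C: "C > 0"
    "\<And>u v. u @ v \<in> red \<Longrightarrow> frob_norm (val u) * frob_norm (val v) \<le> C * frob_norm (val (u @ v))"
    using quasi_mult by blast
  obtain L0 where L0: "\<And>w. w \<in> red \<Longrightarrow> val w \<in> {g. frob_norm g \<le> 2 * C} \<Longrightarrow> length w \<le> L0"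
    using red_length_bound[OF finite_frob_norm_le[of "2 * C"]] by blast
  define L where "L = Suc L0"
  have main: "real (length w) \<le> L * (1 + ln (frob_norm (val w)) / ln 2)" if "w \<in> red" for w
    using that
  proof (induction "length w" arbitrary: w rule: less_induct)
    case less
    have n: "frob_norm (val w) \<ge> 1" by (intro frob_norm_ge_1 \<Gamma>_det val_red_\<Gamma> less.prems)
    show ?case
    proof (cases "length w < L")
      case True
      have "real L * 1 \<le> real L * (1 + ln (frob_norm (val w)) / ln 2)"
        using n by (intro mult_left_mono) auto
      with True show ?thesis by linarith
    next
      case False
      let ?u = "take L w" and ?v = "drop L w"
      have r: "?u @ ?v \<in> red" using less.prems by simp
      have uv: "?u \<in> red" "?v \<in> red" using red_append[OF r] by blast+
      have "length ?u = Suc L0" using False by (simp add: L_def)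
      then have "\<not> length ?u \<le> L0" by linarith
      then have "frob_norm (val ?u) > 2 * C" using L0[OF uv(1)] by (meson mem_Collect_eq not_less)
      have nv: "frob_norm (val ?v) \<ge> 1" by (intro frob_norm_ge_1 \<Gamma>_det val_red_\<Gamma> uv)
      have "(2 * C) * frob_norm (val ?v) \<le> frob_norm (val ?u) * frob_norm (val ?v)"
        using \<open>frob_norm (val ?u) > 2 * C\<close> by (intro mult_right_mono) auto
      also have "\<dots> \<le> C * frob_norm (val w)" using C(2)[OF r] by simp
      finally have "2 * frob_norm (val ?v) \<le> frob_norm (val w)" using C(1) by simp
      then have "ln (2 * frob_norm (val ?v)) \<le> ln (frob_norm (val w))" using nv by simp
      then have "ln 2 + ln (frob_norm (val ?v)) \<le> ln (frob_norm (val w))"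
        using nv by (subst (asm) ln_mult) auto
      from divide_right_mono[OF this, of "ln 2"] have ln: "1 + ln (frob_norm (val ?v)) / ln 2
        \<le> ln (frob_norm (val w)) / ln 2"
        by (simp add: add_divide_distrib)
      have "length ?v < length w" using False by (simp add: L_def)
      then have IH: "real (length ?v) \<le> L * (1 + ln (frob_norm (val ?v)) / ln 2)"
        using less.hyps uv(2) by blast
      have "real (length w) = L + real (length ?v)" using False by simp
      also have "\<dots> \<le> L + L * (ln (frob_norm (val w)) / ln 2)"
        using IH mult_left_mono[OF ln, of "real L"] by linarith
      finally show ?thesis by (simp add: algebra_simps)
    qed
  qed
  define D where "D = L / ln 2"
  have "real (length w) \<le> D * (1 + ln (frob_norm (val w)))" if "w \<in> red" for w
  proof -
    have "ln (2::real) \<le> 1" using ln_le_minus_one[of 2] by simp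
    then have "L \<le> D" by (simp add: D_def field_simps mult_left_le)
    have "real (length w) \<le> L + D * ln (frob_norm (val w))"
      using main[OF that] by (simp add: D_def algebra_simps)
    with \<open>L \<le> D\<close> show ?thesis by (simp add: algebra_simps)
  qed
  moreover have "D > 0" by (simp add: D_def L_def)
  ultimately show ?thesis using that by blast
qed

text \<open>As the words part after \<open>p\<close>, the word \<open>inv_word a @ b\<close> is
  reduced. So the numerator of the squared distance is at least of order
  \<open>nsq (val a) * nsq (val b)\<close>, and this cancels against the denominator up to the
  square of \<open>nsq (val p)\<close>.\<close>

lemma disc_pt_separation:
  obtains c where "c > 0" "\<And>p a b. p @ a \<in> red \<Longrightarrow> p @ b \<in> red \<Longrightarrow> a \<noteq> b \<Longrightarrow>
    a = [] \<or> b = [] \<or> hd a \<noteq> hd b \<Longrightarrow>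
    c / real_of_int (nsq (val p)) \<le> dist (disc_pt (val (p @ a))) (disc_pt (val (p @ b)))"
proof -
  obtain C where C: "C > 0"
    "\<And>u v. u @ v \<in> red \<Longrightarrow> frob_norm (val u) * frob_norm (val v) \<le> C * frob_norm (val (u @ v))"
    using quasi_mult by blast
  have "(1 / (2 * C)) / real_of_int (nsq (val p)) \<le> dist (disc_pt (val (p @ a))) (disc_pt (val (p @ b)))"
    if pa: "p @ a \<in> red" and pb: "p @ b \<in> red" and ab: "a \<noteq> b" and hd: "a = [] \<or> b = [] \<or> hd a \<noteq> hd b"
    for p a b
  proof -
    have p: "p \<in> red" and a: "a \<in> red" and b: "b \<in> red" using red_append[OF pa] red_append[OF pb] by blast+
    have r: "inv_word a @ b \<in> red"
      using hd a b by (auto simp: reduced_words_append reduced_inv_word last_inv_word)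
    have d: "det (val (p @ a)) = 1" "det (val (p @ b)) = 1" "det (val p) = 1" "det (val a) = 1" "det (val b) = 1"
      using pa pb p a b by (auto intro!: \<Gamma>_det val_red_\<Gamma>)
    have ia: "val (inv_word a) = adj2 (val a)" by (rule val_inv_word[OF red_lists[OF a]])
    let ?M = "val (inv_word a @ b)"
    have M: "?M = adj2 (val (p @ a)) ** val (p @ b)"
      by (simp add: val_append ia adj2_mult matrix_mul_assoc[symmetric] adj2_cancel d)
    have "inv_word a @ b \<noteq> []" using ab by auto
    then have M3: "nsq ?M \<ge> 3" by (rule nsq_ge_3[OF r])
    define x y z m where "x = real_of_int (nsq (val a))" "y = real_of_int (nsq (val b))"
      "z = real_of_int (nsq (val p))" "m = real_of_int (nsq ?M)"
    note defs = this
    have pos: "x \<ge> 2" "y \<ge> 2" "z \<ge> 2" "m \<ge> 3"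
      using nsq_ge_2[OF d(4)] nsq_ge_2[OF d(5)] nsq_ge_2[OF d(3)] M3 by (simp_all add: defs)
    have "frob_norm (val a) * frob_norm (val b) \<le> C * frob_norm ?M"
      using C(2)[OF r] by (simp add: ia)
    then have "(frob_norm (val a) * frob_norm (val b))\<^sup>2 \<le> (C * frob_norm ?M)\<^sup>2"
      by (intro power_mono) auto
    then have xy: "x * y \<le> C\<^sup>2 * m" by (simp add: power_mult_distrib frob_norm_sq defs)
    have na: "real_of_int (nsq (val (p @ a)) + 2) \<le> 2 * (z * x)"
    proof -
      have "real_of_int (nsq (val (p @ a))) \<le> z * x"
        unfolding defs of_int_mult[symmetric] of_int_le_iff val_append by (rule nsq_mult)
      moreover have "2 * 1 \<le> z * x" using pos by (intro mult_mono) auto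
      ultimately show ?thesis by simp
    qed
    have nb: "real_of_int (nsq (val (p @ b)) + 2) \<le> 2 * (z * y)"
    proof -
      have "real_of_int (nsq (val (p @ b))) \<le> z * y"
        unfolding defs of_int_mult[symmetric] of_int_le_iff val_append by (rule nsq_mult)
      moreover have "2 * 1 \<le> z * y" using pos by (intro mult_mono) auto
      ultimately show ?thesis by simp
    qed
    have pos_ab: "real_of_int (nsq (val (p @ a)) + 2) > 0" "real_of_int (nsq (val (p @ b)) + 2) > 0"
      using nsq_nonneg[of "val (p @ a)"] nsq_nonneg[of "val (p @ b)"] by linarith+
    have "((1 / (2 * C)) / z)\<^sup>2 = (m / 4) / (C\<^sup>2 * m * z\<^sup>2)"
      using pos C(1) by (simp add: power2_eq_square field_simps)
    also have "\<dots> \<le> (m / 4) / ((x * y) * z\<^sup>2)"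
      using xy pos C(1) by (intro divide_left_mono mult_right_mono mult_pos_pos) auto
    also have "\<dots> = m / ((2 * (z * x)) * (2 * (z * y)))" by (simp add: power2_eq_square field_simps)
    also have "\<dots> \<le> m / (real_of_int (nsq (val (p @ a)) + 2) * real_of_int (nsq (val (p @ b)) + 2))"
      using na nb pos_ab pos by (intro divide_left_mono mult_mono mult_pos_pos) auto
    \<comment> \<open>m \<le> 4 (m - 2) because m \<ge> 3.\<close>
    also have "\<dots> \<le> 4 * (m - 2) / (real_of_int (nsq (val (p @ a)) + 2) * real_of_int (nsq (val (p @ b)) + 2))"
      using pos pos_ab by (intro divide_right_mono mult_nonneg_nonneg) auto
    also have "\<dots> = (dist (disc_pt (val (p @ a))) (disc_pt (val (p @ b))))\<^sup>2"
      by (simp add: disc_pt_dist d defs M)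
    finally show ?thesis unfolding defs(3)[symmetric] by (rule power2_le_imp_le) simp
  qed
  with C(1) that[of "1 / (2 * C)"] show ?thesis by simp
qed

end

section \<open>The Poincare series\<close>

lemma sum_Un_le:
  fixes f :: "'a \<Rightarrow> real"
  assumes "finite A" "finite B" "\<And>x. x \<in> A \<union> B \<Longrightarrow> f x \<ge> 0"
  shows "sum f (A \<union> B) \<le> sum f A + sum f B"
proof -
  have "sum f (A \<inter> B) \<ge> 0" using assms(3) by (intro sum_nonneg) auto
  with sum.union_inter[OF assms(1,2), of f] show ?thesis by linarith
qed

lemma sum_UN_le:
  fixes f :: "'a \<Rightarrow> real"
  assumes "finite I" "\<And>i. i \<in> I \<Longrightarrow> finite (A i)" "\<And>x. f x \<ge> 0"
  shows "sum f (\<Union>i\<in>I. A i) \<le> (\<Sum>i\<in>I. sum f (A i))"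
  using assms(1,2)
proof (induction I rule: finite_induct)
  case (insert i I)
  have "sum f (A i \<union> (\<Union>i\<in>I. A i)) \<le> sum f (A i) + sum f (\<Union>i\<in>I. A i)"
    using insert assms(3) by (intro sum_Un_le) auto
  with insert show ?case by simp
qed simp

text \<open>A countable cover is fattened to open balls at a cost of at most \<eta> / 2, after which
  compactness makes it finite.\<close>

lemma hausdorff_null_cover:
  fixes A :: "'a::metric_space set"
  assumes "s > 0" "hausdorff_measure s A = 0" "compact A" "\<eta> > 0"
  obtains F :: "nat set" and x :: "nat \<Rightarrow> 'a" and r where "finite F" "\<And>i. r i > 0"
    "A \<subseteq> (\<Union>i\<in>F. ball (x i) (r i))" "(\<Sum>i\<in>F. r i powr s) \<le> \<eta>"
proof -
  have "hausdorff_premeasure s 1 A \<le> hausdorff_measure s A"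
    unfolding hausdorff_measure_def by (rule SUP_upper) simp
  then have "hausdorff_premeasure s 1 A < ennreal (\<eta> / 2)" using assms by simp
  then obtain U :: "nat \<Rightarrow> 'a set" where U: "A \<subseteq> (\<Union>i. U i)" "\<And>i. bounded (U i)"
    "(\<Sum>i. ennreal (diameter (U i) powr s)) < ennreal (\<eta> / 2)"
    unfolding hausdorff_premeasure_def INF_less_iff by auto
  define d where "d i = diameter (U i)" for i
  define e where "e i = \<eta> / 2 * (1 / 2) ^ Suc i" for i
  have e: "e i > 0" for i using assms(4) by (simp add: e_def)
  \<comment> \<open>The summand \<open>e i\<close> makes the radius positive and larger than the
    diameter, also for sets of diameter 0.\<close>
  define r where "r i = (d i powr s + e i) powr (1 / s)" for i
  have rs: "r i powr s = d i powr s + e i" for i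
    using e[of i] assms(1) by (simp add: r_def powr_powr add_nonneg_nonneg less_imp_le)
  have r0: "r i > 0" for i using e[of i] powr_ge_zero[of "d i" s] unfolding r_def powr_gt_zero by linarith
  have rd: "d i < r i" for i
  proof -
    have "d i powr s < r i powr s" using rs e[of i] by simp
    then show ?thesis using powr_mono2[of s "r i" "d i"] assms(1) r0[of i] by fastforce
  qed
  define x where "x i = (SOME y. y \<in> U i)" for i
  have Ub: "U i \<subseteq> ball (x i) (r i)" for i
  proof
    fix y assume y: "y \<in> U i"
    then have "x i \<in> U i" unfolding x_def by (rule someI)
    then have "dist (x i) y \<le> d i" unfolding d_def by (intro diameter_bounded_bound U y)
    with rd[of i] show "y \<in> ball (x i) (r i)" by simp
  qed
  have "A \<subseteq> (\<Union>i\<in>UNIV. ball (x i) (r i))" using U(1) Ub by blast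
  then obtain F where F: "finite F" "A \<subseteq> (\<Union>i\<in>F. ball (x i) (r i))"
    using compactE_image[OF assms(3), of UNIV "\<lambda>i. ball (x i) (r i)"] by auto
  have "ennreal (\<Sum>i\<in>F. d i powr s) = (\<Sum>i\<in>F. ennreal (d i powr s))" by simp
  also have "\<dots> \<le> (\<Sum>i. ennreal (d i powr s))" by (intro sum_le_suminf F) auto
  also have "\<dots> < ennreal (\<eta> / 2)" using U(3) by (simp add: d_def)
  finally have "(\<Sum>i\<in>F. d i powr s) < \<eta> / 2"
    by (simp add: ennreal_less_iff sum_nonneg)
  moreover have "(\<Sum>i\<in>F. e i) \<le> (\<Sum>i. e i)"
  proof (intro sum_le_suminf F)
    show "summable e" unfolding e_def using sums_summable[OF power_half_series] by (intro summable_mult)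
  qed (use e in \<open>auto intro: less_imp_le\<close>)
  moreover have "(\<Sum>i. e i) = \<eta> / 2"
    unfolding e_def using sums_mult[OF power_half_series, of "\<eta> / 2"] by (simp add: sums_iff)
  ultimately have "(\<Sum>i\<in>F. r i powr s) \<le> \<eta>" by (simp add: rs sum.distrib)
  with F r0 that show ?thesis by blast
qed

text \<open>\<open>p\<close> is the longest common prefix of the words in \<open>G\<close>: either a
  word of \<open>G\<close> ends there, or two of them continue with different letters.\<close>

lemma branching_prefix:
  assumes "w1 \<in> G" "w2 \<in> G" "w1 \<noteq> w2"
  obtains p a b where "\<forall>w\<in>G. \<exists>v. w = p @ v" "p @ a \<in> G" "p @ b \<in> G" "a \<noteq> b"
    "a = [] \<or> b = [] \<or> hd a \<noteq> hd b"
proof -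
  define common where "common n \<longleftrightarrow> (\<forall>w\<in>G. n \<le> length w \<and> take n w = take n w1)" for n
  have "common 0" by (simp add: common_def)
  moreover have "\<And>n. common n \<Longrightarrow> n \<le> length w1" using assms(1) by (auto simp: common_def)
  ultimately obtain n where n: "common n" and max: "\<And>m. common m \<Longrightarrow> m \<le> n"
    using GreatestI_nat[of common 0 "length w1"] Greatest_le_nat[of common _ "length w1"] by metis
  define p where "p = take n w1"
  have pre: "w = p @ drop n w" if "w \<in> G" for w
    using n that unfolding common_def p_def by (metis append_take_drop_id)
  have len: "n \<le> length w" if "w \<in> G" for w using n that by (simp add: common_def)
  show ?thesis
  proof (cases "\<exists>w\<in>G. length w = n")
    case True
    then obtain w where w: "w \<in> G" "length w = n" by blast
    then have wp: "p @ [] \<in> G" using pre[of w] by simp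
    obtain w' where w': "w' \<in> G" "w' \<noteq> w" using assms by blast
    have "drop n w' \<noteq> []"
    proof
      assume "drop n w' = []"
      then have "w' = p" using pre[OF w'(1)] by simp
      moreover have "w = p" using pre[OF w(1)] w(2) by simp
      ultimately show False using w'(2) by simp
    qed
    moreover have "p @ drop n w' \<in> G" using pre[OF w'(1)] w'(1) by simp
    ultimately show ?thesis using that[of p "[]" "drop n w'"] wp pre by metis
  next
    case False
    have "\<not> common (Suc n)" using max[of "Suc n"] by auto
    moreover have "Suc n \<le> length w" if "w \<in> G" for w
      using False len[OF that] that by (metis Suc_leI le_neq_implies_less)
    ultimately obtain w where w: "w \<in> G" "take (Suc n) w \<noteq> take (Suc n) w1"
      and l: "n < length w" "n < length w1" using assms(1) unfolding common_def by (meson Suc_le_lessD)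
    have "take n w = take n w1" using n w(1) by (simp add: common_def)
    then have "w ! n \<noteq> w1 ! n" using w(2) l by (simp add: take_Suc_conv_app_nth)
    then have hd: "hd (drop n w) \<noteq> hd (drop n w1)" using l by (simp add: hd_drop_conv_nth)
    then have "drop n w \<noteq> drop n w1" by metis
    moreover have "p @ drop n w \<in> G" "p @ drop n w1 \<in> G"
      using pre[OF w(1)] pre[OF assms(1)] w(1) assms(1) by simp_all
    ultimately show ?thesis using that[of p "drop n w" "drop n w1"] pre hd by metis
  qed
qed

context free_nonparabolic
begin

lemma disc_pt_inj: "inj_on disc_pt \<Gamma>"
proof (rule inj_onI)
  fix g g' assume g: "g \<in> \<Gamma>" "g' \<in> \<Gamma>" "disc_pt g = disc_pt g'"
  have d: "det g = 1" "det g' = 1" using g \<Gamma>_det by auto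
  have pos: "real_of_int (nsq g + 2) > 0" "real_of_int (nsq g' + 2) > 0"
    using nsq_nonneg[of g] nsq_nonneg[of g'] by linarith+
  let ?M = "adj2 g ** g'"
  have "4 * real_of_int (nsq ?M - 2) / (real_of_int (nsq g + 2) * real_of_int (nsq g' + 2)) = 0"
    using disc_pt_dist[OF d] g(3) by simp
  with pos have "nsq ?M = 2" by (simp del: of_int_diff of_int_add)
  have "?M \<in> \<Gamma>" using g by (intro \<Gamma>_mult \<Gamma>_adj2)
  then obtain z where z: "z \<in> red" "?M = val z" by (rule obtain_word)
  have "z = []" using nsq_ge_3[OF z(1)] \<open>nsq ?M = 2\<close> z(2) by fastforce
  then have "?M = mat 1" using z(2) by simp
  then have "g ** ?M = g" by simp
  then show "g = g'" using d by (simp add: adj2_cancel)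
qed

lemma compact_limit_set: "compact (limit_set \<Gamma>)"
proof -
  have "limit_set \<Gamma> = sphere 0 1 \<inter> {\<zeta>. \<zeta> islimpt ((\<lambda>\<gamma>. cayley (moebius_act \<gamma> \<i>)) ` \<Gamma>)}"
    by (auto simp: limit_set_def)
  then show ?thesis using compact_Int_closed[OF compact_sphere closed_limpts] by simp
qed

text \<open>Infinitely many orbit points outside U would accumulate in the closed disc. As each
  smaller concentric disc contains only finitely many, the accumulation point is on the circle,
  hence in the limit set and in the open set U, a contradiction.\<close>

lemma finite_disc_pt_outside:
  assumes "open U" "limit_set \<Gamma> \<subseteq> U"
  shows "finite {\<gamma> \<in> \<Gamma>. disc_pt \<gamma> \<notin> U}"
proof (rule ccontr)
  let ?X = "{\<gamma> \<in> \<Gamma>. disc_pt \<gamma> \<notin> U}"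
  assume inf: "infinite ?X"
  have inj: "inj_on disc_pt ?X" by (rule inj_on_subset[OF disc_pt_inj]) auto
  have "infinite (disc_pt ` ?X)" using inf finite_imageD[OF _ inj] by blast
  moreover have "cmod (disc_pt g) \<le> 1" if "g \<in> \<Gamma>" for g
  proof -
    have "(cmod (disc_pt g))\<^sup>2 \<le> 1\<^sup>2"
      using disc_pt_norm[OF \<Gamma>_det[OF that]] nsq_nonneg[of g] by (simp del: nsq_nonneg)
    then show ?thesis by (rule power2_le_imp_le) simp
  qed
  then have "disc_pt ` ?X \<subseteq> cball 0 1" by auto
  ultimately obtain \<zeta> where \<zeta>: "\<zeta> \<in> cball 0 1" "\<zeta> islimpt (disc_pt ` ?X)"
    using compact_eq_Bolzano_Weierstrass[THEN iffD1, OF compact_cball, rule_format] by blast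
  have "cmod \<zeta> = 1"
  proof (rule ccontr)
    assume "cmod \<zeta> \<noteq> 1"
    with \<zeta>(1) have lt: "cmod \<zeta> < 1" by simp
    define \<epsilon> where "\<epsilon> = (1 - cmod \<zeta>) / 2"
    define b where "b = 1 - \<epsilon>"
    have \<epsilon>: "\<epsilon> > 0" "\<epsilon> \<le> 1/2" using lt by (simp_all add: \<epsilon>_def)
    then have b: "0 < b" "b < 1" by (simp_all add: b_def)
    then have b2: "1 - b\<^sup>2 > 0" by (simp add: power_less_one_iff)
    have inf': "infinite (disc_pt ` ?X \<inter> ball \<zeta> \<epsilon>)"
      using \<zeta>(2) \<epsilon> by (simp add: islimpt_eq_infinite_ball)
    have "disc_pt ` ?X \<inter> ball \<zeta> \<epsilon> \<subseteq> disc_pt ` {g. nsq g \<le> \<lceil>4 / (1 - b\<^sup>2)\<rceil>}"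
    proof
      fix y assume y: "y \<in> disc_pt ` ?X \<inter> ball \<zeta> \<epsilon>"
      then obtain g where g: "g \<in> \<Gamma>" "y = disc_pt g" by blast
      have "cmod y \<le> cmod \<zeta> + dist \<zeta> y" unfolding dist_norm by norm
      also have "\<dots> \<le> b" using y by (simp add: b_def \<epsilon>_def field_simps)
      finally have "(cmod y)\<^sup>2 \<le> b\<^sup>2" by (intro power_mono) auto
      then have "1 - b\<^sup>2 \<le> 4 / real_of_int (nsq g + 2)" using disc_pt_norm[OF \<Gamma>_det[OF g(1)]] g(2) by simp
      moreover have "real_of_int (nsq g + 2) > 0" using nsq_nonneg[of g] by linarith
      ultimately have "real_of_int (nsq g + 2) * (1 - b\<^sup>2) \<le> 4" by (simp add: pos_le_divide_eq mult.commute)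
      then have "real_of_int (nsq g + 2) \<le> 4 / (1 - b\<^sup>2)" using b2 by (simp add: pos_le_divide_eq)
      then have "nsq g \<le> \<lceil>4 / (1 - b\<^sup>2)\<rceil>" by linarith
      then show "y \<in> disc_pt ` {g. nsq g \<le> \<lceil>4 / (1 - b\<^sup>2)\<rceil>}" using g(2) by blast
    qed
    then show False using inf' finite_subset finite_imageI[OF finite_nsq_le] by blast
  qed
  moreover have "\<zeta> islimpt (disc_pt ` \<Gamma>)" using \<zeta>(2) by (rule islimpt_subset) auto
  ultimately have "\<zeta> \<in> limit_set \<Gamma>" by (simp add: limit_set_def disc_pt_def)
  then have "\<zeta> \<in> U" using assms(2) by blast
  moreover have "\<zeta> islimpt (- U)" using \<zeta>(2) by (rule islimpt_subset) auto
  then have "\<zeta> \<in> - U" using assms(1) closed_limpt[of "- U"] by auto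
  ultimately show False by blast
qed

text \<open>Almost all words begin with one of finitely many words \<open>p\<close> for which the sum of
  \<open>frob_norm (val p) powr (-2s)\<close> is small, and the partial sums \<open>Z n\<close> over words of length at most \<open>n\<close>
  satisfy \<open>Z n \<le> Z0 + Z n / 2\<close>.\<close>

lemma poincare_series_bounded:
  assumes "s > 0" "hausdorff_measure s (limit_set \<Gamma>) = 0"
  obtains Z where "Z > 0"
    "\<And>F. finite F \<Longrightarrow> F \<subseteq> \<Gamma> \<Longrightarrow> (\<Sum>\<gamma>\<in>F. frob_norm \<gamma> powr (- 2 * s)) \<le> Z"
proof -
  obtain C where C: "C > 0"
    "\<And>u v. u @ v \<in> red \<Longrightarrow> frob_norm (val u) * frob_norm (val v) \<le> C * frob_norm (val (u @ v))"
    using quasi_mult by blast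
  obtain c where c: "c > 0" "\<And>p a b. p @ a \<in> red \<Longrightarrow> p @ b \<in> red \<Longrightarrow> a \<noteq> b \<Longrightarrow>
    a = [] \<or> b = [] \<or> hd a \<noteq> hd b \<Longrightarrow>
    c / real_of_int (nsq (val p)) \<le> dist (disc_pt (val (p @ a))) (disc_pt (val (p @ b)))"
    using disc_pt_separation by blast
  define P where "P w = frob_norm (val w) powr (- 2 * s)" for w
  have P0: "P w \<ge> 0" for w by (simp add: P_def)
  have npos: "frob_norm (val w) > 0" if "w \<in> red" for w by (intro frob_norm_pos \<Gamma>_det val_red_\<Gamma> that)
  have P_mult: "P (u @ v) \<le> C powr (2 * s) * (P u * P v)" if r: "u @ v \<in> red" for u v
  proof -
    have uv: "u \<in> red" "v \<in> red" using red_append[OF r] by blast+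
    have "P (u @ v) \<le> (frob_norm (val u) * frob_norm (val v) / C) powr (- 2 * s)"
      unfolding P_def using C(2)[OF r] C(1) npos[OF uv(1)] npos[OF uv(2)] assms(1)
      by (intro powr_mono2') (auto simp: field_simps)
    also have "\<dots> = C powr (2 * s) * (P u * P v)"
      using C(1) npos[OF uv(1)] npos[OF uv(2)]
      by (simp add: P_def powr_divide powr_mult powr_minus_divide)
    finally show ?thesis .
  qed
  \<comment> \<open>Chosen for \<open>half\<close>: splitting off a prefix costs the factor of
    \<open>P_mult\<close>, and comparing the prefix with its ball costs
    \<open>(2 / c) powr s\<close>.\<close>
  define \<eta> where "\<eta> = 1 / (2 * C powr (2 * s) * (2 / c) powr s)"
  have \<eta>: "\<eta> > 0" using C(1) c(1) by (simp add: \<eta>_def)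
  obtain F :: "nat set" and x r where F: "finite F" "\<And>i. r i > 0"
    "limit_set \<Gamma> \<subseteq> (\<Union>i\<in>F. ball (x i) (r i))" "(\<Sum>i\<in>F. r i powr s) \<le> \<eta>"
    using hausdorff_null_cover[OF assms compact_limit_set \<eta>] by metis
  define G where "G i = {w \<in> red. disc_pt (val w) \<in> ball (x i) (r i)}" for i
  define F' where "F' = {i \<in> F. \<exists>w1\<in>G i. \<exists>w2\<in>G i. w1 \<noteq> w2}"
  have finF': "finite F'" using F(1) by (simp add: F'_def)
  \<comment> \<open>Besides the words whose points miss all balls, this contains the words that are
    alone in a ball. Without a second word there is no branching, and the radius gives no
    information on a prefix.\<close>
  define Ex where "Ex = {w \<in> red. val w \<in> {\<gamma> \<in> \<Gamma>. disc_pt \<gamma> \<notin> (\<Union>i\<in>F. ball (x i) (r i))}} \<union> (\<Union>i\<in>F - F'. G i)"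
  have "finite (G i)" if "i \<in> F - F'" for i
  proof -
    have "\<forall>w1\<in>G i. \<forall>w2\<in>G i. w1 = w2" using that by (auto simp: F'_def)
    then have "G i \<subseteq> {SOME w. w \<in> G i}" by (metis singletonI someI_ex subsetI)
    then show ?thesis by (rule finite_subset) simp
  qed
  then have finEx: "finite Ex" unfolding Ex_def
    using F(1) by (intro finite_UnI finite_UN_I finite_red_val finite_disc_pt_outside[OF _ F(3)]) auto
  have "\<exists>p. (\<forall>w\<in>G i. \<exists>v. w = p @ v) \<and> P p \<le> (2 / c) powr s * r i powr s" if iF: "i \<in> F'" for i
  proof -
    obtain w1 w2 where w12: "w1 \<in> G i" "w2 \<in> G i" "w1 \<noteq> w2" using iF unfolding F'_def by blast
    obtain p a b where p: "\<forall>w\<in>G i. \<exists>v. w = p @ v" "p @ a \<in> G i" "p @ b \<in> G i" "a \<noteq> b"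
      "a = [] \<or> b = [] \<or> hd a \<noteq> hd b" by (rule branching_prefix[OF w12])
    have r: "p @ a \<in> red" "p @ b \<in> red" using p(2,3) by (simp_all add: G_def)
    have pr: "p \<in> red" using red_append[OF r(1)] by blast
    have "dist (disc_pt (val (p @ a))) (disc_pt (val (p @ b)))
        \<le> dist (x i) (disc_pt (val (p @ a))) + dist (x i) (disc_pt (val (p @ b)))"
      by (rule dist_triangle3)
    also have "\<dots> \<le> 2 * r i" using p(2,3) by (simp add: G_def)
    finally have le: "c / real_of_int (nsq (val p)) \<le> 2 * r i" using c(2)[OF r p(4,5)] by linarith
    define n where "n = real_of_int (nsq (val p))"
    have n: "n > 0" using nsq_ge_2[OF \<Gamma>_det[OF val_red_\<Gamma>[OF pr]]] by (simp add: n_def)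
    have "P p = n powr (- s)"
    proof -
      have "n = frob_norm (val p) powr 2" using npos[OF pr] by (simp add: n_def flip: frob_norm_sq)
      moreover have "P p = (frob_norm (val p) powr 2) powr (- s)" unfolding P_def powr_powr by simp
      ultimately show ?thesis by (simp only:)
    qed
    also have "\<dots> = (1 / n) powr s" using n by (simp add: powr_minus_divide powr_divide)
    also have "\<dots> \<le> (2 / c * r i) powr s"
      using le c(1) n assms(1) unfolding n_def[symmetric] by (intro powr_mono2) (auto simp: field_simps)
    also have "\<dots> = (2 / c) powr s * r i powr s" by (rule powr_mult)
    finally show ?thesis using p(1) by blast
  qed
  then obtain p where p: "\<And>i w. i \<in> F' \<Longrightarrow> w \<in> G i \<Longrightarrow> \<exists>v. w = p i @ v"
    "\<And>i. i \<in> F' \<Longrightarrow> P (p i) \<le> (2 / c) powr s * r i powr s" by metis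
  \<comment> \<open>With bounded length the sums are finite, so that half of them can be subtracted,
    and removing a prefix does not leave \<open>W n\<close>.\<close>
  define W where "W n = {w \<in> red. length w \<le> n}" for n
  have finW: "finite (W n)" for n unfolding W_def by (rule finite_red_length)
  define Z0 where "Z0 = (\<Sum>w\<in>Ex. P w)"
  have half: "(\<Sum>i\<in>F'. C powr (2 * s) * P (p i)) \<le> 1 / 2"
  proof -
    have "(\<Sum>i\<in>F'. C powr (2 * s) * P (p i)) \<le> (\<Sum>i\<in>F'. C powr (2 * s) * ((2 / c) powr s * r i powr s))"
      by (intro sum_mono mult_left_mono p) auto
    also have "\<dots> \<le> (\<Sum>i\<in>F. C powr (2 * s) * ((2 / c) powr s * r i powr s))"
      using F(1) by (intro sum_mono2) (auto simp: F'_def)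
    also have "\<dots> = C powr (2 * s) * (2 / c) powr s * (\<Sum>i\<in>F. r i powr s)"
      unfolding sum_distrib_left by (simp only: mult.assoc)
    also have "\<dots> \<le> C powr (2 * s) * (2 / c) powr s * \<eta>" by (intro mult_left_mono F) auto
    also have "\<dots> = 1 / 2" using C(1) c(1) by (simp add: \<eta>_def)
    finally show ?thesis .
  qed
  have Z: "(\<Sum>w\<in>W n. P w) \<le> 2 * Z0" for n
  proof -
    have "W n \<subseteq> Ex \<union> (\<Union>i\<in>F'. {w \<in> W n. \<exists>v. w = p i @ v})"
    proof
      fix w assume w: "w \<in> W n"
      then have wr: "w \<in> red" by (simp add: W_def)
      show "w \<in> Ex \<union> (\<Union>i\<in>F'. {w \<in> W n. \<exists>v. w = p i @ v})"
      proof (cases "w \<in> Ex")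
        case False
        then have "disc_pt (val w) \<in> (\<Union>i\<in>F. ball (x i) (r i))"
          using wr val_red_\<Gamma>[OF wr] unfolding Ex_def by blast
        then obtain i where i: "i \<in> F" "w \<in> G i" using wr by (auto simp: G_def)
        then have "i \<in> F'" using False unfolding Ex_def by blast
        with p(1)[of i w] i w show ?thesis by blast
      qed simp
    qed
    then have "(\<Sum>w\<in>W n. P w) \<le> (\<Sum>w\<in>Ex \<union> (\<Union>i\<in>F'. {w \<in> W n. \<exists>v. w = p i @ v}). P w)"
      using finEx finF' finW P0 by (intro sum_mono2) auto
    also have "\<dots> \<le> Z0 + (\<Sum>w\<in>(\<Union>i\<in>F'. {w \<in> W n. \<exists>v. w = p i @ v}). P w)"
      unfolding Z0_def using finEx finF' finW P0 by (intro sum_Un_le) auto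
    also have "(\<Sum>w\<in>(\<Union>i\<in>F'. {w \<in> W n. \<exists>v. w = p i @ v}). P w)
        \<le> (\<Sum>i\<in>F'. \<Sum>w\<in>{w \<in> W n. \<exists>v. w = p i @ v}. P w)"
      using finF' finW P0 by (intro sum_UN_le) auto
    also have "\<dots> \<le> (\<Sum>i\<in>F'. C powr (2 * s) * P (p i) * (\<Sum>w\<in>W n. P w))"
    proof (intro sum_mono)
      fix i assume "i \<in> F'"
      let ?V = "{v. p i @ v \<in> W n}"
      have VW: "?V \<subseteq> W n" using red_append(2) by (auto simp: W_def)
      have eq: "{w \<in> W n. \<exists>v. w = p i @ v} = (@) (p i) ` ?V" by auto
      have "(\<Sum>w\<in>{w \<in> W n. \<exists>v. w = p i @ v}. P w) = (\<Sum>v\<in>?V. P (p i @ v))"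
        unfolding eq by (subst sum.reindex) (auto simp: inj_on_def)
      also have "\<dots> \<le> (\<Sum>v\<in>?V. C powr (2 * s) * (P (p i) * P v))"
        by (intro sum_mono P_mult) (simp add: W_def)
      also have "\<dots> \<le> (\<Sum>v\<in>W n. C powr (2 * s) * (P (p i) * P v))"
        using finW VW P0 by (intro sum_mono2) auto
      also have "\<dots> = C powr (2 * s) * P (p i) * (\<Sum>w\<in>W n. P w)"
        unfolding sum_distrib_left by (simp only: mult.assoc)
      finally show "(\<Sum>w\<in>{w \<in> W n. \<exists>v. w = p i @ v}. P w) \<le> C powr (2 * s) * P (p i) * (\<Sum>w\<in>W n. P w)" .
    qed
    also have "\<dots> = (\<Sum>i\<in>F'. C powr (2 * s) * P (p i)) * (\<Sum>w\<in>W n. P w)"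
      by (rule sum_distrib_right[symmetric])
    also have "\<dots> \<le> 1 / 2 * (\<Sum>w\<in>W n. P w)" using half P0 by (intro mult_right_mono sum_nonneg) auto
    finally show ?thesis by simp
  qed
  have Z0: "Z0 \<ge> 0" unfolding Z0_def using P0 by (intro sum_nonneg) auto
  have "(\<Sum>\<gamma>\<in>A. frob_norm \<gamma> powr (- 2 * s)) \<le> 2 * Z0 + 1" if A: "finite A" "A \<subseteq> \<Gamma>" for A
  proof -
    obtain n where n: "\<And>w. w \<in> red \<Longrightarrow> val w \<in> A \<Longrightarrow> length w \<le> n" using red_length_bound[OF A(1)] by blast
    have "A \<subseteq> val ` W n"
    proof
      fix g assume g: "g \<in> A"
      then obtain w where "w \<in> red" "g = val w" using A(2) obtain_word by blast
      then show "g \<in> val ` W n" using n g by (auto simp: W_def)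
    qed
    then have "(\<Sum>\<gamma>\<in>A. frob_norm \<gamma> powr (- 2 * s)) \<le> (\<Sum>\<gamma>\<in>val ` W n. frob_norm \<gamma> powr (- 2 * s))"
      using finW by (intro sum_mono2) auto
    also have "\<dots> = (\<Sum>w\<in>W n. P w)"
      unfolding P_def by (subst sum.reindex[OF inj_on_subset[OF inj_on_val]]) (auto simp: W_def)
    finally show ?thesis using Z[of n] by linarith
  qed
  moreover have "2 * Z0 + 1 > 0" using Z0 by linarith
  ultimately show ?thesis using that by blast
qed

text \<open>Each term of the sum over \<open>F\<close> is at least
  \<open>T powr (- 2 * s)\<close>.\<close>

lemma card_le_of_poincare:
  assumes "\<And>F. finite F \<Longrightarrow> F \<subseteq> \<Gamma> \<Longrightarrow> (\<Sum>\<gamma>\<in>F. frob_norm \<gamma> powr (- 2 * s)) \<le> Z"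
    and "s > 0" "F \<subseteq> \<Gamma>" "\<And>\<gamma>. \<gamma> \<in> F \<Longrightarrow> frob_norm \<gamma> \<le> T" "T > 0"
  shows "real (card F) \<le> Z * T powr (2 * s)"
proof -
  have fin: "finite F" by (rule finite_subset[OF _ finite_frob_norm_le[of T]]) (use assms(4) in auto)
  have "real (card F) * T powr (- 2 * s) = (\<Sum>\<gamma>\<in>F. T powr (- 2 * s))" by simp
  also have "\<dots> \<le> (\<Sum>\<gamma>\<in>F. frob_norm \<gamma> powr (- 2 * s))"
    using assms by (intro sum_mono powr_mono2' frob_norm_pos \<Gamma>_det) auto
  also have "\<dots> \<le> Z" by (rule assms(1)[OF fin assms(3)])
  finally have "real (card F) * T powr (- 2 * s) * T powr (2 * s) \<le> Z * T powr (2 * s)"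
    by (intro mult_right_mono) auto
  then show ?thesis using assms(5) by (simp add: mult.assoc flip: powr_add)
qed

end

section \<open>Solutions of a b = a' b' in \<Gamma>\<close>

context free_nonparabolic
begin

text \<open>If \<open>g = c @ \<alpha>\<close> and \<open>h = \<alpha>\<inverse> @ b\<close> with \<open>c @ b\<close> reduced, then \<open>c\<close> is short, and \<open>g\<close> is determined
  by \<open>c\<close> and the length of \<open>\<alpha>\<close>.\<close>

lemma card_right_translates:
  assumes Z: "\<And>F. finite F \<Longrightarrow> F \<subseteq> \<Gamma> \<Longrightarrow> (\<Sum>\<gamma>\<in>F. frob_norm \<gamma> powr (- 2 * s)) \<le> Z"
    and "Z > 0" "s > 0"
  obtains D where "D > 0" "\<And>h R. h \<in> \<Gamma> \<Longrightarrow> R \<ge> 1 \<Longrightarrow>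
    real (card {\<gamma> \<in> \<Gamma>. frob_norm \<gamma> < R \<and> frob_norm (\<gamma> ** h) < R})
      \<le> D * (1 + ln R) * (R\<^sup>2 / frob_norm h) powr s"
proof -
  obtain C where C: "C > 0"
    "\<And>u v. u @ v \<in> red \<Longrightarrow> frob_norm (val u) * frob_norm (val v) \<le> C * frob_norm (val (u @ v))"
    using quasi_mult by blast
  obtain C' where C': "C' > 0" "\<And>w. w \<in> red \<Longrightarrow> real (length w) \<le> C' * (1 + ln (frob_norm (val w)))"
    using length_le_log by blast
  define D where "D = (2 * C' + 1) * (Z * C powr (2 * s))"
  have main: "real (card {\<gamma> \<in> \<Gamma>. frob_norm \<gamma> < R \<and> frob_norm (\<gamma> ** h) < R})
      \<le> D * (1 + ln R) * (R\<^sup>2 / frob_norm h) powr s" (is "real (card ?A) \<le> ?rhs")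
    if h: "h \<in> \<Gamma>" and R: "R \<ge> 1" for h R
  proof (cases "?A = {}")
    case True
    have "?rhs \<ge> 0" using R assms(2) C' by (simp add: D_def)
    then show ?thesis unfolding True by simp
  next
    case False
    obtain w where w: "w \<in> red" "h = val w" using h by (rule obtain_word)
    have dh: "det h = 1" by (rule \<Gamma>_det[OF h])
    have nh: "frob_norm h \<ge> 1" by (rule frob_norm_ge_1[OF dh])
    \<comment> \<open>The product of |c| |\<alpha>| \<le> C R and |c| |b| \<le> C R, together with
      |h| \<le> |\<alpha>| |b|, gives |c| \<le> T.\<close>
    define T where "T = C * R / sqrt (frob_norm h)"
    have T: "T > 0" using C R nh by (simp add: T_def)
    have T2: "T\<^sup>2 = C\<^sup>2 * (R\<^sup>2 / frob_norm h)" using nh by (simp add: T_def power_divide power_mult_distrib)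
    define B where "B = {\<gamma> \<in> \<Gamma>. frob_norm \<gamma> \<le> T}"
    have finB: "finite B" by (rule finite_subset[OF _ finite_frob_norm_le[of T]]) (auto simp: B_def)
    have cardB: "real (card B) \<le> Z * T powr (2 * s)"
      by (rule card_le_of_poincare[OF Z assms(3)]) (auto simp: B_def T)
    have sub: "?A \<subseteq> (\<Union>k\<in>{..length w}. (\<lambda>c. c ** adj2 (val (take k w))) ` B)"
    proof
      fix g assume g: "g \<in> ?A"
      then obtain u where u: "u \<in> red" "g = val u" using obtain_word by blast
      obtain c \<alpha> b where cab: "u = c @ \<alpha>" "w = inv_word \<alpha> @ b" "c @ b \<in> red"
        using cancellation[OF u(1) w(1)] by blast
      have r: "c \<in> red" "\<alpha> \<in> red" "b \<in> red"
        using red_append(1)[OF cab(3)] red_append(2)[OF cab(3)] red_append(2)[of c \<alpha>] u(1) cab(1) by blast+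
      have d\<alpha>: "det (val \<alpha>) = 1" by (intro \<Gamma>_det val_red_\<Gamma> r)
      have i\<alpha>: "val (inv_word \<alpha>) = adj2 (val \<alpha>)" by (rule val_inv_word[OF red_lists[OF r(2)]])
      have gc: "g = val c ** val \<alpha>" by (simp add: u(2) cab(1) val_append)
      have hb: "h = adj2 (val \<alpha>) ** val b" by (simp add: w(2) cab(2) val_append i\<alpha>)
      have gh: "g ** h = val (c @ b)"
        by (simp add: gc hb val_append matrix_mul_assoc[symmetric] adj2_cancel d\<alpha>)
      have "frob_norm (val c) * frob_norm (val \<alpha>) \<le> C * frob_norm g"
        using C(2)[of c \<alpha>] u cab(1) by simp
      also have "\<dots> \<le> C * R" using g C(1) by (intro mult_left_mono) auto
      finally have 1: "frob_norm (val c) * frob_norm (val \<alpha>) \<le> C * R" .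
      have "frob_norm (val c) * frob_norm (val b) \<le> C * frob_norm (g ** h)"
        using C(2)[OF cab(3)] by (simp add: gh)
      also have "\<dots> \<le> C * R" using g C(1) by (intro mult_left_mono) auto
      finally have 2: "frob_norm (val c) * frob_norm (val b) \<le> C * R" .
      have "(frob_norm (val c))\<^sup>2 * frob_norm h \<le> (frob_norm (val c))\<^sup>2 * (frob_norm (val \<alpha>) * frob_norm (val b))"
        using frob_norm_mult[of "adj2 (val \<alpha>)" "val b"] by (intro mult_left_mono) (simp_all add: hb)
      also have "\<dots> = (frob_norm (val c) * frob_norm (val \<alpha>)) * (frob_norm (val c) * frob_norm (val b))"
        by (simp add: power2_eq_square)
      also have "\<dots> \<le> (C * R) * (C * R)" using C(1) R by (intro mult_mono[OF 1 2]) auto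
      finally have "(frob_norm (val c))\<^sup>2 \<le> (C * R) * (C * R) / frob_norm h"
        using nh by (simp add: pos_le_divide_eq)
      also have "\<dots> = T\<^sup>2" unfolding T2 by (simp add: power2_eq_square)
      finally have "(frob_norm (val c))\<^sup>2 \<le> T\<^sup>2" .
      then have "frob_norm (val c) \<le> T" using T by (rule power2_le_imp_le[OF _ less_imp_le])
      then have cB: "val c \<in> B" using val_red_\<Gamma>[OF r(1)] by (simp add: B_def)
      have "take (length \<alpha>) w = inv_word \<alpha>" by (simp add: cab(2))
      then have "g = val c ** adj2 (val (take (length \<alpha>) w))" by (simp add: gc i\<alpha>)
      moreover have "length \<alpha> \<in> {..length w}" by (simp add: cab(2))
      ultimately show "g \<in> (\<Union>k\<in>{..length w}. (\<lambda>c. c ** adj2 (val (take k w))) ` B)"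
        using cB by (intro UN_I image_eqI)
    qed
    have "card ?A \<le> card (\<Union>k\<in>{..length w}. (\<lambda>c. c ** adj2 (val (take k w))) ` B)"
      using finB by (intro card_mono[OF _ sub]) auto
    also have "\<dots> \<le> (\<Sum>k\<in>{..length w}. card ((\<lambda>c. c ** adj2 (val (take k w))) ` B))"
      by (rule card_UN_le) simp
    also have "\<dots> \<le> (\<Sum>k\<in>{..length w}. card B)" by (intro sum_mono card_image_le finB)
    also have "\<dots> = Suc (length w) * card B" by simp
    finally have "real (card ?A) \<le> real (Suc (length w) * card B)" by (rule of_nat_mono)
    also have "\<dots> = (1 + real (length w)) * real (card B)" by (simp add: distrib_right)
    also have "\<dots> \<le> ((2 * C' + 1) * (1 + ln R)) * (Z * T powr (2 * s))"
    proof (intro mult_mono cardB)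
      obtain g where g: "frob_norm g < R" "frob_norm (g ** h) < R" "g \<in> \<Gamma>" using False by blast
      have "frob_norm h \<le> frob_norm g * frob_norm (g ** h)" by (rule frob_norm_mult_ge[OF \<Gamma>_det[OF g(3)]])
      also have "\<dots> \<le> R * R" using g R by (intro mult_mono) auto
      finally have "ln (frob_norm h) \<le> ln (R * R)" using nh R by simp
      also have "\<dots> = 2 * ln R" using R by (simp add: ln_mult)
      finally have "C' * (1 + ln (frob_norm h)) \<le> C' * (1 + 2 * ln R)" using C'(1) by simp
      with C'(2)[OF w(1)] have "real (length w) \<le> C' * (1 + 2 * ln R)" by (simp add: w(2))
      also have "\<dots> \<le> C' * (2 * (1 + ln R))" using C'(1) R by (intro mult_left_mono) auto
      finally show "1 + real (length w) \<le> (2 * C' + 1) * (1 + ln R)"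
        using ln_ge_zero[OF R] by (simp add: algebra_simps)
    qed (use R C'(1) in auto)
    also have "T powr (2 * s) = (T\<^sup>2) powr s" using T by (simp add: powr_powr flip: powr_numeral)
    also have "\<dots> = (C\<^sup>2) powr s * (R\<^sup>2 / frob_norm h) powr s" unfolding T2 by (rule powr_mult)
    also have "(C\<^sup>2) powr s = C powr (2 * s)" using C(1) by (simp add: powr_powr flip: powr_numeral)
    finally show ?thesis by (simp add: D_def mult_ac)
  qed
  have "D > 0" using C'(1) C(1) assms(2) by (simp add: D_def)
  with main that show ?thesis by blast
qed

text \<open>Put h = a'^-1 a, so that b' = h b. For fixed h, the elements a' and b^-1 are both
  counted by \<open>card_right_translates\<close>. Each count has a factor |h|^-s, and the product
  |h|^(-2 s) is summed over h by the Poincare series.\<close>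

lemma energy_bound:
  assumes Z: "\<And>F. finite F \<Longrightarrow> F \<subseteq> \<Gamma> \<Longrightarrow> (\<Sum>\<gamma>\<in>F. frob_norm \<gamma> powr (- 2 * s)) \<le> Z"
    and "Z > 0" "s > 0"
  obtains D where "D > 0" "\<And>A B R1 R2. A \<subseteq> \<Gamma> \<Longrightarrow> B \<subseteq> \<Gamma> \<Longrightarrow> R1 \<ge> 1 \<Longrightarrow> R2 \<ge> 1 \<Longrightarrow>
    (\<And>a. a \<in> A \<Longrightarrow> frob_norm a < R1) \<Longrightarrow> (\<And>b. b \<in> B \<Longrightarrow> frob_norm b < R2) \<Longrightarrow>
    real (card {(a, b, a', b') \<in> A \<times> B \<times> A \<times> B. a ** b = a' ** b'})
      \<le> D * ((1 + ln R1) * (1 + ln R2)) * (R1 * R2) powr (2 * s)"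
proof -
  obtain D where D: "D > 0" "\<And>h R. h \<in> \<Gamma> \<Longrightarrow> R \<ge> 1 \<Longrightarrow>
    real (card {\<gamma> \<in> \<Gamma>. frob_norm \<gamma> < R \<and> frob_norm (\<gamma> ** h) < R})
      \<le> D * (1 + ln R) * (R\<^sup>2 / frob_norm h) powr s"
    using card_right_translates[OF Z assms(2,3)] by blast
  have main: "real (card {(a, b, a', b') \<in> A \<times> B \<times> A \<times> B. a ** b = a' ** b'})
      \<le> (D\<^sup>2 * Z) * ((1 + ln R1) * (1 + ln R2)) * (R1 * R2) powr (2 * s)"
    if AB: "A \<subseteq> \<Gamma>" "B \<subseteq> \<Gamma>" and R: "R1 \<ge> 1" "R2 \<ge> 1"
      and nA: "\<And>a. a \<in> A \<Longrightarrow> frob_norm a < R1" and nB: "\<And>b. b \<in> B \<Longrightarrow> frob_norm b < R2"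
    for A B R1 R2
  proof -
    let ?Q = "{(a, b, a', b') \<in> A \<times> B \<times> A \<times> B. a ** b = a' ** b'}"
    define U where "U R h = {\<gamma> \<in> \<Gamma>. frob_norm \<gamma> < R \<and> frob_norm (\<gamma> ** h) < R}" for R h
    have finU: "finite (U R h)" for R h
      by (rule finite_subset[OF _ finite_frob_norm_le[of R]]) (auto simp: U_def)
    define H where "H = {h \<in> \<Gamma>. frob_norm h \<le> R1 * R1}"
    have finH: "finite H" by (rule finite_subset[OF _ finite_frob_norm_le[of "R1 * R1"]]) (auto simp: H_def)
    \<comment> \<open>Recovers (a, b, a', b') from h, a' and c = b^-1.\<close>
    define f where "f h = (\<lambda>(a' :: int^2^2, c). (a' ** h, adj2 c, a', h ** adj2 c))" for h
    have "?Q \<subseteq> (\<Union>h\<in>H. f h ` (U R1 h \<times> U R2 (adj2 h)))"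
    proof safe
      fix a b a' b' assume ab: "a \<in> A" "b \<in> B" "a' \<in> A" "b' \<in> B" "a ** b = a' ** b'"
      have g: "a \<in> \<Gamma>" "b \<in> \<Gamma>" "a' \<in> \<Gamma>" "b' \<in> \<Gamma>" using ab AB by blast+
      have d: "det a = 1" "det b = 1" "det a' = 1" "det b' = 1" using g \<Gamma>_det by blast+
      define h where "h = adj2 a' ** a"
      have a: "a = a' ** h" by (simp add: h_def adj2_cancel d)
      have "h ** b = adj2 a' ** (a ** b)" by (simp add: h_def matrix_mul_assoc)
      then have b': "b' = h ** b" using ab(5) d by (simp add: adj2_cancel)
      have h: "h \<in> \<Gamma>" unfolding h_def by (intro \<Gamma>_mult \<Gamma>_adj2 g)
      have "frob_norm h \<le> frob_norm (adj2 a') * frob_norm a" unfolding h_def by (rule frob_norm_mult)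
      also have "\<dots> \<le> R1 * R1" using nA[OF ab(1)] nA[OF ab(3)] R by (intro mult_mono) auto
      finally have hH: "h \<in> H" using h by (simp add: H_def)
      have 1: "a' \<in> U R1 h" using nA[OF ab(1)] nA[OF ab(3)] g by (simp add: U_def a[symmetric])
      have "frob_norm (adj2 b ** adj2 h) = frob_norm b'" unfolding b' adj2_mult[symmetric] by simp
      then have 2: "adj2 b \<in> U R2 (adj2 h)" using nB[OF ab(2)] nB[OF ab(4)] \<Gamma>_adj2[OF g(2)] by (simp add: U_def)
      have "(a, b, a', b') = f h (a', adj2 b)" by (simp add: f_def a[symmetric] b')
      with hH 1 2 show "(a, b, a', b') \<in> (\<Union>h\<in>H. f h ` (U R1 h \<times> U R2 (adj2 h)))"
        by (intro UN_I image_eqI) auto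
    qed
    then have "card ?Q \<le> card (\<Union>h\<in>H. f h ` (U R1 h \<times> U R2 (adj2 h)))"
      using finH finU by (intro card_mono) auto
    also have "\<dots> \<le> (\<Sum>h\<in>H. card (f h ` (U R1 h \<times> U R2 (adj2 h))))" by (rule card_UN_le[OF finH])
    also have "\<dots> \<le> (\<Sum>h\<in>H. card (U R1 h \<times> U R2 (adj2 h)))"
      using finU by (intro sum_mono card_image_le) auto
    also have "\<dots> = (\<Sum>h\<in>H. card (U R1 h) * card (U R2 (adj2 h)))" by (simp add: card_cartesian_product)
    finally have "real (card ?Q) \<le> real (\<Sum>h\<in>H. card (U R1 h) * card (U R2 (adj2 h)))" by (rule of_nat_mono)
    also have "\<dots> = (\<Sum>h\<in>H. real (card (U R1 h)) * real (card (U R2 (adj2 h))))" by simp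
    also have "\<dots> \<le> (\<Sum>h\<in>H. (D\<^sup>2 * ((1 + ln R1) * (1 + ln R2)) * (R1 * R2) powr (2 * s)) * frob_norm h powr (- 2 * s))"
    proof (intro sum_mono)
      fix h assume "h \<in> H"
      then have h: "h \<in> \<Gamma>" by (simp add: H_def)
      have n: "frob_norm h > 0" by (rule frob_norm_pos[OF \<Gamma>_det[OF h]])
      have "real (card (U R1 h)) * real (card (U R2 (adj2 h)))
          \<le> (D * (1 + ln R1) * (R1\<^sup>2 / frob_norm h) powr s) * (D * (1 + ln R2) * (R2\<^sup>2 / frob_norm h) powr s)"
        using D(2)[OF h R(1)] D(2)[OF \<Gamma>_adj2[OF h] R(2)] D(1) R
        by (intro mult_mono) (auto simp: U_def)
      also have "\<dots> = D\<^sup>2 * ((1 + ln R1) * (1 + ln R2)) * ((R1\<^sup>2 / frob_norm h) * (R2\<^sup>2 / frob_norm h)) powr s"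
        unfolding powr_mult by (simp add: power2_eq_square mult_ac)
      also have "(R1\<^sup>2 / frob_norm h) * (R2\<^sup>2 / frob_norm h) = (R1 * R2) powr 2 * frob_norm h powr (- 2)"
        using n R by (simp add: powr_minus_divide power_mult_distrib) (simp add: power2_eq_square)
      also have "\<dots> powr s = (R1 * R2) powr (2 * s) * frob_norm h powr (- 2 * s)"
        unfolding powr_mult powr_powr by simp
      finally show "real (card (U R1 h)) * real (card (U R2 (adj2 h)))
          \<le> (D\<^sup>2 * ((1 + ln R1) * (1 + ln R2)) * (R1 * R2) powr (2 * s)) * frob_norm h powr (- 2 * s)"
        by (simp only: mult.assoc)
    qed
    also have "\<dots> = (D\<^sup>2 * ((1 + ln R1) * (1 + ln R2)) * (R1 * R2) powr (2 * s)) * (\<Sum>h\<in>H. frob_norm h powr (- 2 * s))"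
      by (rule sum_distrib_left[symmetric])
    also have "\<dots> \<le> (D\<^sup>2 * ((1 + ln R1) * (1 + ln R2)) * (R1 * R2) powr (2 * s)) * Z"
      using R by (intro mult_left_mono Z finH) (auto simp: H_def)
    finally show ?thesis by (simp only: mult_ac)
  qed
  have "D\<^sup>2 * Z > 0" using D(1) assms(2) by simp
  with main show ?thesis by (rule that[rotated])
qed

end

section \<open>A large sieve inequality on the circle\<close>

definition nint_dist :: "real \<Rightarrow> real" where
  "nint_dist z = \<bar>z - of_int (round z)\<bar>"

lemma nint_dist_le_iff: "nint_dist z \<le> r \<longleftrightarrow> (\<exists>m::int. \<bar>z - of_int m\<bar> \<le> r)"
  using round_diff_minimal[of z] unfolding nint_dist_def by (meson order_trans)

lemma nint_dist_add: "nint_dist (a + b) \<le> nint_dist a + nint_dist b"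
  unfolding nint_dist_le_iff
  by (rule exI[of _ "round a + round b"]) (simp add: nint_dist_def)

lemma nint_dist_minus: "nint_dist (- a) = nint_dist a"
proof -
  have "nint_dist (- b) \<le> nint_dist b" for b
    unfolding nint_dist_le_iff
    by (rule exI[of _ "- round b"]) (simp add: nint_dist_def)
  from this[of a] this[of "- a"] show ?thesis by simp
qed

lemma nint_dist_diff: "nint_dist (a - b) \<le> nint_dist a + nint_dist b"
  using nint_dist_add[of a "- b"] by (simp add: nint_dist_minus)

lemma nint_dist_mult: "nint_dist (of_int n * a) \<le> \<bar>of_int n\<bar> * nint_dist a"
  unfolding nint_dist_le_iff
proof (rule exI[of _ "n * round a"])
  have "of_int n * a - of_int (n * round a) = of_int n * (a - of_int (round a))"
    by (simp add: algebra_simps)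
  then show "\<bar>of_int n * a - of_int (n * round a)\<bar> \<le> \<bar>of_int n\<bar> * nint_dist a"
    by (simp only: nint_dist_def abs_mult)
qed

lemma nint_dist_add_int: "nint_dist (a + of_int n) = nint_dist a"
proof -
  have le: "nint_dist (b + of_int m) \<le> nint_dist b" for b and m :: int
    unfolding nint_dist_le_iff
    by (rule exI[of _ "round b + m"]) (simp add: nint_dist_def)
  from le[of a n] le[of "a + of_int n" "- n"] show ?thesis by simp
qed

lemma unit_exp_add: "unit_exp (x + y) = unit_exp x * unit_exp y"
  by (simp add: unit_exp_def exp_add distrib_left)

lemma unit_exp_eq_cis: "unit_exp x = cis (2 * pi * x)"
  by (simp add: unit_exp_def cis_conv_exp mult_ac)

lemma norm_unit_exp [simp]: "cmod (unit_exp x) = 1"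
  by (simp add: unit_exp_eq_cis)

lemma unit_exp_int [simp]: "unit_exp (of_int n) = 1"
  by (simp add: unit_exp_eq_cis cis_multiple_2pi)

lemma unit_exp_0 [simp]: "unit_exp 0 = 1"
  by (simp add: unit_exp_def)

lemma cnj_unit_exp: "cnj (unit_exp x) = unit_exp (- x)"
  by (simp add: unit_exp_eq_cis cis_cnj)

lemma Re_unit_exp: "Re (unit_exp x) = cos (2 * pi * x)"
  by (simp add: unit_exp_eq_cis)

lemma unit_exp_measurable [measurable]: "unit_exp \<in> borel_measurable borel"
  unfolding unit_exp_def by (intro borel_measurable_continuous_onI continuous_intros)

lemma nint_dist_measurable [measurable]: "nint_dist \<in> borel_measurable borel"
  unfolding nint_dist_def round_def by measurable

lemma cnj_measurable [measurable]: "cnj \<in> borel_measurable borel"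
  by (intro borel_measurable_continuous_onI continuous_intros)

section \<open>Fourier analysis on the circle\<close>

definition circle :: "real measure" where
  "circle = restrict_space lborel {0..<1}"

lemma circle_finite: "finite_measure circle"
proof
  show "emeasure circle (space circle) \<noteq> \<infinity>"
    by (simp add: circle_def space_restrict_space emeasure_restrict_space)
qed

lemma circle_measurable: "f \<in> borel_measurable borel \<Longrightarrow> f \<in> borel_measurable circle"
  unfolding circle_def by (rule measurable_restrict_space1) simp

lemma circle_integrable:
  fixes f :: "real \<Rightarrow> 'b::{banach, second_countable_topology}"
  assumes "f \<in> borel_measurable borel" "\<And>u. norm (f u) \<le> B"
  shows "integrable circle f"
  using assms circle_measurable
  by (intro finite_measure.integrable_const_bound[OF circle_finite, of _ B]) auto

lemma circle_integral:
  fixes f :: "real \<Rightarrow> 'b::{banach, second_countable_topology}"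
  shows "integral\<^sup>L circle f = (\<integral>u. indicator {0..<1} u *\<^sub>R f u \<partial>lborel)"
  unfolding circle_def by (rule integral_restrict_space) simp

lemma integrable_indicator_bounded:
  fixes f :: "real \<Rightarrow> 'b::{banach, second_countable_topology}"
  assumes f: "f \<in> borel_measurable borel" "\<And>u. norm (f u) \<le> B"
  shows "integrable lborel (\<lambda>u. indicator {a..<b} u *\<^sub>R f u)"
proof (rule Bochner_Integration.integrable_bound)
  show "integrable lborel (\<lambda>u. B * indicator {a..<b} u :: real)"
  proof (intro integrable_mult_right integrable_real_indicator)
    show "emeasure lborel {a..<b} < \<infinity>" by (cases "a \<le> b") auto
  qed simp
  show "AE u in lborel. norm (indicator {a..<b} u *\<^sub>R f u) \<le> norm (B * indicator {a..<b} u :: real)"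
    using f(2) by (auto simp: indicator_def intro: order_trans[OF _ abs_ge_self])
qed (use f(1) in measurable)

lemma circle_shift:
  fixes f :: "real \<Rightarrow> 'b::{banach, second_countable_topology}"
  assumes f: "f \<in> borel_measurable borel" "\<And>u. norm (f u) \<le> B"
    and per: "\<And>u (n::int). f (u + of_int n) = f u"
  shows "integral\<^sup>L circle (\<lambda>u. f (u + t)) = integral\<^sup>L circle f"
proof -
  define a where "a = frac t"
  have a: "0 \<le> a" "a < 1" by (simp_all add: a_def frac_lt_1)
  have t: "f (u + t) = f (u + a)" for u
    using per[of "u + a" "\<lfloor>t\<rfloor>"] by (simp add: a_def frac_def)
  have "integral\<^sup>L circle (\<lambda>u. f (u + t)) = (\<integral>u. indicator {0..<1} u *\<^sub>R f (u + a) \<partial>lborel)"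
    by (simp add: circle_integral t)
  also have "\<dots> = (\<integral>u. indicator {a..<1 + a} (a + 1 * u) *\<^sub>R f (a + 1 * u) \<partial>lborel)"
    by (intro Bochner_Integration.integral_cong) (auto simp: indicator_def add.commute)
  also have "\<dots> = (\<integral>u. indicator {a..<1 + a} u *\<^sub>R f u \<partial>lborel)"
    using lborel_integral_real_affine[of 1 "\<lambda>u. indicator {a..<1 + a} u *\<^sub>R f u" a] by simp
  also have "\<dots> = (\<integral>u. indicator {a..<1} u *\<^sub>R f u + indicator {1..<1 + a} u *\<^sub>R f u \<partial>lborel)"
    using a by (intro Bochner_Integration.integral_cong) (auto simp: indicator_def)
  also have "\<dots> = (\<integral>u. indicator {a..<1} u *\<^sub>R f u \<partial>lborel) + (\<integral>u. indicator {1..<1 + a} u *\<^sub>R f u \<partial>lborel)"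
    by (intro Bochner_Integration.integral_add integrable_indicator_bounded[OF f])
  also have "(\<integral>u. indicator {1..<1 + a} u *\<^sub>R f u \<partial>lborel)
      = (\<integral>u. indicator {1..<1 + a} (1 + 1 * u) *\<^sub>R f (1 + 1 * u) \<partial>lborel)"
    using lborel_integral_real_affine[of 1 "\<lambda>u. indicator {1..<1 + a} u *\<^sub>R f u" 1] by simp
  also have "\<dots> = (\<integral>u. indicator {0..<a} u *\<^sub>R f u \<partial>lborel)"
    using per[of _ 1] by (intro Bochner_Integration.integral_cong) (auto simp: indicator_def add.commute)
  also have "(\<integral>u. indicator {a..<1} u *\<^sub>R f u \<partial>lborel) + (\<integral>u. indicator {0..<a} u *\<^sub>R f u \<partial>lborel)
      = (\<integral>u. indicator {a..<1} u *\<^sub>R f u + indicator {0..<a} u *\<^sub>R f u \<partial>lborel)"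
    by (intro Bochner_Integration.integral_add[symmetric] integrable_indicator_bounded[OF f])
  also have "\<dots> = integral\<^sup>L circle f"
    unfolding circle_integral using a
    by (intro Bochner_Integration.integral_cong) (auto simp: indicator_def)
  finally show ?thesis .
qed

lemma circle_integral_const: "integral\<^sup>L circle (\<lambda>u. c :: complex) = c"
  by (simp add: circle_def measure_restrict_space space_restrict_space)

text \<open>For nonzero n, a shift by 1 / (2 n) changes the sign of the integrand.\<close>

lemma circle_integral_unit_exp:
  "integral\<^sup>L circle (\<lambda>u. unit_exp (of_int n * u)) = (if n = 0 then 1 else 0)"
proof (cases "n = 0")
  case True
  then show ?thesis using circle_integral_const[of 1] by simp
next
  case False
  let ?I = "integral\<^sup>L circle (\<lambda>u. unit_exp (of_int n * u))"
  have m: "(\<lambda>u. unit_exp (of_int n * u)) \<in> borel_measurable borel" by measurable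
  have p: "unit_exp (of_int n * (u + of_int m)) = unit_exp (of_int n * u)" for u m
  proof -
    have "unit_exp (of_int n * (u + of_int m)) = unit_exp (of_int n * u) * unit_exp (of_int (n * m))"
      by (simp add: unit_exp_add distrib_left)
    then show ?thesis by (simp only: unit_exp_int mult_1_right)
  qed
  have half: "unit_exp (1 / 2) = - 1" by (simp add: unit_exp_eq_cis cis_pi)
  have "?I = integral\<^sup>L circle (\<lambda>u. unit_exp (of_int n * (u + 1 / (2 * of_int n))))"
    by (rule circle_shift[OF m, where B = 1, symmetric]) (simp_all add: p)
  also have "\<dots> = integral\<^sup>L circle (\<lambda>u. - unit_exp (of_int n * u))"
    using False by (intro Bochner_Integration.integral_cong) (simp_all add: distrib_left unit_exp_add half)
  finally have "?I = - ?I" by simp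
  then show ?thesis using False by (simp add: equal_neg_zero)
qed

text \<open>Bessel's inequality, from the nonnegative integral of |g - p|^2, where \<open>p\<close>
  is the projection of \<open>g\<close> to the frequencies -x with x in J.\<close>

lemma circle_bessel:
  fixes g :: "real \<Rightarrow> complex"
  assumes "finite J" and g: "g \<in> borel_measurable borel" "\<And>u. cmod (g u) \<le> B"
  shows "(\<Sum>x\<in>J. (cmod (integral\<^sup>L circle (\<lambda>u. g u * unit_exp (of_int x * u))))\<^sup>2)
    \<le> integral\<^sup>L circle (\<lambda>u. (cmod (g u))\<^sup>2)"
proof -
  define a where "a x = integral\<^sup>L circle (\<lambda>u. g u * unit_exp (of_int x * u))" for x :: int
  define p where "p u = (\<Sum>x\<in>J. a x * unit_exp (- (of_int x * u)))" for u
  define A where "A = (\<Sum>x\<in>J. (cmod (a x))\<^sup>2)"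
  have p_meas [measurable]: "p \<in> borel_measurable borel" unfolding p_def by measurable
  note g(1) [measurable]
  have B: "B \<ge> 0" using g(2)[of 0] norm_ge_zero order_trans by blast
  define B' where "B' = (\<Sum>x\<in>J. cmod (a x))"
  have pB: "cmod (p u) \<le> B'" for u
    unfolding p_def B'_def by (rule order_trans[OF norm_sum]) (simp add: norm_mult)
  have B': "B' \<ge> 0" unfolding B'_def by (rule sum_nonneg) simp
  have int1: "integrable circle (\<lambda>u. g u * unit_exp (of_int x * u))" for x :: int
    by (rule circle_integrable[where B = B]) (use g(2) in \<open>auto simp: norm_mult\<close>)
  have int_gg: "integrable circle (\<lambda>u. g u * cnj (g u))"
    by (rule circle_integrable[where B = "B * B"]) (use g(2) B in \<open>auto simp: norm_mult intro!: mult_mono\<close>)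
  have int_gp: "integrable circle (\<lambda>u. g u * cnj (p u))"
    by (rule circle_integrable[where B = "B * B'"]) (use g(2) pB B in \<open>auto simp: norm_mult intro!: mult_mono\<close>)
  have int_pg: "integrable circle (\<lambda>u. p u * cnj (g u))"
    by (rule circle_integrable[where B = "B' * B"]) (use g(2) pB B' in \<open>auto simp: norm_mult intro!: mult_mono\<close>)
  have int_pp: "integrable circle (\<lambda>u. p u * cnj (p u))"
    by (rule circle_integrable[where B = "B' * B'"]) (use pB B' in \<open>auto simp: norm_mult intro!: mult_mono\<close>)
  have gp_eq: "g u * cnj (p u) = (\<Sum>x\<in>J. cnj (a x) * (g u * unit_exp (of_int x * u)))" for u
    by (simp add: p_def cnj_unit_exp sum_distrib_left mult_ac)
  have gp: "integral\<^sup>L circle (\<lambda>u. g u * cnj (p u)) = of_real A"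
  proof -
    have "integral\<^sup>L circle (\<lambda>u. g u * cnj (p u))
        = (\<Sum>x\<in>J. integral\<^sup>L circle (\<lambda>u. cnj (a x) * (g u * unit_exp (of_int x * u))))"
      unfolding gp_eq by (intro Bochner_Integration.integral_sum integrable_mult_right int1)
    also have "\<dots> = (\<Sum>x\<in>J. a x * cnj (a x))"
      by (simp only: integral_mult_right_zero a_def[symmetric]) (simp only: mult.commute)
    also have "\<dots> = of_real A" unfolding A_def of_real_sum complex_norm_square ..
    finally show ?thesis .
  qed
  have "(\<lambda>u. p u * cnj (g u)) = (\<lambda>u. cnj (g u * cnj (p u)))"
    by (simp add: fun_eq_iff mult.commute)
  then have pg: "integral\<^sup>L circle (\<lambda>u. p u * cnj (g u)) = of_real A"
    by (simp only: Bochner_Integration.integral_cnj gp complex_cnj_complex_of_real)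
  have pp_eq: "p u * cnj (p u) = (\<Sum>x\<in>J. \<Sum>y\<in>J. (a x * cnj (a y)) * unit_exp (of_int (y - x) * u))" for u
  proof -
    have trm: "(a x * unit_exp (- (of_int x * u))) * (cnj (a y) * unit_exp (of_int y * u))
        = (a x * cnj (a y)) * unit_exp (of_int (y - x) * u)" for x y
      using unit_exp_add[of "- (of_int x * u)" "of_int y * u"] by (simp add: algebra_simps)
    have "p u * cnj (p u) = (\<Sum>x\<in>J. \<Sum>y\<in>J. (a x * unit_exp (- (of_int x * u))) * (cnj (a y) * unit_exp (of_int y * u)))"
      by (simp add: p_def cnj_unit_exp sum_product)
    then show ?thesis by (simp only: trm)
  qed
  have inte: "integrable circle (\<lambda>u. c * unit_exp (of_int n * u))" for c and n :: int
    by (rule circle_integrable[where B = "cmod c"]) (auto simp: norm_mult)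
  have "integral\<^sup>L circle (\<lambda>u. p u * cnj (p u)) = (\<Sum>x\<in>J. \<Sum>y\<in>J. (a x * cnj (a y)) * (if y - x = 0 then 1 else 0))"
  proof -
    have "integral\<^sup>L circle (\<lambda>u. p u * cnj (p u))
        = (\<Sum>x\<in>J. integral\<^sup>L circle (\<lambda>u. \<Sum>y\<in>J. (a x * cnj (a y)) * unit_exp (of_int (y - x) * u)))"
      unfolding pp_eq by (intro Bochner_Integration.integral_sum Bochner_Integration.integrable_sum inte)
    also have "\<dots> = (\<Sum>x\<in>J. \<Sum>y\<in>J. integral\<^sup>L circle (\<lambda>u. (a x * cnj (a y)) * unit_exp (of_int (y - x) * u)))"
      by (intro sum.cong refl Bochner_Integration.integral_sum inte)
    finally show ?thesis by (simp only: integral_mult_right_zero circle_integral_unit_exp)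
  qed
  also have "\<dots> = (\<Sum>x\<in>J. a x * cnj (a x))"
  proof (intro sum.cong refl)
    fix x assume "x \<in> J"
    have "(\<Sum>y\<in>J. (a x * cnj (a y)) * (if y - x = 0 then 1 else 0)) = (\<Sum>y\<in>J. if y = x then a x * cnj (a y) else 0)"
      by (intro sum.cong refl) simp
    with \<open>x \<in> J\<close> assms(1) show "(\<Sum>y\<in>J. (a x * cnj (a y)) * (if y - x = 0 then 1 else 0)) = a x * cnj (a x)"
      by (simp add: sum.delta)
  qed
  also have "\<dots> = of_real A" unfolding A_def of_real_sum complex_norm_square ..
  finally have pp: "integral\<^sup>L circle (\<lambda>u. p u * cnj (p u)) = of_real A" .
  have nonneg: "0 \<le> integral\<^sup>L circle (\<lambda>u. (cmod (g u - p u))\<^sup>2)" by simp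
  have "complex_of_real (integral\<^sup>L circle (\<lambda>u. (cmod (g u - p u))\<^sup>2))
      = integral\<^sup>L circle (\<lambda>u. g u * cnj (g u) - g u * cnj (p u) - (p u * cnj (g u) - p u * cnj (p u)))"
    by (simp only: integral_complex_of_real[symmetric] complex_norm_square) (simp add: algebra_simps)
  also have "\<dots> = integral\<^sup>L circle (\<lambda>u. g u * cnj (g u)) - of_real A"
    using int_gg int_gp int_pg int_pp by (simp add: gp pg pp)
  also have "integral\<^sup>L circle (\<lambda>u. g u * cnj (g u)) = of_real (integral\<^sup>L circle (\<lambda>u. (cmod (g u))\<^sup>2))"
    by (simp only: integral_complex_of_real[symmetric] complex_norm_square)
  finally have "integral\<^sup>L circle (\<lambda>u. (cmod (g u - p u))\<^sup>2) = integral\<^sup>L circle (\<lambda>u. (cmod (g u))\<^sup>2) - A"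
    by (simp only: of_real_diff[symmetric] of_real_eq_iff)
  with nonneg show ?thesis by (simp add: A_def a_def)
qed

text \<open>The kernel of the large sieve: the indicator of an arc of half-width h about 0.\<close>

definition nbox :: "real \<Rightarrow> real \<Rightarrow> real" where
  "nbox h u = (if nint_dist u \<le> h then 1 else 0)"

lemma nbox_measurable [measurable]: "nbox h \<in> borel_measurable borel"
  unfolding nbox_def by measurable

lemma nbox_bounds: "0 \<le> nbox h u" "nbox h u \<le> 1"
  by (simp_all add: nbox_def)

lemma nbox_periodic: "nbox h (u + of_int n) = nbox h u"
  by (simp add: nbox_def nint_dist_add_int)

lemma circle_integral_nbox:
  assumes "0 < h" "h < 1 / 2"
  shows "integral\<^sup>L circle (nbox h) = 2 * h"
proof -
  have "nbox h u = indicator {0..h} u + indicator {1 - h..<1} u" if "0 \<le> u" "u < 1" for u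
  proof -
    have "nint_dist u \<le> h \<longleftrightarrow> u \<le> h \<or> 1 - h \<le> u"
    proof
      assume "nint_dist u \<le> h"
      then obtain m :: int where m: "\<bar>u - of_int m\<bar> \<le> h" unfolding nint_dist_le_iff by blast
      then have "real_of_int m > -1" "real_of_int m < 2" using that assms by linarith+
      then have "m = 0 \<or> m = 1" by linarith
      with m show "u \<le> h \<or> 1 - h \<le> u" by auto
    next
      assume "u \<le> h \<or> 1 - h \<le> u"
      then have "\<bar>u - of_int 0\<bar> \<le> h \<or> \<bar>u - of_int 1\<bar> \<le> h" using that by auto
      then show "nint_dist u \<le> h" unfolding nint_dist_le_iff by blast
    qed
    then show ?thesis using that assms by (auto simp: nbox_def indicator_def)
  qed
  then have "integral\<^sup>L circle (nbox h) = (\<integral>u. indicator {0..h} u + indicator {1 - h..<1} u \<partial>lborel)"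
    unfolding circle_integral using assms
    by (intro Bochner_Integration.integral_cong) (auto simp: indicator_def)
  also have "\<dots> = 2 * h"
    using assms by (subst Bochner_Integration.integral_add)
      auto
  finally show ?thesis .
qed

text \<open>On the arc the phase 2 \<pi> x u stays within \<pi> / 3 of a multiple of 2 \<pi>, where
  the cosine is at least 1/2. This is the origin of the bound 1/6.\<close>

lemma circle_integral_nbox_exp_ge:
  assumes "0 < h" "h < 1 / 2" "\<bar>real_of_int x\<bar> * h \<le> 1 / 6"
  shows "h \<le> cmod (integral\<^sup>L circle (\<lambda>u. of_real (nbox h u) * unit_exp (of_int x * u)))"
proof -
  have int: "integrable circle (\<lambda>u. of_real (nbox h u) * unit_exp (of_int x * u))"
    by (rule circle_integrable[where B = 1]) (auto simp: norm_mult nbox_def)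
  have le: "1 / 2 * nbox h u \<le> Re (of_real (nbox h u) * unit_exp (of_int x * u))" for u
  proof (cases "nint_dist u \<le> h")
    case True
    then obtain m :: int where m: "\<bar>u - of_int m\<bar> \<le> h" unfolding nint_dist_le_iff by blast
    define d where "d = u - of_int m"
    have "unit_exp (of_int x * u) = unit_exp (of_int x * d) * unit_exp (of_int (x * m))"
      unfolding unit_exp_add[symmetric] by (simp add: d_def algebra_simps)
    then have e: "Re (unit_exp (of_int x * u)) = cos (2 * pi * (of_int x * d))"
      by (simp only: unit_exp_int mult_1_right Re_unit_exp)
    have "\<bar>of_int x * d\<bar> \<le> \<bar>real_of_int x\<bar> * h"
      unfolding abs_mult using m by (intro mult_left_mono) (auto simp: d_def)
    then have "\<bar>of_int x * d\<bar> \<le> 1 / 6" using assms(3) by linarith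
    then have "\<bar>2 * pi * (of_int x * d)\<bar> \<le> pi / 3" using pi_gt_zero by (simp add: abs_mult field_simps)
    then have "cos (pi / 3) \<le> cos \<bar>2 * pi * (of_int x * d)\<bar>" using pi_gt_zero
      by (intro cos_monotone_0_pi_le) linarith+
    then have "1 / 2 \<le> cos (2 * pi * (of_int x * d))" by (simp add: cos_60)
    with True e show ?thesis by (simp add: nbox_def)
  qed (simp add: nbox_def)
  have "h = integral\<^sup>L circle (\<lambda>u. 1 / 2 * nbox h u)"
    using circle_integral_nbox[OF assms(1,2)] by simp
  also have "\<dots> \<le> integral\<^sup>L circle (\<lambda>u. Re (of_real (nbox h u) * unit_exp (of_int x * u)))"
  proof (rule integral_mono)
    show "integrable circle (\<lambda>u. 1 / 2 * nbox h u)"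
      by (rule circle_integrable[where B = 1]) (auto simp: nbox_def)
    show "integrable circle (\<lambda>u. Re (of_real (nbox h u) * unit_exp (of_int x * u)))"
      by (rule integrable_Re[OF int])
  qed (rule le)
  also have "\<dots> = Re (integral\<^sup>L circle (\<lambda>u. of_real (nbox h u) * unit_exp (of_int x * u)))"
    by (rule integral_Re[OF int])
  also have "\<dots> \<le> cmod (integral\<^sup>L circle (\<lambda>u. of_real (nbox h u) * unit_exp (of_int x * u)))"
    by (rule complex_Re_le_cmod)
  finally show ?thesis .
qed

text \<open>Point masses c i at t i are smoothed by the box. This multiplies the Fourier
  coefficients by \<open>\<kappa> x\<close>, which has modulus at least h for x in J, and Bessel's
  inequality applies to the smoothed function.\<close>

lemma exp_sum_le_box_integral:
  fixes c :: "'i \<Rightarrow> complex" and t :: "'i \<Rightarrow> real"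
  assumes "finite I" "finite J" "0 < h" "h < 1 / 2" "\<And>x. x \<in> J \<Longrightarrow> \<bar>real_of_int x\<bar> * h \<le> 1 / 6"
  shows "(\<Sum>x\<in>J. (cmod (\<Sum>i\<in>I. c i * unit_exp (of_int x * t i)))\<^sup>2)
    \<le> 1 / h\<^sup>2 * integral\<^sup>L circle (\<lambda>u. (cmod (\<Sum>i\<in>I. c i * of_real (nbox h (u - t i))))\<^sup>2)"
proof -
  define g where "g u = (\<Sum>i\<in>I. c i * of_real (nbox h (u - t i)))" for u
  define \<kappa> where "\<kappa> x = integral\<^sup>L circle (\<lambda>u. of_real (nbox h u) * unit_exp (of_int x * u))" for x :: int
  have g_meas: "g \<in> borel_measurable borel" unfolding g_def by measurable
  have g_le: "cmod (g u) \<le> (\<Sum>i\<in>I. cmod (c i))" for u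
    unfolding g_def by (rule order_trans[OF norm_sum]) (auto intro!: sum_mono simp: norm_mult nbox_def)
  have coeff: "integral\<^sup>L circle (\<lambda>u. g u * unit_exp (of_int x * u))
      = (\<Sum>i\<in>I. c i * unit_exp (of_int x * t i)) * \<kappa> x" for x :: int
  proof -
    define f where "f u = of_real (nbox h u) * unit_exp (of_int x * u)" for u
    have f_meas [measurable]: "f \<in> borel_measurable borel" unfolding f_def by measurable
    have f_le: "cmod (f u) \<le> 1" for u by (simp add: f_def norm_mult nbox_def)
    have f_per: "f (u + of_int n) = f u" for u and n :: int
    proof -
      have "unit_exp (of_int x * (u + of_int n)) = unit_exp (of_int x * u) * unit_exp (of_int (x * n))"
        unfolding unit_exp_add[symmetric] by (simp add: algebra_simps)
      then show ?thesis unfolding f_def nbox_periodic by (simp only: unit_exp_int mult_1_right)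
    qed
    have "g u * unit_exp (of_int x * u) = (\<Sum>i\<in>I. (c i * unit_exp (of_int x * t i)) * f (u + - t i))" for u
    proof -
      have "unit_exp (of_int x * u) = unit_exp (of_int x * t i) * unit_exp (of_int x * (u + - t i))" for i
        unfolding unit_exp_add[symmetric] by (simp add: algebra_simps)
      then show ?thesis unfolding g_def f_def sum_distrib_right
        by (intro sum.cong refl) (simp add: mult_ac)
    qed
    then have "integral\<^sup>L circle (\<lambda>u. g u * unit_exp (of_int x * u))
        = integral\<^sup>L circle (\<lambda>u. \<Sum>i\<in>I. (c i * unit_exp (of_int x * t i)) * f (u + - t i))" by simp
    also have "\<dots> = (\<Sum>i\<in>I. integral\<^sup>L circle (\<lambda>u. (c i * unit_exp (of_int x * t i)) * f (u + - t i)))"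
    proof (rule Bochner_Integration.integral_sum)
      fix i show "integrable circle (\<lambda>u. (c i * unit_exp (of_int x * t i)) * f (u + - t i))"
        by (rule circle_integrable[where B = "cmod (c i)"])
          (auto simp: norm_mult intro!: mult_left_le f_le)
    qed
    also have "\<dots> = (\<Sum>i\<in>I. (c i * unit_exp (of_int x * t i)) * integral\<^sup>L circle (\<lambda>u. f (u + - t i)))"
      by (simp only: integral_mult_right_zero)
    also have "\<dots> = (\<Sum>i\<in>I. (c i * unit_exp (of_int x * t i)) * integral\<^sup>L circle f)"
      by (simp only: circle_shift[OF f_meas f_le f_per])
    also have "integral\<^sup>L circle f = \<kappa> x" unfolding \<kappa>_def f_def ..
    finally show ?thesis by (simp only: sum_distrib_right)
  qed
  have "(\<Sum>x\<in>J. (cmod (\<Sum>i\<in>I. c i * unit_exp (of_int x * t i)))\<^sup>2)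
      \<le> (\<Sum>x\<in>J. 1 / h\<^sup>2 * (cmod (integral\<^sup>L circle (\<lambda>u. g u * unit_exp (of_int x * u))))\<^sup>2)"
  proof (rule sum_mono)
    fix x assume "x \<in> J"
    then have "h \<le> cmod (\<kappa> x)" unfolding \<kappa>_def by (intro circle_integral_nbox_exp_ge assms)
    then have "h\<^sup>2 \<le> (cmod (\<kappa> x))\<^sup>2" using assms(3) by (intro power_mono) auto
    then have "h\<^sup>2 * (cmod (\<Sum>i\<in>I. c i * unit_exp (of_int x * t i)))\<^sup>2
        \<le> (cmod (\<kappa> x))\<^sup>2 * (cmod (\<Sum>i\<in>I. c i * unit_exp (of_int x * t i)))\<^sup>2"
      by (rule mult_right_mono) simp
    then show "(cmod (\<Sum>i\<in>I. c i * unit_exp (of_int x * t i)))\<^sup>2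
        \<le> 1 / h\<^sup>2 * (cmod (integral\<^sup>L circle (\<lambda>u. g u * unit_exp (of_int x * u))))\<^sup>2"
      using assms(3) unfolding coeff norm_mult power_mult_distrib by (simp add: field_simps)
  qed
  also have "\<dots> = 1 / h\<^sup>2 * (\<Sum>x\<in>J. (cmod (integral\<^sup>L circle (\<lambda>u. g u * unit_exp (of_int x * u))))\<^sup>2)"
    by (rule sum_distrib_left[symmetric])
  also have "\<dots> \<le> 1 / h\<^sup>2 * integral\<^sup>L circle (\<lambda>u. (cmod (g u))\<^sup>2)"
    by (intro mult_left_mono circle_bessel[OF assms(2) g_meas g_le]) simp
  finally show ?thesis by (simp only: g_def)
qed

lemma circle_integral_nbox_pair_le:
  assumes "0 < h" "h < 1 / 2"
  shows "integral\<^sup>L circle (\<lambda>u. nbox h (u - s) * nbox h (u - t))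
    \<le> 2 * h * (if nint_dist (s - t) \<le> 2 * h then 1 else 0)"
proof (cases "nint_dist (s - t) \<le> 2 * h")
  case True
  have "integral\<^sup>L circle (\<lambda>u. nbox h (u - s) * nbox h (u - t)) \<le> integral\<^sup>L circle (\<lambda>u. nbox h (u + - s))"
    by (intro integral_mono circle_integrable[where B = 1]) (auto simp: nbox_def)
  also have "\<dots> = integral\<^sup>L circle (nbox h)"
    by (rule circle_shift[where B = 1]) (auto simp: nbox_def nint_dist_add_int)
  finally show ?thesis using True circle_integral_nbox[OF assms] by simp
next
  case False
  have "(\<lambda>u. nbox h (u - s) * nbox h (u - t)) = (\<lambda>u. 0)"
  proof (rule ext, rule ccontr)
    fix u assume "nbox h (u - s) * nbox h (u - t) \<noteq> 0"
    then have "nint_dist (u - s) \<le> h" "nint_dist (u - t) \<le> h" by (auto simp: nbox_def split: if_splits)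
    moreover have "nint_dist (s - t) \<le> nint_dist (u - t) + nint_dist (u - s)"
      using nint_dist_diff[of "u - t" "u - s"] by simp
    ultimately show False using False by linarith
  qed
  then have "integral\<^sup>L circle (\<lambda>u. nbox h (u - s) * nbox h (u - t)) = 0" by simp
  then show ?thesis using False by simp
qed

lemma norm_sum_box_sq_le:
  fixes c :: "'i \<Rightarrow> complex" and b :: "'i \<Rightarrow> real"
  assumes "\<And>i. b i \<ge> 0"
  shows "(cmod (\<Sum>i\<in>I. c i * of_real (b i)))\<^sup>2 \<le> (\<Sum>i\<in>I. \<Sum>j\<in>I. cmod (c i) * cmod (c j) * (b i * b j))"
proof -
  have "cmod (\<Sum>i\<in>I. c i * of_real (b i)) \<le> (\<Sum>i\<in>I. cmod (c i) * b i)"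
    by (rule order_trans[OF norm_sum]) (simp add: norm_mult assms)
  then have "(cmod (\<Sum>i\<in>I. c i * of_real (b i)))\<^sup>2 \<le> (\<Sum>i\<in>I. cmod (c i) * b i)\<^sup>2" by (intro power_mono) auto
  also have "\<dots> = (\<Sum>i\<in>I. \<Sum>j\<in>I. cmod (c i) * cmod (c j) * (b i * b j))"
    by (simp add: power2_eq_square sum_product mult_ac)
  finally show ?thesis .
qed

text \<open>The weight \<open>d\<close> carries one coordinate along while the other is integrated,
  as in \<open>large_sieve_2\<close>.\<close>

lemma box_integral_le:
  fixes c :: "'i \<Rightarrow> complex" and t :: "'i \<Rightarrow> real"
  assumes "0 < h" "h < 1 / 2" and d: "\<And>i j. d i j \<ge> 0"
  shows "integral\<^sup>L circle (\<lambda>u. \<Sum>i\<in>I. \<Sum>j\<in>I. cmod (c i) * cmod (c j) * (nbox h (u - t i) * nbox h (u - t j)) * d i j)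
    \<le> 2 * h * (\<Sum>i\<in>I. \<Sum>j\<in>I. cmod (c i) * cmod (c j) * (if nint_dist (t i - t j) \<le> 2 * h then 1 else 0) * d i j)"
proof -
  have int: "integrable circle (\<lambda>u. cmod (c i) * cmod (c j) * (nbox h (u - t i) * nbox h (u - t j)) * d i j)" for i j
    by (rule circle_integrable[where B = "cmod (c i) * cmod (c j) * 1 * d i j"])
      (use d in \<open>auto simp: abs_mult nbox_def intro!: mult_mono\<close>)
  have "integral\<^sup>L circle (\<lambda>u. \<Sum>i\<in>I. \<Sum>j\<in>I. cmod (c i) * cmod (c j) * (nbox h (u - t i) * nbox h (u - t j)) * d i j)
      = (\<Sum>i\<in>I. \<Sum>j\<in>I. cmod (c i) * cmod (c j) * integral\<^sup>L circle (\<lambda>u. nbox h (u - t i) * nbox h (u - t j)) * d i j)"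
  proof -
    have "integral\<^sup>L circle (\<lambda>u. \<Sum>i\<in>I. \<Sum>j\<in>I. cmod (c i) * cmod (c j) * (nbox h (u - t i) * nbox h (u - t j)) * d i j)
        = (\<Sum>i\<in>I. integral\<^sup>L circle (\<lambda>u. \<Sum>j\<in>I. cmod (c i) * cmod (c j) * (nbox h (u - t i) * nbox h (u - t j)) * d i j))"
      by (intro Bochner_Integration.integral_sum Bochner_Integration.integrable_sum int)
    also have "\<dots> = (\<Sum>i\<in>I. \<Sum>j\<in>I. integral\<^sup>L circle (\<lambda>u. cmod (c i) * cmod (c j) *
      (nbox h (u - t i) * nbox h (u - t j)) * d i j))"
      by (intro sum.cong refl Bochner_Integration.integral_sum int)
    finally show ?thesis by (simp only: integral_mult_right_zero integral_mult_left_zero)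
  qed
  also have "\<dots> \<le> (\<Sum>i\<in>I. \<Sum>j\<in>I. cmod (c i) * cmod (c j) * (2 * h * (if nint_dist (t i - t j) \<le> 2 * h then 1 else 0)) *
    d i j)"
    by (intro sum_mono mult_right_mono mult_left_mono circle_integral_nbox_pair_le assms) auto
  also have "\<dots> = 2 * h * (\<Sum>i\<in>I. \<Sum>j\<in>I. cmod (c i) * cmod (c j) * (if nint_dist (t i - t j) \<le> 2 * h then 1 else 0) * d i j)"
    unfolding sum_distrib_left by (intro sum.cong refl) simp
  finally show ?thesis .
qed

lemma large_sieve_1:
  fixes c :: "'i \<Rightarrow> complex" and t :: "'i \<Rightarrow> real"
  assumes "finite I" "finite J" "0 < h" "h < 1 / 2" "\<And>x. x \<in> J \<Longrightarrow> \<bar>real_of_int x\<bar> * h \<le> 1 / 6"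
  shows "(\<Sum>x\<in>J. (cmod (\<Sum>i\<in>I. c i * unit_exp (of_int x * t i)))\<^sup>2)
    \<le> 2 / h * (\<Sum>i\<in>I. \<Sum>j\<in>I. cmod (c i) * cmod (c j) * (if nint_dist (t i - t j) \<le> 2 * h then 1 else 0))"
proof -
  have int1: "integrable circle (\<lambda>u. (cmod (\<Sum>i\<in>I. c i * of_real (nbox h (u - t i))))\<^sup>2)"
  proof (rule circle_integrable[where B = "(\<Sum>i\<in>I. cmod (c i))\<^sup>2"])
    fix u
    have "cmod (\<Sum>i\<in>I. c i * of_real (nbox h (u - t i))) \<le> (\<Sum>i\<in>I. cmod (c i))"
      by (rule order_trans[OF norm_sum]) (auto intro!: sum_mono simp: norm_mult nbox_def)
    then show "norm ((cmod (\<Sum>i\<in>I. c i * of_real (nbox h (u - t i))))\<^sup>2) \<le> (\<Sum>i\<in>I. cmod (c i))\<^sup>2"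
      by (simp add: power_mono)
  qed measurable
  have int2: "integrable circle (\<lambda>u. \<Sum>i\<in>I. \<Sum>j\<in>I. cmod (c i) * cmod (c j) * (nbox h (u - t i) * nbox h (u - t j)) * 1)"
    by (intro Bochner_Integration.integrable_sum circle_integrable[where B = "cmod (c _) * cmod (c _)"])
      (auto simp: abs_mult nbox_def)
  have "(\<Sum>x\<in>J. (cmod (\<Sum>i\<in>I. c i * unit_exp (of_int x * t i)))\<^sup>2)
      \<le> 1 / h\<^sup>2 * integral\<^sup>L circle (\<lambda>u. (cmod (\<Sum>i\<in>I. c i * of_real (nbox h (u - t i))))\<^sup>2)"
    by (rule exp_sum_le_box_integral[OF assms])
  also have "\<dots> \<le> 1 / h\<^sup>2 * integral\<^sup>L circle (\<lambda>u. \<Sum>i\<in>I. \<Sum>j\<in>I. cmod (c i) * cmod (c j) *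
    (nbox h (u - t i) * nbox h (u - t j)) * 1)"
    using norm_sum_box_sq_le[of "\<lambda>i. nbox h (_ - t i)" c I]
    by (intro mult_left_mono integral_mono int1 int2) (auto simp: nbox_bounds)
  also have "\<dots> \<le> 1 / h\<^sup>2 * (2 * h * (\<Sum>i\<in>I. \<Sum>j\<in>I. cmod (c i) * cmod (c j) * (if nint_dist (t i - t j)
    \<le> 2 * h then 1 else 0) * 1))"
    using assms(3,4) by (intro mult_left_mono box_integral_le) auto
  also have "\<dots> = 2 / h * (\<Sum>i\<in>I. \<Sum>j\<in>I. cmod (c i) * cmod (c j) * (if nint_dist (t i - t j) \<le> 2 * h then 1 else 0))"
    using assms(3) by (simp add: power2_eq_square)
  finally show ?thesis .
qed

text \<open>One coordinate at a time. For fixed y the phase in y is absorbed into the coefficients,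
  and the sum over x becomes a box integral; under the integral sign \<open>large_sieve_1\<close>
  treats the sum over y.\<close>

lemma large_sieve_2:
  fixes c :: "'i \<Rightarrow> complex" and s t :: "'i \<Rightarrow> real"
  assumes "finite I" "finite J" "0 < h" "h < 1 / 2" "\<And>x. x \<in> J \<Longrightarrow> \<bar>real_of_int x\<bar> * h \<le> 1 / 6"
  shows "(\<Sum>x\<in>J. \<Sum>y\<in>J. (cmod (\<Sum>i\<in>I. c i * unit_exp (of_int x * s i + of_int y * t i)))\<^sup>2)
    \<le> 4 / h\<^sup>2 * (\<Sum>i\<in>I. \<Sum>j\<in>I. cmod (c i) * cmod (c j) *
        (if nint_dist (s i - s j) \<le> 2 * h \<and> nint_dist (t i - t j) \<le> 2 * h then 1 else 0))"
proof -
  define e where "e i j = (if nint_dist (t i - t j) \<le> 2 * h then 1 else 0 :: real)" for i j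
  define F where "F y u = (cmod (\<Sum>i\<in>I. (c i * unit_exp (of_int y * t i)) * of_real (nbox h (u - s i))))\<^sup>2"
    for y :: int and u
  have int1: "integrable circle (F y)" for y
  proof (rule circle_integrable[where B = "(\<Sum>i\<in>I. cmod (c i))\<^sup>2"])
    fix u
    have "cmod (\<Sum>i\<in>I. (c i * unit_exp (of_int y * t i)) * of_real (nbox h (u - s i))) \<le> (\<Sum>i\<in>I. cmod (c i))"
      by (rule order_trans[OF norm_sum]) (auto intro!: sum_mono simp: norm_mult nbox_def)
    then show "norm (F y u) \<le> (\<Sum>i\<in>I. cmod (c i))\<^sup>2"
      by (simp add: F_def power_mono)
  next
    show "F y \<in> borel_measurable borel" unfolding F_def by measurable
  qed
  have int2: "integrable circle (\<lambda>u. \<Sum>i\<in>I. \<Sum>j\<in>I. cmod (c i) * cmod (c j) * (nbox h (u - s i) * nbox h (u - s j)) * e i j)"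
    by (intro Bochner_Integration.integrable_sum circle_integrable[where B = "cmod (c _) * cmod (c _)"])
      (auto simp: abs_mult nbox_def e_def)
  have "(\<Sum>x\<in>J. \<Sum>y\<in>J. (cmod (\<Sum>i\<in>I. c i * unit_exp (of_int x * s i + of_int y * t i)))\<^sup>2)
      = (\<Sum>y\<in>J. \<Sum>x\<in>J. (cmod (\<Sum>i\<in>I. (c i * unit_exp (of_int y * t i)) * unit_exp (of_int x * s i)))\<^sup>2)"
    by (subst sum.swap) (simp add: unit_exp_add mult_ac)
  also have "\<dots> \<le> (\<Sum>y\<in>J. 1 / h\<^sup>2 * integral\<^sup>L circle (F y))"
    unfolding F_def by (intro sum_mono exp_sum_le_box_integral assms)
  also have "\<dots> = 1 / h\<^sup>2 * integral\<^sup>L circle (\<lambda>u. \<Sum>y\<in>J. F y u)"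
    by (simp add: Bochner_Integration.integral_sum int1 sum_distrib_left)
  also have "\<dots> \<le> 1 / h\<^sup>2 * integral\<^sup>L circle (\<lambda>u. 2 / h *
      (\<Sum>i\<in>I. \<Sum>j\<in>I. cmod (c i) * cmod (c j) * (nbox h (u - s i) * nbox h (u - s j)) * e i j))"
  proof (intro mult_left_mono integral_mono)
    fix u
    have "(\<Sum>y\<in>J. F y u) = (\<Sum>y\<in>J. (cmod (\<Sum>i\<in>I. (c i * of_real (nbox h (u - s i))) * unit_exp (of_int y * t i)))\<^sup>2)"
      unfolding F_def by (simp add: mult_ac)
    also have "\<dots> \<le> 2 / h * (\<Sum>i\<in>I. \<Sum>j\<in>I. cmod (c i * of_real (nbox h (u - s i))) *
      cmod (c j * of_real (nbox h (u - s j))) * e i j)"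
      unfolding e_def by (rule large_sieve_1[OF assms])
    also have "\<dots> = 2 / h * (\<Sum>i\<in>I. \<Sum>j\<in>I. cmod (c i) * cmod (c j) * (nbox h (u - s i) * nbox h (u - s j)) * e i j)"
      by (simp add: norm_mult nbox_bounds mult_ac)
    finally show "(\<Sum>y\<in>J. F y u) \<le> 2 / h * (\<Sum>i\<in>I. \<Sum>j\<in>I. cmod (c i) * cmod (c j) *
      (nbox h (u - s i) * nbox h (u - s j)) * e i j)" .
  qed (use int1 int2 in auto)
  also have "\<dots> = 1 / h\<^sup>2 * (2 / h * integral\<^sup>L circle (\<lambda>u.
      \<Sum>i\<in>I. \<Sum>j\<in>I. cmod (c i) * cmod (c j) * (nbox h (u - s i) * nbox h (u - s j)) * e i j))"
    by (simp only: integral_mult_right_zero)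
  also have "\<dots> \<le> 1 / h\<^sup>2 * (2 / h * (2 * h * (\<Sum>i\<in>I. \<Sum>j\<in>I. cmod (c i) * cmod (c j) * (if nint_dist (s i - s j)
    \<le> 2 * h then 1 else 0) * e i j)))"
    using assms(3,4) by (intro mult_left_mono box_integral_le) (auto simp: e_def)
  also have "\<dots> = 4 / h\<^sup>2 * (\<Sum>i\<in>I. \<Sum>j\<in>I. cmod (c i) * cmod (c j) * (if nint_dist (s i - s j) \<le> 2 * h then 1 else 0) *
    e i j)"
    using assms(3) by simp
  also have "(\<Sum>i\<in>I. \<Sum>j\<in>I. cmod (c i) * cmod (c j) * (if nint_dist (s i - s j) \<le> 2 * h then 1 else 0) * e i j)
      = (\<Sum>i\<in>I. \<Sum>j\<in>I. cmod (c i) * cmod (c j) *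
        (if nint_dist (s i - s j) \<le> 2 * h \<and> nint_dist (t i - t j) \<le> 2 * h then 1 else 0))"
    unfolding e_def by (intro sum.cong refl) simp
  finally show ?thesis .
qed

section \<open>Counting near coincidences on the torus\<close>

definition wedge :: "int^2 \<Rightarrow> int^2 \<Rightarrow> int" where
  "wedge y z = y$1 * z$2 - y$2 * z$1"

definition vmax :: "int^2 \<Rightarrow> int" where
  "vmax y = max \<bar>y$1\<bar> \<bar>y$2\<bar>"

definition torus_close :: "real \<Rightarrow> int^2 \<Rightarrow> real \<Rightarrow> int^2 \<Rightarrow> real \<Rightarrow> bool" where
  "torus_close r y \<theta> y' \<theta>' \<longleftrightarrow>
    nint_dist (of_int (y$1) * \<theta> - of_int (y'$1) * \<theta>') \<le> r \<and>
    nint_dist (of_int (y$2) * \<theta> - of_int (y'$2) * \<theta>') \<le> r"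

lemma vmax_ge: "\<bar>y$1\<bar> \<le> vmax y" "\<bar>y$2\<bar> \<le> vmax y"
  by (simp_all add: vmax_def)

lemma vmax_ge_1: assumes "coprime (y$1) (y$2)" shows "vmax y \<ge> 1"
proof -
  have "y$1 \<noteq> 0 \<or> y$2 \<noteq> 0" using assms by auto
  then show ?thesis by (auto simp: vmax_def)
qed

lemma torus_close_sym: "torus_close r y \<theta> y' \<theta>' \<longleftrightarrow> torus_close r y' \<theta>' y \<theta>"
proof -
  have "nint_dist (a - b) = nint_dist (b - a)" for a b
    using nint_dist_minus[of "a - b"] by simp
  then show ?thesis unfolding torus_close_def by metis
qed

lemma real_mult_le: "\<bar>n\<bar> \<le> (m::int) \<Longrightarrow> 0 \<le> x \<Longrightarrow> x \<le> r \<Longrightarrow> \<bar>real_of_int n\<bar> * x \<le> of_int m * r"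
  by (intro mult_mono) (auto simp flip: of_int_abs)

lemma nint_dist_nonneg [simp]: "nint_dist z \<ge> 0"
  by (simp add: nint_dist_def)

text \<open>In the combination of the two coordinates of y \<theta> - y' \<theta>' with the
  coefficients y'$2 and -y'$1 the angle \<theta>' cancels.\<close>

lemma nint_dist_wedge:
  assumes "torus_close r y \<theta> y' \<theta>'"
  shows "nint_dist (of_int (wedge y y') * \<theta>) \<le> 2 * r * of_int (vmax y')"
proof -
  define A where "A = of_int (y$1) * \<theta> - of_int (y'$1) * \<theta>'"
  define B where "B = of_int (y$2) * \<theta> - of_int (y'$2) * \<theta>'"
  have AB: "nint_dist A \<le> r" "nint_dist B \<le> r" using assms by (simp_all add: torus_close_def A_def B_def)
  have "of_int (wedge y y') * \<theta> = of_int (y'$2) * A - of_int (y'$1) * B"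
    by (simp add: wedge_def A_def B_def algebra_simps)
  then have "nint_dist (of_int (wedge y y') * \<theta>) \<le> nint_dist (of_int (y'$2) * A) + nint_dist (of_int (y'$1) * B)"
    using nint_dist_diff by metis
  also have "\<dots> \<le> \<bar>of_int (y'$2)\<bar> * nint_dist A + \<bar>of_int (y'$1)\<bar> * nint_dist B"
    by (intro add_mono nint_dist_mult)
  also have "\<dots> \<le> of_int (vmax y') * r + of_int (vmax y') * r"
    using AB by (intro add_mono real_mult_le vmax_ge) auto
  finally show ?thesis by (simp add: mult_ac)
qed

lemma wedge_eq_0_imp:
  assumes "wedge y z = 0" "coprime (y$1) (y$2)"
  obtains k where "z$1 = k * y$1" "z$2 = k * y$2"
proof -
  obtain u v where "u * y$1 + v * y$2 = gcd (y$1) (y$2)" using bezout_int by blast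
  then have 1: "u * y$1 + v * y$2 = 1" using assms(2) by simp
  have w: "y$1 * z$2 = y$2 * z$1" using assms(1) by (simp add: wedge_def)
  have "(u * z$1 + v * z$2) * y$1 = (u * y$1 + v * y$2) * z$1"
    using w by (simp add: algebra_simps)
  moreover have "(u * z$1 + v * z$2) * y$2 = (u * y$1 + v * y$2) * z$2"
    using w by (simp add: algebra_simps)
  ultimately show ?thesis using that[of "u * z$1 + v * z$2"] 1 by simp
qed

text \<open>For primitive \<open>y'\<close>, the loop \<open>\<theta>' \<mapsto> y' \<theta>'\<close> on the torus is simple, and its strands are about
  \<open>1 / vmax y'\<close> apart.\<close>

lemma torus_close_same_strand:
  assumes "coprime (y'$1) (y'$2)" "4 * r * of_int (vmax y') < 1"
    "torus_close r y \<theta> y' \<theta>1" "torus_close r y \<theta> y' \<theta>2"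
  shows "nint_dist (\<theta>1 - \<theta>2) \<le> 2 * r / of_int (vmax y')"
proof -
  define d where "d = \<theta>1 - \<theta>2"
  have v1: "vmax y' \<ge> 1" by (rule vmax_ge_1[OF assms(1)])
  have close: "nint_dist (of_int (y'$1) * d) \<le> 2 * r" "nint_dist (of_int (y'$2) * d) \<le> 2 * r"
    using assms(3,4)
      nint_dist_diff[of "of_int (y$1) * \<theta> - of_int (y'$1) * \<theta>2" "of_int (y$1) * \<theta> - of_int (y'$1) * \<theta>1"]
      nint_dist_diff[of "of_int (y$2) * \<theta> - of_int (y'$2) * \<theta>2" "of_int (y$2) * \<theta> - of_int (y'$2) * \<theta>1"]
    by (simp_all add: torus_close_def d_def algebra_simps)
  \<comment> \<open>The integer vector next to y' (\<theta>1 - \<theta>2). The integer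
    \<open>wedge y' p\<close> has absolute value below 1, so \<open>p\<close> is an integer multiple
    m y', and the difference of the angles is close to m.\<close>
  define p where "p = (\<chi> i. round (real_of_int (y'$i) * d))"
  define t1 where "t1 = of_int (y'$1) * d - of_int (p$1)"
  define t2 where "t2 = of_int (y'$2) * d - of_int (p$2)"
  have t: "\<bar>t1\<bar> \<le> 2 * r" "\<bar>t2\<bar> \<le> 2 * r" using close by (simp_all add: t1_def t2_def p_def nint_dist_def)
  have "of_int (wedge y' p) = of_int (y'$2) * t1 - of_int (y'$1) * t2"
    by (simp add: wedge_def t1_def t2_def algebra_simps)
  then have "\<bar>real_of_int (wedge y' p)\<bar> \<le> \<bar>of_int (y'$2) * t1\<bar> + \<bar>of_int (y'$1) * t2\<bar>" by linarith
  also have "\<dots> \<le> of_int (vmax y') * (2 * r) + of_int (vmax y') * (2 * r)"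
    using t unfolding abs_mult by (intro add_mono real_mult_le vmax_ge) auto
  also have "\<dots> < 1" using assms(2) by (simp add: mult_ac)
  finally have "wedge y' p = 0" by linarith
  then obtain m where m: "p$1 = m * y'$1" "p$2 = m * y'$2" using assms(1) by (rule wedge_eq_0_imp)
  have t': "t1 = of_int (y'$1) * (d - of_int m)" "t2 = of_int (y'$2) * (d - of_int m)"
    by (simp_all add: t1_def t2_def m algebra_simps)
  have "of_int (vmax y') * \<bar>d - of_int m\<bar> \<le> 2 * r"
    using t unfolding t' abs_mult vmax_def by (auto simp: max_def)
  then have "\<bar>d - of_int m\<bar> \<le> 2 * r / of_int (vmax y')"
    using v1 by (simp add: pos_le_divide_eq mult.commute)
  then show ?thesis unfolding nint_dist_le_iff d_def by blast
qed

lemma card_int_interval: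
  assumes "a \<le> b + 1"
  shows "finite {k::int. a \<le> of_int k \<and> of_int k \<le> b}" "real (card {k::int. a \<le> of_int k \<and> of_int k \<le> b}) \<le> b - a + 1"
proof -
  have eq: "{k::int. a \<le> of_int k \<and> of_int k \<le> b} = {\<lceil>a\<rceil>..\<lfloor>b\<rfloor>}" by (auto simp: ceiling_le_iff le_floor_iff)
  show "finite {k::int. a \<le> of_int k \<and> of_int k \<le> b}" unfolding eq by simp
  have "real (card {\<lceil>a\<rceil>..\<lfloor>b\<rfloor>}) = real (nat (\<lfloor>b\<rfloor> - \<lceil>a\<rceil> + 1))" by (simp add: algebra_simps)
  also have "\<dots> \<le> b - a + 1" using assms by linarith
  finally show "real (card {k::int. a \<le> of_int k \<and> of_int k \<le> b}) \<le> b - a + 1" unfolding eq .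
qed

definition grid :: "real \<Rightarrow> real \<Rightarrow> real set" where
  "grid \<phi> M = range (\<lambda>k::int. \<phi> + of_int k / M)"

lemma card_grid_interval:
  assumes "M > 0" "r \<ge> 0" "A \<subseteq> grid \<phi> M" "\<And>x. x \<in> A \<Longrightarrow> \<bar>x - c\<bar> \<le> r"
  shows "finite A" "real (card A) \<le> 2 * r * M + 1"
proof -
  let ?K = "{k::int. (c - r - \<phi>) * M \<le> of_int k \<and> of_int k \<le> (c + r - \<phi>) * M}"
  have le: "(c - r - \<phi>) * M \<le> (c + r - \<phi>) * M + 1"
    using assms(1,2) mult_right_mono[of "c - r - \<phi>" "c + r - \<phi>" M] by linarith
  have sub: "A \<subseteq> (\<lambda>k. \<phi> + of_int k / M) ` ?K"
  proof
    fix x assume x: "x \<in> A"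
    then obtain k :: int where k: "x = \<phi> + of_int k / M" using assms(3) by (auto simp: grid_def)
    have "c - r - \<phi> \<le> of_int k / M" "of_int k / M \<le> c + r - \<phi>" using assms(4)[OF x] k by linarith+
    then have "k \<in> ?K" using assms(1) by (simp add: pos_le_divide_eq pos_divide_le_eq)
    with k show "x \<in> (\<lambda>k. \<phi> + of_int k / M) ` ?K" by blast
  qed
  show "finite A" by (rule finite_subset[OF sub]) (intro finite_imageI card_int_interval(1)[OF le])
  have "card A \<le> card ?K"
    by (rule surj_card_le[OF card_int_interval(1)[OF le] sub])
  then have "real (card A) \<le> real (card ?K)" by simp
  also have "\<dots> \<le> (c + r - \<phi>) * M - (c - r - \<phi>) * M + 1" by (rule card_int_interval(2)[OF le])
  also have "\<dots> = 2 * r * M + 1" by (simp add: algebra_simps)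
  finally show "real (card A) \<le> 2 * r * M + 1" .
qed

text \<open>Closeness is modulo 1: relative to one point c, all others lie near c - 1, c or c + 1,
  whence the factor 3.\<close>

lemma card_grid_close:
  assumes "M > 0" "0 \<le> r" "r < 1" "A \<subseteq> {0..<1}" "A \<subseteq> grid \<phi> M"
    "\<And>a b. a \<in> A \<Longrightarrow> b \<in> A \<Longrightarrow> nint_dist (a - b) \<le> r"
  shows "real (card A) \<le> 3 * (2 * r * M + 1)"
proof (cases "A = {}")
  case True
  then show ?thesis using assms by simp
next
  case False
  then obtain c where c: "c \<in> A" by blast
  define B where "B m = {x \<in> A. \<bar>x - (c + of_int m)\<bar> \<le> r}" for m :: int
  have B: "finite (B m)" "real (card (B m)) \<le> 2 * r * M + 1" for m
    using assms(5) by (intro card_grid_interval[OF assms(1,2), of _ \<phi> "c + of_int m"]; auto simp: B_def)+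
  have sub: "A \<subseteq> (\<Union>m\<in>{-1, 0, 1}. B m)"
  proof
    fix x assume x: "x \<in> A"
    then obtain m :: int where m: "\<bar>(x - c) - of_int m\<bar> \<le> r" using assms(6)[OF x c] unfolding nint_dist_le_iff by blast
    have "0 \<le> x" "x < 1" "0 \<le> c" "c < 1" using x c assms(4) by auto
    with m assms(3) have "real_of_int m < 2" "real_of_int m > -2" by linarith+
    then have "m \<in> {-1, 0, 1}" by auto
    moreover have "x \<in> B m" using m x by (simp add: B_def algebra_simps)
    ultimately show "x \<in> (\<Union>m\<in>{-1, 0, 1}. B m)" by blast
  qed
  have "card A \<le> card (\<Union>m\<in>{-1, 0, 1}. B m)" by (rule card_mono[OF _ sub]) (use B in auto)
  also have "\<dots> \<le> (\<Sum>m\<in>{-1, 0, 1}. card (B m))" by (rule card_UN_le) simp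
  finally have "real (card A) \<le> (\<Sum>m\<in>{-1, 0, 1}. real (card (B m)))" unfolding of_nat_sum[symmetric] by (rule of_nat_mono)
  also have "\<dots> \<le> (\<Sum>m\<in>{-1, 0, 1 :: int}. 2 * r * M + 1)" by (intro sum_mono B)
  finally show ?thesis by simp
qed

text \<open>The integers n are cut into blocks of length q. As a is prime to q, the integer
  \<open>z n\<close> determines n modulo q. It is q times the signed distance from n \<theta> to the
  nearest integer, minus n \<eta>; in block b the latter stays within 1 of b q \<eta>, so
  \<open>z n\<close> lies in an interval of length 2 (q \<epsilon> + 1).\<close>

lemma card_multiples_near_int:
  fixes q :: int
  assumes "q > 0" "coprime a q" "\<bar>of_int q * \<theta> - of_int a\<bar> \<le> 1 / of_int q" "\<epsilon> \<ge> 0" "Z \<ge> 0"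
  shows "finite {n::int. \<bar>of_int n\<bar> \<le> Z \<and> nint_dist (of_int n * \<theta>) \<le> \<epsilon>}" (is "finite ?A")
    and "real (card {n::int. \<bar>of_int n\<bar> \<le> Z \<and> nint_dist (of_int n * \<theta>) \<le> \<epsilon>})
      \<le> (2 * Z / of_int q + 2) * (2 * of_int q * \<epsilon> + 3)"
proof -
  have "{n::int. \<bar>of_int n\<bar> \<le> Z} \<subseteq> {n. - Z \<le> of_int n \<and> of_int n \<le> Z}" by auto
  then have "finite {n::int. \<bar>of_int n\<bar> \<le> Z}"
    using card_int_interval(1)[of "- Z" Z] assms(5) finite_subset by fastforce
  then show finA: "finite ?A" by (rule finite_subset[rotated]) auto
  define \<eta> where "\<eta> = of_int q * \<theta> - of_int a"
  have \<eta>: "\<bar>\<eta>\<bar> \<le> 1 / of_int q" using assms(3) by (simp add: \<eta>_def)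
  let ?q = "real_of_int q"
  have q: "?q > 0" using assms(1) by simp
  define B where "B b = {n \<in> ?A. n div q = b}" for b
  have cardB: "real (card (B b)) \<le> 2 * ?q * \<epsilon> + 3" for b
  proof -
    define z where "z n = n * a - round (of_int n * \<theta>) * q" for n :: int
    let ?l = "- (of_int b * ?q * \<eta>) - (?q * \<epsilon> + 1)" and ?u = "- (of_int b * ?q * \<eta>) + (?q * \<epsilon> + 1)"
    have "?q * \<epsilon> \<ge> 0" using q assms(4) by simp
    then have lu: "?l \<le> ?u + 1" by linarith
    have "z ` B b \<subseteq> {k. ?l \<le> of_int k \<and> of_int k \<le> ?u}"
    proof
      fix k assume "k \<in> z ` B b"
      then obtain n where n: "n \<in> B b" "k = z n" by blast
      have nd: "\<bar>of_int n * \<theta> - of_int (round (of_int n * \<theta>))\<bar> \<le> \<epsilon>" using n(1) by (simp add: B_def nint_dist_def)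
      define j where "j = n mod q"
      have j: "0 \<le> j" "j < q" using assms(1) by (simp_all add: j_def)
      have nj: "n = b * q + j" using n(1) by (auto simp: B_def j_def)
      have "?q * (of_int n * \<theta> - of_int (round (of_int n * \<theta>))) = of_int k + of_int n * \<eta>"
        unfolding n(2) z_def \<eta>_def by (simp add: algebra_simps)
      then have "\<bar>of_int k + of_int n * \<eta>\<bar> = ?q * \<bar>of_int n * \<theta> - of_int (round (of_int n * \<theta>))\<bar>"
        using q by (metis abs_mult abs_of_pos)
      also have "\<dots> \<le> ?q * \<epsilon>" using nd q by (intro mult_left_mono) auto
      finally have 1: "\<bar>of_int k + of_int n * \<eta>\<bar> \<le> ?q * \<epsilon>" .
      have "\<bar>of_int j * \<eta>\<bar> \<le> ?q * (1 / ?q)" unfolding abs_mult using j \<eta> by (intro mult_mono) auto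
      then have 2: "\<bar>of_int j * \<eta>\<bar> \<le> 1" using q by simp
      have "of_int n * \<eta> = of_int b * ?q * \<eta> + of_int j * \<eta>" unfolding nj by (simp add: algebra_simps)
      with 1 2 show "k \<in> {k. ?l \<le> of_int k \<and> of_int k \<le> ?u}" by (simp only: mem_Collect_eq) linarith
    qed
    moreover have "inj_on z (B b)"
    proof (rule inj_onI)
      fix m n assume mn: "m \<in> B b" "n \<in> B b" "z m = z n"
      have "(m - n) * a = (round (of_int m * \<theta>) - round (of_int n * \<theta>)) * q"
        using mn(3) by (simp add: z_def algebra_simps)
      then have "q dvd (m - n) * a" by simp
      then have "q dvd m - n" using assms(2) by (simp add: coprime_dvd_mult_left_iff coprime_commute)
      then have "m mod q = n mod q" by (simp add: mod_eq_dvd_iff)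
      moreover have "m div q = n div q" using mn by (simp add: B_def)
      ultimately show "m = n" by (metis div_mult_mod_eq)
    qed
    ultimately have "card (B b) \<le> card {k::int. ?l \<le> of_int k \<and> of_int k \<le> ?u}"
      by (intro card_inj_on_le[of z] card_int_interval(1)[OF lu])
    then have "real (card (B b)) \<le> ?u - ?l + 1" using card_int_interval(2)[OF lu] by linarith
    then show ?thesis by (simp add: mult_ac)
  qed
  let ?D = "{b::int. - Z / ?q - 1 \<le> of_int b \<and> of_int b \<le> Z / ?q}"
  have D: "- Z / ?q - 1 \<le> Z / ?q + 1" using assms(5) q by (smt (verit) divide_nonneg_pos minus_divide_left)
  have sub: "?A \<subseteq> (\<Union>b\<in>?D. B b)"
  proof
    fix n assume n: "n \<in> ?A"
    have fl: "n div q = \<lfloor>of_int n / ?q\<rfloor>" by (simp add: floor_divide_of_int_eq)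
    have nz: "- Z \<le> of_int n" "of_int n \<le> Z" using n by (auto simp: abs_le_iff)
    have "- Z / ?q \<le> of_int n / ?q" "of_int n / ?q \<le> Z / ?q"
      using divide_right_mono[OF nz(1), of ?q] divide_right_mono[OF nz(2), of ?q] q by simp_all
    then have "n div q \<in> ?D" unfolding fl mem_Collect_eq by linarith
    moreover have "n \<in> B (n div q)" using n by (simp add: B_def)
    ultimately show "n \<in> (\<Union>b\<in>?D. B b)" by blast
  qed
  have "finite (B b)" for b by (rule finite_subset[OF _ finA]) (auto simp: B_def)
  then have "card ?A \<le> card (\<Union>b\<in>?D. B b)" by (intro card_mono[OF _ sub] finite_UN_I card_int_interval(1)[OF D])
  also have "\<dots> \<le> (\<Sum>b\<in>?D. card (B b))" by (rule card_UN_le[OF card_int_interval(1)[OF D]])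
  finally have "real (card ?A) \<le> (\<Sum>b\<in>?D. real (card (B b)))" unfolding of_nat_sum[symmetric] by (rule of_nat_mono)
  also have "\<dots> \<le> (\<Sum>b\<in>?D. 2 * ?q * \<epsilon> + 3)" by (intro sum_mono cardB)
  also have "\<dots> = real (card ?D) * (2 * ?q * \<epsilon> + 3)" by simp
  also have "\<dots> \<le> (2 * Z / ?q + 2) * (2 * ?q * \<epsilon> + 3)"
    using card_int_interval(2)[OF D] q assms(4) by (intro mult_right_mono) auto
  finally show "real (card ?A) \<le> (2 * Z / ?q + 2) * (2 * ?q * \<epsilon> + 3)" .
qed

lemma finite_vmax_le: "finite {y. of_int (vmax y) \<le> (Y::real)}"
proof -
  have "{y. of_int (vmax y) \<le> Y} \<subseteq> (\<lambda>(a, b). vector [a, b]) ` ({-\<lfloor>Y\<rfloor>..\<lfloor>Y\<rfloor>} \<times> {-\<lfloor>Y\<rfloor>..\<lfloor>Y\<rfloor>})"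
  proof
    fix y :: "int^2" assume "y \<in> {y. of_int (vmax y) \<le> Y}"
    then have "vmax y \<le> \<lfloor>Y\<rfloor>" by (simp add: le_floor_iff)
    then have "\<bar>y$1\<bar> \<le> \<lfloor>Y\<rfloor>" "\<bar>y$2\<bar> \<le> \<lfloor>Y\<rfloor>" using vmax_ge[of y] by linarith+
    then have "(y$1, y$2) \<in> {-\<lfloor>Y\<rfloor>..\<lfloor>Y\<rfloor>} \<times> {-\<lfloor>Y\<rfloor>..\<lfloor>Y\<rfloor>}" by auto
    moreover have "y = (\<lambda>(a, b). vector [a, b]) (y$1, y$2)" by (simp add: vec_eq_iff forall_2)
    ultimately show "y \<in> (\<lambda>(a, b). vector [a, b]) ` ({-\<lfloor>Y\<rfloor>..\<lfloor>Y\<rfloor>} \<times> {-\<lfloor>Y\<rfloor>..\<lfloor>Y\<rfloor>})"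
      by (rule rev_image_eqI)
  qed
  then show ?thesis by (rule finite_subset) simp
qed

text \<open>Two solutions differ by an integer multiple k y, and |k| \<open>vmax y\<close> is at
  most 2 Y.\<close>

lemma card_wedge_eq:
  assumes "coprime (y$1) (y$2)" "Y \<ge> 0"
  shows "real (card {y'. of_int (vmax y') \<le> Y \<and> wedge y y' = n}) \<le> 4 * Y / of_int (vmax y) + 1"
proof (cases "{y'. of_int (vmax y') \<le> Y \<and> wedge y y' = n} = {}")
  case True
  have "vmax y \<ge> 1" by (rule vmax_ge_1[OF assms(1)])
  then show ?thesis unfolding True using assms(2) by simp
next
  case False
  let ?v = "real_of_int (vmax y)"
  have v: "?v \<ge> 1" using vmax_ge_1[OF assms(1)] by simp
  obtain z where z: "of_int (vmax z) \<le> Y" "wedge y z = n" using False by blast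
  let ?K = "{k::int. - (2 * Y / ?v) \<le> of_int k \<and> of_int k \<le> 2 * Y / ?v}"
  have le: "- (2 * Y / ?v) \<le> 2 * Y / ?v + 1" using assms(2) v by (smt (verit) divide_nonneg_pos)
  have "{y'. of_int (vmax y') \<le> Y \<and> wedge y y' = n} \<subseteq> (\<lambda>k. (\<chi> i. z$i + k * y$i)) ` ?K"
  proof
    fix y' assume "y' \<in> {y'. of_int (vmax y') \<le> Y \<and> wedge y y' = n}"
    then have y': "of_int (vmax y') \<le> Y" "wedge y y' = n" by auto
    have "wedge y (y' - z) = 0" using y'(2) z(2) by (simp add: wedge_def algebra_simps)
    then obtain k where k: "(y' - z)$1 = k * y$1" "(y' - z)$2 = k * y$2" using assms(1) by (rule wedge_eq_0_imp)
    have le2: "\<bar>y'$i - z$i\<bar> \<le> vmax y' + vmax z" for i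
      using vmax_ge[of y'] vmax_ge[of z] exhaust_2[of i] by (auto intro: order_trans[OF abs_triangle_ineq4])
    have "\<bar>k\<bar> * vmax y \<le> vmax y' + vmax z"
    proof (cases "vmax y = \<bar>y$1\<bar>")
      case True
      then show ?thesis using k(1) le2[of 1] by (simp flip: abs_mult)
    next
      case False
      then have "vmax y = \<bar>y$2\<bar>" by (auto simp: vmax_def max_def split: if_splits)
      then show ?thesis using k(2) le2[of 2] by (simp flip: abs_mult)
    qed
    then have "real_of_int (\<bar>k\<bar> * vmax y) \<le> of_int (vmax y' + vmax z)" by (simp only: of_int_le_iff)
    then have "\<bar>real_of_int k\<bar> * ?v \<le> 2 * Y" using y'(1) z(1) by simp
    then have "\<bar>real_of_int k\<bar> \<le> 2 * Y / ?v" using v by (simp add: pos_le_divide_eq)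
    then have "k \<in> ?K" by auto
    moreover have "y' = (\<chi> i. z$i + k * y$i)" using k by (simp add: vec_eq_iff forall_2)
    ultimately show "y' \<in> (\<lambda>k. (\<chi> i. z$i + k * y$i)) ` ?K" by blast
  qed
  then have "card {y'. of_int (vmax y') \<le> Y \<and> wedge y y' = n} \<le> card ((\<lambda>k. (\<chi> i. z$i + k * y$i)) ` ?K)"
    by (intro card_mono finite_imageI card_int_interval(1)[OF le])
  also have "\<dots> \<le> card ?K" by (rule card_image_le[OF card_int_interval(1)[OF le]])
  finally have "real (card {y'. of_int (vmax y') \<le> Y \<and> wedge y y' = n}) \<le> real (card ?K)" by simp
  also have "\<dots> \<le> 2 * Y / ?v - (- (2 * Y / ?v)) + 1" by (rule card_int_interval(2)[OF le])
  finally show ?thesis by simp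
qed

lemma card_wedge_near_int:
  fixes q :: int
  assumes y: "coprime (y$1) (y$2)" and "q > 0" "coprime a q" "\<bar>of_int q * \<theta> - of_int a\<bar> \<le> 1 / of_int q"
    and "\<epsilon> \<ge> 0" "Y \<ge> 0"
  shows "real (card {y'. of_int (vmax y') \<le> Y \<and> nint_dist (of_int (wedge y y') * \<theta>) \<le> \<epsilon>})
    \<le> (4 * Y / of_int (vmax y) + 1) * ((4 * of_int (vmax y) * Y / of_int q + 2) * (2 * of_int q * \<epsilon> + 3))"
proof -
  let ?v = "real_of_int (vmax y)"
  have v: "?v \<ge> 1" using vmax_ge_1[OF y] by simp
  define N where "N = {n::int. \<bar>of_int n\<bar> \<le> 2 * ?v * Y \<and> nint_dist (of_int n * \<theta>) \<le> \<epsilon>}"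
  have Z: "2 * ?v * Y \<ge> 0" using v assms(6) by simp
  have N: "finite N" "real (card N) \<le> (2 * (2 * ?v * Y) / of_int q + 2) * (2 * of_int q * \<epsilon> + 3)"
    unfolding N_def by (rule card_multiples_near_int[OF assms(2-5) Z])+
  have sub: "{y'. of_int (vmax y') \<le> Y \<and> nint_dist (of_int (wedge y y') * \<theta>) \<le> \<epsilon>}
      \<subseteq> (\<Union>n\<in>N. {y'. of_int (vmax y') \<le> Y \<and> wedge y y' = n})"
  proof safe
    fix y' assume y': "of_int (vmax y') \<le> Y" "nint_dist (of_int (wedge y y') * \<theta>) \<le> \<epsilon>"
    have "\<bar>wedge y y'\<bar> \<le> \<bar>y$1\<bar> * \<bar>y'$2\<bar> + \<bar>y$2\<bar> * \<bar>y'$1\<bar>"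
      unfolding wedge_def abs_mult[symmetric] by (rule abs_triangle_ineq4)
    also have "\<dots> \<le> vmax y * vmax y' + vmax y * vmax y'"
      by (intro add_mono mult_mono vmax_ge) (auto simp: vmax_def)
    finally have "real_of_int \<bar>wedge y y'\<bar> \<le> real_of_int (vmax y * vmax y' + vmax y * vmax y')"
      by (simp only: of_int_le_iff)
    also have "\<dots> = 2 * ?v * of_int (vmax y')" by simp
    also have "\<dots> \<le> 2 * ?v * Y" using v y'(1) by (intro mult_left_mono) auto
    finally have "wedge y y' \<in> N" using y'(2) by (simp add: N_def)
    then show "y' \<in> (\<Union>n\<in>N. {y'. of_int (vmax y') \<le> Y \<and> wedge y y' = n})" using y'(1) by blast
  qed
  have "card {y'. of_int (vmax y') \<le> Y \<and> nint_dist (of_int (wedge y y') * \<theta>) \<le> \<epsilon>}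
      \<le> card (\<Union>n\<in>N. {y'. of_int (vmax y') \<le> Y \<and> wedge y y' = n})"
    by (rule card_mono[OF _ sub]) (rule finite_subset[OF _ finite_vmax_le[of Y]], auto)
  also have "\<dots> \<le> (\<Sum>n\<in>N. card {y'. of_int (vmax y') \<le> Y \<and> wedge y y' = n})" by (rule card_UN_le[OF N(1)])
  finally have "real (card {y'. of_int (vmax y') \<le> Y \<and> nint_dist (of_int (wedge y y') * \<theta>) \<le> \<epsilon>})
      \<le> (\<Sum>n\<in>N. real (card {y'. of_int (vmax y') \<le> Y \<and> wedge y y' = n}))"
    unfolding of_nat_sum[symmetric] by (rule of_nat_mono)
  also have "\<dots> \<le> (\<Sum>n\<in>N. 4 * Y / ?v + 1)" by (intro sum_mono card_wedge_eq[OF y assms(6)])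
  also have "\<dots> = (4 * Y / ?v + 1) * real (card N)" by simp
  also have "\<dots> \<le> (4 * Y / ?v + 1) * ((2 * (2 * ?v * Y) / of_int q + 2) * (2 * of_int q * \<epsilon> + 3))"
    using v assms(6) by (intro mult_left_mono N) auto
  finally show ?thesis by (simp add: mult.assoc)
qed

text \<open>For vectors y' of size about z, the three factors stand for the vectors with a given
  wedge product, the blocks of length q, and the choices within a block. The factor 1 / z comes from
  the number of \<theta>' for each y'.\<close>

lemma dyadic_product_le:
  fixes v z q r Y :: real
  assumes "1 \<le> v" "v \<le> Y" "1 \<le> z" "z \<le> 2 * Y" "q > 0" "r \<ge> 0"
  shows "1 / z * ((z / v + 1) * ((v * z / q + 1) * (q * r * z + 1)))
    \<le> 2 + 3 * Y / q + 3 * q * r * Y / v + 6 * r * Y\<^sup>2"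
proof -
  have "1 / z * ((z / v + 1) * ((v * z / q + 1) * (q * r * z + 1)))
      = (1 / v + 1 / z) + (z + v) / q + q * r * (z / v + 1) + r * ((z + v) * z)"
    using assms by (simp add: field_simps)
  also have "\<dots> \<le> 2 + 3 * Y / q + q * r * (3 * Y / v) + r * (3 * Y * (2 * Y))"
  proof (intro add_mono)
    have "1 / v \<le> 1" "1 / z \<le> 1" using assms by simp_all
    then show "1 / v + 1 / z \<le> 2" by linarith
    show "(z + v) / q \<le> 3 * Y / q" using assms by (intro divide_right_mono) auto
    have "z / v + 1 = (z + v) / v" using assms by (simp add: field_simps)
    also have "\<dots> \<le> 3 * Y / v" using assms by (intro divide_right_mono) auto
    finally show "q * r * (z / v + 1) \<le> q * r * (3 * Y / v)" using assms by (intro mult_left_mono) auto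
    show "r * ((z + v) * z) \<le> r * (3 * Y * (2 * Y))" using assms by (intro mult_left_mono mult_mono) auto
  qed
  finally show ?thesis by (simp add: power2_eq_square mult_ac)
qed

text \<open>The vectors y' are split by size into dyadic ranges, the number of which gives the
  logarithm. In a range, \<open>card_wedge_near_int\<close> counts the y', and for each y' all
  \<theta>' lie on one strand, in an arc of length of order r / \<open>vmax y'\<close>.\<close>

lemma card_torus_close_pairs:
  fixes q :: int and V :: "(int^2) set"
  assumes V: "finite V" "\<And>y. y \<in> V \<Longrightarrow> coprime (y$1) (y$2)" "\<And>y. y \<in> V \<Longrightarrow> of_int (vmax y) \<le> Y"
    and \<Theta>: "finite \<Theta>" "\<Theta> \<subseteq> {0..<1}" "\<Theta> \<subseteq> grid \<phi> M" "M > 0"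
    and r: "r > 0" "4 * r * Y < 1" "Y \<le> K * (r * M)" "K > 0"
    and y: "y \<in> V" and q: "q > 0" "coprime a q" "\<bar>of_int q * \<theta> - of_int a\<bar> \<le> 1 / of_int q"
  shows "real (card {(y', \<theta>') \<in> V \<times> \<Theta>. torus_close r y \<theta> y' \<theta>'})
    \<le> (1 + 2 * ln Y) * (192 * (8 + 2 * K) * (r * M) *
        (2 + 3 * Y / of_int q + 3 * of_int q * r * Y / of_int (vmax y) + 6 * r * Y\<^sup>2))"
proof -
  let ?v = "real_of_int (vmax y)" and ?q = "real_of_int q"
  have v: "1 \<le> ?v" "?v \<le> Y" using vmax_ge_1[OF V(2)[OF y]] V(3)[OF y] by simp_all
  have Y1: "Y \<ge> 1" using v by linarith
  define R where "R = 2 + 3 * Y / ?q + 3 * ?q * r * Y / ?v + 6 * r * Y\<^sup>2"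
  define J where "J = nat \<lfloor>log 2 Y\<rfloor>"
  define W where "W j = {y'. of_int (vmax y') \<le> (2::real) ^ Suc j \<and> nint_dist (of_int (wedge y y') * \<theta>)
    \<le> 2 * r * 2 ^ Suc j}" for j :: nat
  define f where "f y' = {\<theta>' \<in> \<Theta>. torus_close r y \<theta> y' \<theta>'}" for y'
  \<comment> \<open>Vectors without a partner \<theta>' are left out, because only a near
    coincidence puts y' into \<open>W j\<close>.\<close>
  define Vj where "Vj j = {y' \<in> V. 2 ^ j \<le> vmax y' \<and> vmax y' < 2 ^ Suc j \<and> f y' \<noteq> {}}" for j :: nat
  have W_fin: "finite (W j)" for j
    by (rule finite_subset[OF _ finite_vmax_le[of "2 ^ Suc j"]]) (auto simp: W_def)
  have rM: "r * M > 0" using r \<Theta>(4) by simp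
  have J: "2 ^ Suc j \<le> 2 * Y" if "j \<le> J" for j
  proof -
    have "real j \<le> log 2 Y" using that Y1 unfolding J_def
      by (simp add: le_nat_floor zero_le_floor le_nat_iff le_floor_iff)
    then have "2 powr real j \<le> Y" using Y1 by (simp add: le_log_iff)
    then show ?thesis by (simp add: powr_realpow)
  qed
  have sub: "{(y', \<theta>') \<in> V \<times> \<Theta>. torus_close r y \<theta> y' \<theta>'} \<subseteq> (\<Union>j\<in>{..J}. Sigma (Vj j) f)"
  proof safe
    fix y' \<theta>' assume y': "y' \<in> V" and \<theta>': "\<theta>' \<in> \<Theta>" and close: "torus_close r y \<theta> y' \<theta>'"
    have v': "1 \<le> vmax y'" "real_of_int (vmax y') \<le> Y" using vmax_ge_1[OF V(2)[OF y']] V(3)[OF y'] by simp_all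
    define j where "j = nat \<lfloor>log 2 (real_of_int (vmax y'))\<rfloor>"
    have l0: "log 2 (real_of_int (vmax y')) \<ge> 0" using v' by simp
    have j: "real j \<le> log 2 (real_of_int (vmax y'))" "log 2 (real_of_int (vmax y')) < real j + 1"
      using l0 unfolding j_def by linarith+
    have "2 powr real j \<le> real_of_int (vmax y')" using j(1) v' by (simp add: le_log_iff)
    then have 1: "2 ^ j \<le> vmax y'" by (simp add: powr_realpow)
    have "real_of_int (vmax y') < 2 powr (real j + 1)" using j(2) v' by (simp add: log_less_iff)
    also have "\<dots> = 2 ^ Suc j" using powr_realpow[of 2 "Suc j"] by (simp add: add.commute)
    finally have 2: "vmax y' < 2 ^ Suc j" by (metis of_int_less_iff of_int_numeral of_int_power)
    have "log 2 (real_of_int (vmax y')) \<le> log 2 Y" using v' by simp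
    then have "j \<le> J" unfolding j_def J_def by (intro nat_mono floor_mono)
    moreover have "\<theta>' \<in> f y'" using \<theta>' close by (simp add: f_def)
    moreover from this have "y' \<in> Vj j" using y' 1 2 by (auto simp: Vj_def)
    ultimately show "(y', \<theta>') \<in> (\<Union>j\<in>{..J}. Sigma (Vj j) f)" by blast
  qed
  have finf: "finite (f y')" for y' using \<Theta>(1) by (simp add: f_def)
  have finV: "finite (Vj j)" for j using V(1) by (simp add: Vj_def)
  have cardf: "real (card (f y')) \<le> 3 * (4 * (r * M) / 2 ^ j + 1)" if "y' \<in> Vj j" for y' j
  proof -
    have y': "y' \<in> V" "2 ^ j \<le> vmax y'" using that by (simp_all add: Vj_def)
    let ?w = "real_of_int (vmax y')"
    have w: "2 ^ j \<le> ?w" using y'(2) by (metis of_int_le_iff of_int_numeral of_int_power)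
    have w1: "1 \<le> ?w" "?w \<le> Y" using vmax_ge_1[OF V(2)[OF y'(1)]] V(3)[OF y'(1)] by simp_all
    have small: "4 * r * ?w < 1"
      using r(2) mult_left_mono[OF w1(2), of "4 * r"] r(1) by linarith
    have r1: "2 * r / ?w < 1"
    proof -
      have "2 * r / ?w \<le> 2 * r * ?w" using w1 r(1) mult_mono[of 1 ?w 1 ?w] by (simp add: field_simps)
      then show ?thesis using small r(1) w1 by linarith
    qed
    have "real (card (f y')) \<le> 3 * (2 * (2 * r / ?w) * M + 1)"
    proof (rule card_grid_close[OF \<Theta>(4) _ r1])
      fix \<theta>1 \<theta>2 assume "\<theta>1 \<in> f y'" "\<theta>2 \<in> f y'"
      then show "nint_dist (\<theta>1 - \<theta>2) \<le> 2 * r / ?w"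
        by (intro torus_close_same_strand[OF V(2)[OF y'(1)] small, of y \<theta>]) (auto simp: f_def)
    qed (use \<Theta> r(1) w1 in \<open>auto simp: f_def\<close>)
    also have "\<dots> = 3 * (4 * (r * M) / ?w + 1)" by simp
    also have "\<dots> \<le> 3 * (4 * (r * M) / 2 ^ j + 1)"
      using w w1 rM by (intro mult_left_mono add_right_mono divide_left_mono) auto
    finally show ?thesis .
  qed
  have cardV: "real (card (Vj j)) \<le> (4 * 2 ^ Suc j / ?v + 1) * ((4 * ?v * 2 ^ Suc j / ?q + 2) *
    (2 * ?q * (2 * r * 2 ^ Suc j) + 3))" for j
  proof -
    have "Vj j \<subseteq> W j"
    proof
      fix y' assume y': "y' \<in> Vj j"
      then have lt: "vmax y' < 2 ^ Suc j" and ne: "f y' \<noteq> {}" by (simp_all add: Vj_def)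
      from lt have w: "real_of_int (vmax y') \<le> 2 ^ Suc j" by (metis less_imp_le of_int_le_iff of_int_numeral of_int_power)
      obtain \<theta>' where "torus_close r y \<theta> y' \<theta>'" using ne by (auto simp: f_def)
      from nint_dist_wedge[OF this] have "nint_dist (of_int (wedge y y') * \<theta>) \<le> 2 * r * 2 ^ Suc j"
        using w r(1) by (meson mult_left_mono order_trans less_imp_le mult_pos_pos zero_less_numeral)
      with w show "y' \<in> W j" unfolding W_def by blast
    qed
    then have "real (card (Vj j)) \<le> real (card (W j))" using card_mono[OF W_fin] by simp
    also have "\<dots> \<le> (4 * 2 ^ Suc j / ?v + 1) * ((4 * ?v * 2 ^ Suc j / ?q + 2) * (2 * ?q * (2 * r * 2 ^ Suc j) + 3))"
      unfolding W_def using r(1) by (intro card_wedge_near_int[OF V(2)[OF y] q]) auto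
    finally show ?thesis .
  qed
  have trm: "real (card (Sigma (Vj j) f)) \<le> 192 * (8 + 2 * K) * (r * M) * R" if "j \<le> J" for j
  proof -
    define z where "z = (2::real) ^ Suc j"
    have z: "z \<le> 2 * Y" using J[OF that] by (simp add: z_def)
    have z1: "1 \<le> z" unfolding z_def by (rule one_le_power) simp
    have zj: "2 ^ j = z / 2" by (simp add: z_def)
    have qp: "?q > 0" using q(1) by simp
    have "real (card (Sigma (Vj j) f)) = (\<Sum>y'\<in>Vj j. real (card (f y')))"
      using finV finf by (simp add: card_SigmaI)
    also have "\<dots> \<le> (\<Sum>y'\<in>Vj j. 3 * (4 * (r * M) / 2 ^ j + 1))" by (intro sum_mono cardf)
    also have "\<dots> = 3 * (8 * (r * M) / z + 1) * real (card (Vj j))" by (simp add: zj)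
    \<comment> \<open>As z \<le> 2 Y \<le> 2 K r M, the summand 1 is absorbed into the count along a
      strand. The constant 192 will be 3 * 4 * 4 * 4, with one 4 for each of the three
      factors.\<close>
    also have "\<dots> \<le> 3 * ((8 + 2 * K) * (r * M) / z) *
      ((4 * z / ?v + 1) * ((4 * ?v * z / ?q + 2) * (2 * ?q * (2 * r * z) + 3)))"
    proof (intro mult_mono mult_left_mono)
      have "z \<le> 2 * (K * (r * M))" using z r(3) by linarith
      then show "8 * (r * M) / z + 1 \<le> (8 + 2 * K) * (r * M) / z" using z1 by (simp add: field_simps)
      show "real (card (Vj j)) \<le> (4 * z / ?v + 1) * ((4 * ?v * z / ?q + 2) * (2 * ?q * (2 * r * z) + 3))"
        using cardV[of j] by (simp add: z_def)
    qed (use z1 rM r in auto)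
    also have "\<dots> \<le> 3 * ((8 + 2 * K) * (r * M) / z) *
      ((4 * (z / ?v + 1)) * ((4 * (?v * z / ?q + 1)) * (4 * (?q * r * z + 1))))"
      using z1 v qp r rM by (intro mult_left_mono mult_mono) auto
    also have "\<dots> = 192 * (8 + 2 * K) * (r * M) * (1 / z * ((z / ?v + 1) * ((?v * z / ?q + 1) * (?q * r * z + 1))))"
    proof -
      have alg: "3 * (c / z) * ((4 * a) * ((4 * b) * (4 * d))) = 192 * c * (1 / z * (a * (b * d)))" for a b c d :: real
        by simp
      show ?thesis unfolding alg by (simp only: mult.assoc)
    qed
    also have "\<dots> \<le> 192 * (8 + 2 * K) * (r * M) * R"
      unfolding R_def using v z z1 qp r rM by (intro mult_left_mono dyadic_product_le) auto
    finally show ?thesis .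
  qed
  have R0: "R \<ge> 0" using Y1 v r q by (simp add: R_def)
  have "card {(y', \<theta>') \<in> V \<times> \<Theta>. torus_close r y \<theta> y' \<theta>'} \<le> card (\<Union>j\<in>{..J}. Sigma (Vj j) f)"
    by (rule card_mono[OF _ sub]) (use finV finf in auto)
  also have "\<dots> \<le> (\<Sum>j\<in>{..J}. card (Sigma (Vj j) f))" by (rule card_UN_le) simp
  finally have "real (card {(y', \<theta>') \<in> V \<times> \<Theta>. torus_close r y \<theta> y' \<theta>'}) \<le> (\<Sum>j\<in>{..J}. real (card (Sigma (Vj j) f)))"
    unfolding of_nat_sum[symmetric] by (rule of_nat_mono)
  also have "\<dots> \<le> (\<Sum>j\<in>{..J}. 192 * (8 + 2 * K) * (r * M) * R)" by (intro sum_mono trm) simp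
  also have "\<dots> = (1 + real J) * (192 * (8 + 2 * K) * (r * M) * R)" by simp
  also have "\<dots> \<le> (1 + 2 * ln Y) * (192 * (8 + 2 * K) * (r * M) * R)"
  proof (intro mult_right_mono add_left_mono)
    have l: "log 2 Y \<ge> 0" using Y1 by simp
    have "real J \<le> log 2 Y" using l unfolding J_def by linarith
    also have "\<dots> = ln Y / ln 2" by (simp add: log_def)
    also have "\<dots> \<le> 2 * ln Y"
    proof -
      have "ln 2 \<ge> (1/2 :: real)" using ln_ge_iff[of 2 "1/2"] exp_half_le2 by simp
      then have "ln Y * 1 \<le> ln Y * (2 * ln 2)" using Y1 by (intro mult_left_mono) auto
      then show ?thesis by (simp add: field_simps)
    qed
    finally show "real J \<le> 2 * ln Y" .
  qed (use R0 rM r in auto)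
  finally show ?thesis unfolding R_def .
qed

section \<open>The bilinear estimate\<close>

text \<open>The dual sum \<open>G\<close> has the conjugates of \<open>T\<close> as coefficients, so
  that the sum of |T|^2 is the pairing of \<mu> with \<open>G\<close>. Cauchy-Schwarz splits off
  \<mu>, and the large sieve is applied to \<open>G\<close> at the points y \<theta> of the torus,
  indexed by the pairs (\<theta>, y).\<close>

lemma bilinear_bound:
  fixes V Xs :: "(int^2) set" and \<mu> :: "int^2 \<Rightarrow> real"
  assumes fin: "finite Xs" "finite V" "finite \<Theta>" and h: "0 < h" "h < 1 / 2"
    and Xs: "\<And>x i. x \<in> Xs \<Longrightarrow> \<bar>real_of_int (x$i)\<bar> * h \<le> 1 / 6"
    and T: "\<And>\<theta>. T \<theta> = (\<Sum>x\<in>Xs. of_real (\<mu> x) * (\<Sum>y\<in>V. unit_exp (of_int (int_dot x y) * \<theta>)))"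
  shows "(\<Sum>\<theta>\<in>\<Theta>. (cmod (T \<theta>))\<^sup>2)\<^sup>2 \<le> (\<Sum>x\<in>Xs. (\<mu> x)\<^sup>2) * (4 / h\<^sup>2 *
    (\<Sum>\<theta>\<in>\<Theta>. \<Sum>\<theta>'\<in>\<Theta>. cmod (T \<theta>) * cmod (T \<theta>') *
      real (card {(y, y') \<in> V \<times> V. torus_close (2 * h) y \<theta> y' \<theta>'})))"
proof -
  define c where "c i = cnj (T (fst i))" for i :: "real \<times> (int^2)"
  define s where "s i = of_int (snd i $ 1) * fst i" for i :: "real \<times> (int^2)"
  define t where "t i = of_int (snd i $ 2) * fst i" for i :: "real \<times> (int^2)"
  define G where "G x y = (\<Sum>i\<in>\<Theta> \<times> V. c i * unit_exp (of_int x * s i + of_int y * t i))" for x y :: int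
  define J where "J = {x::int. \<bar>real_of_int x\<bar> * h \<le> 1 / 6}"
  have J: "finite J"
  proof (rule finite_subset)
    show "J \<subseteq> {x. - (1 / (6 * h)) \<le> of_int x \<and> of_int x \<le> 1 / (6 * h)}"
    proof
      fix x assume "x \<in> J"
      then have "\<bar>real_of_int x\<bar> \<le> 1 / (6 * h)" using h by (simp add: J_def field_simps)
      then show "x \<in> {x. - (1 / (6 * h)) \<le> of_int x \<and> of_int x \<le> 1 / (6 * h)}" by (simp add: abs_le_iff)
    qed
    show "finite {x::int. - (1 / (6 * h)) \<le> of_int x \<and> of_int x \<le> 1 / (6 * h)}"
      using h by (intro card_int_interval(1)) (simp add: field_simps)
  qed
  define S2 where "S2 = (\<Sum>\<theta>\<in>\<Theta>. (cmod (T \<theta>))\<^sup>2)"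
  have G_eq: "G (x$1) (x$2) = (\<Sum>\<theta>\<in>\<Theta>. cnj (T \<theta>) * (\<Sum>y\<in>V. unit_exp (of_int (int_dot x y) * \<theta>)))" for x
  proof -
    have "G (x$1) (x$2) = (\<Sum>\<theta>\<in>\<Theta>. \<Sum>y\<in>V. cnj (T \<theta>) * unit_exp (of_int (int_dot x y) * \<theta>))"
      unfolding G_def sum.cartesian_product'
      by (simp add: c_def s_def t_def int_dot_def sum_2 algebra_simps)
    then show ?thesis by (simp only: sum_distrib_left)
  qed
  have "complex_of_real S2 = (\<Sum>\<theta>\<in>\<Theta>. cnj (T \<theta>) * T \<theta>)"
    unfolding S2_def of_real_sum complex_norm_square by (simp only: mult.commute)
  also have "\<dots> = (\<Sum>\<theta>\<in>\<Theta>. \<Sum>x\<in>Xs. of_real (\<mu> x) * (cnj (T \<theta>) * (\<Sum>y\<in>V. unit_exp (of_int (int_dot x y) * \<theta>))))"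
  proof (rule sum.cong[OF refl])
    fix \<theta>
    have "cnj (T \<theta>) * T \<theta> = cnj (T \<theta>) * (\<Sum>x\<in>Xs. of_real (\<mu> x) * (\<Sum>y\<in>V. unit_exp (of_int (int_dot x y) * \<theta>)))"
      by (simp only: T)
    then show "cnj (T \<theta>) * T \<theta> = (\<Sum>x\<in>Xs. of_real (\<mu> x) * (cnj (T \<theta>) * (\<Sum>y\<in>V. unit_exp (of_int (int_dot x y) * \<theta>))))"
      by (simp only: sum_distrib_left[of "cnj (T \<theta>)" _ Xs] mult.left_commute)
  qed
  also have "\<dots> = (\<Sum>x\<in>Xs. of_real (\<mu> x) * G (x$1) (x$2))"
    by (subst sum.swap) (simp only: G_eq sum_distrib_left[of "of_real (\<mu> _)" _ \<Theta>])
  finally have S2_eq: "complex_of_real S2 = (\<Sum>x\<in>Xs. of_real (\<mu> x) * G (x$1) (x$2))" .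
  have S20: "S2 \<ge> 0" unfolding S2_def by (intro sum_nonneg) simp
  have "S2 = cmod (complex_of_real S2)" using S20 by simp
  also have "\<dots> \<le> (\<Sum>x\<in>Xs. \<bar>\<mu> x\<bar> * cmod (G (x$1) (x$2)))"
    unfolding S2_eq by (rule order_trans[OF norm_sum]) (simp add: norm_mult)
  finally have "S2\<^sup>2 \<le> (\<Sum>x\<in>Xs. \<bar>\<mu> x\<bar> * cmod (G (x$1) (x$2)))\<^sup>2" using S20 by (intro power_mono)
  also have "\<dots> \<le> (\<Sum>x\<in>Xs. \<bar>\<mu> x\<bar>\<^sup>2) * (\<Sum>x\<in>Xs. (cmod (G (x$1) (x$2)))\<^sup>2)"
    by (rule Cauchy_Schwarz_ineq_sum)
  also have "\<dots> \<le> (\<Sum>x\<in>Xs. (\<mu> x)\<^sup>2) * (4 / h\<^sup>2 *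
    (\<Sum>\<theta>\<in>\<Theta>. \<Sum>\<theta>'\<in>\<Theta>. cmod (T \<theta>) * cmod (T \<theta>') * real (card {(y, y') \<in> V \<times> V. torus_close (2 * h) y \<theta> y' \<theta>'})))"
  proof (intro mult_mono)
    have cardeq: "(\<Sum>y\<in>V. \<Sum>y'\<in>V. if torus_close (2 * h) y \<theta> y' \<theta>' then 1 else 0)
        = real (card {(y, y') \<in> V \<times> V. torus_close (2 * h) y \<theta> y' \<theta>'})" for \<theta> \<theta>'
    proof -
      have "(\<Sum>y\<in>V. \<Sum>y'\<in>V. if torus_close (2 * h) y \<theta> y' \<theta>' then 1 else 0 :: real)
          = (\<Sum>p\<in>V \<times> V. if torus_close (2 * h) (fst p) \<theta> (snd p) \<theta>' then 1 else 0)"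
        unfolding sum.cartesian_product' by simp
      also have "\<dots> = (\<Sum>p\<in>{p \<in> V \<times> V. torus_close (2 * h) (fst p) \<theta> (snd p) \<theta>'}. 1)"
        using fin by (intro sum.inter_filter[symmetric]) simp
      also have "{p \<in> V \<times> V. torus_close (2 * h) (fst p) \<theta> (snd p) \<theta>'} = {(y, y') \<in> V \<times> V. torus_close (2 * h) y \<theta> y' \<theta>'}"
        by auto
      finally show ?thesis by simp
    qed
    have inj: "inj_on (\<lambda>x::int^2. (x$1, x$2)) Xs"
      by (auto intro!: inj_onI simp: vec_eq_iff forall_2)
    have "(\<Sum>x\<in>Xs. (cmod (G (x$1) (x$2)))\<^sup>2) = (\<Sum>p\<in>(\<lambda>x. (x$1, x$2)) ` Xs. (cmod (G (fst p) (snd p)))\<^sup>2)"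
      by (subst sum.reindex[OF inj]) simp
    \<comment> \<open>Completing to the full square adds only nonnegative terms and gives the sum
      the shape of the large sieve.\<close>
    also have "\<dots> \<le> (\<Sum>p\<in>J \<times> J. (cmod (G (fst p) (snd p)))\<^sup>2)"
      using J Xs by (intro sum_mono2) (auto simp: J_def)
    also have "\<dots> = (\<Sum>x\<in>J. \<Sum>y\<in>J. (cmod (G x y))\<^sup>2)"
      unfolding sum.cartesian_product' by simp
    also have "\<dots> \<le> 4 / h\<^sup>2 * (\<Sum>i\<in>\<Theta> \<times> V. \<Sum>j\<in>\<Theta> \<times> V. cmod (c i) * cmod (c j) *
        (if nint_dist (s i - s j) \<le> 2 * h \<and> nint_dist (t i - t j) \<le> 2 * h then 1 else 0))"
      unfolding G_def using fin J h by (intro large_sieve_2) (auto simp: J_def)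
    also have "(\<Sum>i\<in>\<Theta> \<times> V. \<Sum>j\<in>\<Theta> \<times> V. cmod (c i) * cmod (c j) *
        (if nint_dist (s i - s j) \<le> 2 * h \<and> nint_dist (t i - t j) \<le> 2 * h then 1 else 0))
      = (\<Sum>\<theta>\<in>\<Theta>. \<Sum>y\<in>V. \<Sum>\<theta>'\<in>\<Theta>. \<Sum>y'\<in>V. cmod (T \<theta>) * cmod (T \<theta>') * (if torus_close (2 * h) y \<theta> y' \<theta>' then 1 else 0))"
      unfolding sum.cartesian_product' by (simp add: c_def s_def t_def torus_close_def)
    also have "\<dots> = (\<Sum>\<theta>\<in>\<Theta>. \<Sum>\<theta>'\<in>\<Theta>. cmod (T \<theta>) * cmod (T \<theta>') *
      (\<Sum>y\<in>V. \<Sum>y'\<in>V. if torus_close (2 * h) y \<theta> y' \<theta>' then 1 else 0))"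
      by (subst (2) sum.swap) (simp only: sum_distrib_left)
    finally show "(\<Sum>x\<in>Xs. (cmod (G (x$1) (x$2)))\<^sup>2) \<le> 4 / h\<^sup>2 *
      (\<Sum>\<theta>\<in>\<Theta>. \<Sum>\<theta>'\<in>\<Theta>. cmod (T \<theta>) * cmod (T \<theta>') * real (card {(y, y') \<in> V \<times> V. torus_close (2 * h) y \<theta> y' \<theta>'}))"
      by (simp only: cardeq)
  qed (auto intro!: sum_nonneg)
  finally show ?thesis by (simp only: S2_def)
qed

text \<open>Rearranges a row sum of the kernel so that \<open>card_torus_close_pairs\<close> applies
  for each y.\<close>

lemma row_sum_eq:
  assumes "finite V" "finite \<Theta>"
  shows "(\<Sum>\<theta>'\<in>\<Theta>. real (card {(y, y') \<in> V \<times> V. torus_close r y \<theta> y' \<theta>'}))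
    = (\<Sum>y\<in>V. real (card {(y', \<theta>') \<in> V \<times> \<Theta>. torus_close r y \<theta> y' \<theta>'}))"
proof -
  have 1: "{(y, y') \<in> V \<times> V. torus_close r y \<theta> y' \<theta>'} = Sigma V (\<lambda>y. {y' \<in> V. torus_close r y \<theta> y' \<theta>'})" for \<theta>'
    by auto
  have 2: "{(y', \<theta>') \<in> V \<times> \<Theta>. torus_close r y \<theta> y' \<theta>'}
    = prod.swap ` Sigma \<Theta> (\<lambda>\<theta>'. {y' \<in> V. torus_close r y \<theta> y' \<theta>'})" for y
    by (auto simp: image_iff)
  have "card {(y', \<theta>') \<in> V \<times> \<Theta>. torus_close r y \<theta> y' \<theta>'} = (\<Sum>\<theta>'\<in>\<Theta>. card {y' \<in> V. torus_close r y \<theta> y' \<theta>'})" for y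
    unfolding 2 using assms by (subst card_image) auto
  moreover have "card {(y, y') \<in> V \<times> V. torus_close r y \<theta> y' \<theta>'} = (\<Sum>y\<in>V. card {y' \<in> V. torus_close r y \<theta> y' \<theta>'})" for \<theta>'
    unfolding 1 using assms by (intro card_SigmaI) auto
  ultimately show ?thesis by (simp only: of_nat_sum) (rule sum.swap)
qed

lemma card_close_sym:
  "card {(y, y') \<in> V \<times> V. torus_close r y \<theta> y' \<theta>'} = card {(y, y') \<in> V \<times> V. torus_close r y \<theta>' y' \<theta>}"
proof -
  have "{(y, y') \<in> V \<times> V. torus_close r y \<theta>' y' \<theta>} = prod.swap ` {(y, y') \<in> V \<times> V. torus_close r y \<theta> y' \<theta>'}"
    using torus_close_sym by (auto simp: image_iff)
  then show ?thesis by (simp add: card_image)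
qed

text \<open>Schur's test for a symmetric kernel, from 2 f x f y \<le> (f x)^2 + (f y)^2.\<close>

lemma schur_bound:
  fixes f :: "'a \<Rightarrow> real" and k :: "'a \<Rightarrow> 'a \<Rightarrow> real"
  assumes "\<And>x y. k x y \<ge> 0" "\<And>x y. k x y = k y x" "\<And>x. x \<in> A \<Longrightarrow> (\<Sum>y\<in>A. k x y) \<le> K"
  shows "(\<Sum>x\<in>A. \<Sum>y\<in>A. f x * f y * k x y) \<le> K * (\<Sum>x\<in>A. (f x)\<^sup>2)"
proof -
  have "(\<Sum>x\<in>A. \<Sum>y\<in>A. f x * f y * k x y) \<le> (\<Sum>x\<in>A. \<Sum>y\<in>A. ((f x)\<^sup>2 / 2 + (f y)\<^sup>2 / 2) * k x y)"
  proof (intro sum_mono mult_right_mono assms)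
    fix x y show "f x * f y \<le> (f x)\<^sup>2 / 2 + (f y)\<^sup>2 / 2"
      using sum_squares_bound[of "f x" "f y"] by simp
  qed
  also have "\<dots> = (\<Sum>x\<in>A. \<Sum>y\<in>A. (f x)\<^sup>2 / 2 * k x y) + (\<Sum>x\<in>A. \<Sum>y\<in>A. (f y)\<^sup>2 / 2 * k x y)"
    by (simp add: distrib_right sum.distrib)
  also have "(\<Sum>x\<in>A. \<Sum>y\<in>A. (f y)\<^sup>2 / 2 * k x y) = (\<Sum>x\<in>A. \<Sum>y\<in>A. (f x)\<^sup>2 / 2 * k x y)"
    by (subst sum.swap) (simp only: assms(2))
  also have "(\<Sum>x\<in>A. \<Sum>y\<in>A. (f x)\<^sup>2 / 2 * k x y) + (\<Sum>x\<in>A. \<Sum>y\<in>A. (f x)\<^sup>2 / 2 * k x y)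
      = (\<Sum>x\<in>A. (f x)\<^sup>2 * (\<Sum>y\<in>A. k x y))"
    unfolding sum_distrib_left sum.distrib[symmetric] by (intro sum.cong refl) simp
  also have "\<dots> \<le> (\<Sum>x\<in>A. (f x)\<^sup>2 * K)" by (intro sum_mono mult_left_mono assms) auto
  also have "\<dots> = K * (\<Sum>x\<in>A. (f x)\<^sup>2)" unfolding sum_distrib_left by (simp only: mult.commute)
  finally show ?thesis .
qed

lemma harm_le_ln: "n \<ge> 1 \<Longrightarrow> (\<Sum>q=1..n. 1 / real q) \<le> 1 + ln (real n)"
proof -
  assume "n \<ge> 1"
  then obtain m where m: "n = Suc m" by (cases n) auto
  have "harm (Suc m) - ln (Suc m) \<le> harm (Suc 0) - ln (Suc 0)"
    using decseq_harm_diff_ln by (rule decseqD) simp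
  then show ?thesis by (simp add: m harm_def inverse_eq_divide)
qed

text \<open>A point \<theta> with denominator k lies within 1 / (k B) of one of the k + 1 fractions
  j / k in [0, 1], and each of these intervals holds at most 2 M / (k B) + 1 grid points. The weight
  1 / k leaves a harmonic sum and a constant for each k.\<close>

lemma sum_reciprocal_denominators:
  fixes q a :: "real \<Rightarrow> int"
  assumes \<Theta>: "finite \<Theta>" "\<Theta> \<subseteq> {0..<1}" "\<Theta> \<subseteq> grid \<phi> M" "M > 0" and B: "B \<ge> (1::real)" and Q: "Q \<ge> 1"
    and q: "\<And>\<theta>. \<theta> \<in> \<Theta> \<Longrightarrow> 0 < q \<theta>" "\<And>\<theta>. \<theta> \<in> \<Theta> \<Longrightarrow> of_int (q \<theta>) \<le> Q"
      "\<And>\<theta>. \<theta> \<in> \<Theta> \<Longrightarrow> \<bar>of_int (q \<theta>) * \<theta> - of_int (a \<theta>)\<bar> < 1 / B"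
  shows "(\<Sum>\<theta>\<in>\<Theta>. 1 / of_int (q \<theta>)) \<le> 4 * M / B * (1 + ln Q) + 2 * Q"
proof -
  define n where "n = nat \<lfloor>Q\<rfloor>"
  have n: "n \<ge> 1" "real n \<le> Q" using Q by (auto simp: n_def le_nat_iff)
  define T where "T k = {\<theta> \<in> \<Theta>. q \<theta> = int k}" for k
  have cardT: "real (card (T k)) \<le> 4 * M / B + 2 * real k" if k: "k \<ge> 1" for k
  proof -
    define C where "C j = {\<theta> \<in> \<Theta>. \<bar>\<theta> - real j / real k\<bar> \<le> 1 / (real k * B)}" for j :: nat
    have C: "finite (C j)" "real (card (C j)) \<le> 2 * (1 / (real k * B)) * M + 1" for j
      by (rule card_grid_interval[OF \<Theta>(4), of _ _ \<phi> "real j / real k"]; use \<Theta> B in \<open>auto simp: C_def\<close>)+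
    have "T k \<subseteq> (\<Union>j\<in>{..k}. C j)"
    proof
      fix \<theta> assume "\<theta> \<in> T k"
      then have \<theta>: "\<theta> \<in> \<Theta>" "q \<theta> = int k" by (auto simp: T_def)
      have lt: "\<bar>real k * \<theta> - of_int (a \<theta>)\<bar> < 1 / B" using q(3)[OF \<theta>(1)] \<theta>(2) by simp
      have B1: "1 / B \<le> 1" using B by simp
      have \<theta>01: "0 \<le> \<theta>" "\<theta> < 1" using \<theta>(1) \<Theta>(2) by auto
      have "0 \<le> real k * \<theta>" "real k * \<theta> < real k" using \<theta>01 k by auto
      with lt B1 have "real_of_int (a \<theta>) > -1" "real_of_int (a \<theta>) < real k + 1" by linarith+
      then have "0 \<le> a \<theta>" "a \<theta> \<le> int k" by linarith+
      then obtain j where j: "a \<theta> = int j" "j \<le> k" by (metis nat_le_iff nonneg_int_cases of_nat_le_iff)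
      have "real k * (\<theta> - real j / real k) = real k * \<theta> - of_int (a \<theta>)" using k j(1) by (simp add: algebra_simps)
      then have "real k * \<bar>\<theta> - real j / real k\<bar> \<le> 1 / B"
        using lt by (metis abs_mult abs_of_nat less_imp_le)
      moreover have "x \<le> 1 / (real k * B)" if "real k * x \<le> 1 / B" for x
        using that k B by (simp add: field_simps)
      ultimately have "\<theta> \<in> C j" using \<theta>(1) by (simp add: C_def)
      with j(2) show "\<theta> \<in> (\<Union>j\<in>{..k}. C j)" by blast
    qed
    then have "card (T k) \<le> card (\<Union>j\<in>{..k}. C j)" using C(1) by (intro card_mono) auto
    also have "\<dots> \<le> (\<Sum>j\<in>{..k}. card (C j))" by (rule card_UN_le) simp
    finally have "real (card (T k)) \<le> (\<Sum>j\<in>{..k}. real (card (C j)))" unfolding of_nat_sum[symmetric] by (rule of_nat_mono)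
    also have "\<dots> \<le> (\<Sum>j\<in>{..k}. 2 * (1 / (real k * B)) * M + 1)" by (intro sum_mono C)
    also have "\<dots> = (real k + 1) * (2 * M / (real k * B) + 1)" by simp
    also have "\<dots> \<le> (2 * real k) * (2 * M / (real k * B) + 1)" using k B \<Theta>(4) by (intro mult_right_mono) auto
    also have "\<dots> = 4 * M / B + 2 * real k" using k B by (simp add: field_simps)
    finally show ?thesis .
  qed
  have "\<Theta> \<subseteq> (\<Union>k\<in>{1..n}. T k)"
  proof
    fix \<theta> assume \<theta>: "\<theta> \<in> \<Theta>"
    then obtain k where k: "q \<theta> = int k" "k \<ge> 1" using q(1)[OF \<theta>]
      by (metis One_nat_def Suc_leI of_nat_0_less_iff zero_less_imp_eq_int)
    have "real k \<le> Q" using q(2)[OF \<theta>] k by simp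
    then have "k \<le> n" unfolding n_def by (simp add: le_nat_floor)
    with k \<theta> show "\<theta> \<in> (\<Union>k\<in>{1..n}. T k)" by (auto simp: T_def)
  qed
  moreover have "(\<Union>k\<in>{1..n}. T k) \<subseteq> \<Theta>" by (auto simp: T_def)
  ultimately have eq: "\<Theta> = (\<Union>k\<in>{1..n}. T k)" by (rule equalityI)
  have "(\<Sum>\<theta>\<in>\<Theta>. 1 / of_int (q \<theta>)) = (\<Sum>k=1..n. \<Sum>\<theta>\<in>T k. 1 / of_int (q \<theta>))"
    by (subst eq, rule sum.UNION_disjoint) (use \<Theta>(1) in \<open>auto simp: T_def\<close>)
  also have "\<dots> = (\<Sum>k=1..n. real (card (T k)) * (1 / real k))" by (intro sum.cong refl) (simp add: T_def)
  also have "\<dots> \<le> (\<Sum>k=1..n. (4 * M / B + 2 * real k) * (1 / real k))"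
    by (intro sum_mono mult_right_mono cardT) auto
  also have "\<dots> = (\<Sum>k=1..n. 4 * M / B * (1 / real k) + 2)"
    by (intro sum.cong refl) (simp add: field_simps)
  also have "\<dots> = 4 * M / B * (\<Sum>k=1..n. 1 / real k) + 2 * real n"
    by (simp add: sum.distrib sum_distrib_left)
  also have "\<dots> \<le> 4 * M / B * (1 + ln Q) + 2 * Q"
  proof (intro add_mono mult_left_mono)
    show "(\<Sum>k=1..n. 1 / real k) \<le> 1 + ln Q" using harm_le_ln[OF n(1)] n by (smt (verit) ln_mono of_nat_1 of_nat_le_iff)
  qed (use n B \<Theta>(4) in auto)
  finally show ?thesis .
qed

section \<open>Sizes and multiplicities of the vectors, and passage from the integral to
  grids\<close>

lemma sum_card_fibres_sq:
  assumes "finite A"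
  shows "(\<Sum>x\<in>g ` A. (card {p \<in> A. g p = x})\<^sup>2) = card {(p, p') \<in> A \<times> A. g p = g p'}"
proof -
  have "{(p, p') \<in> A \<times> A. g p = g p'} = Sigma A (\<lambda>p. {p' \<in> A. g p' = g p})" by auto
  then have "card {(p, p') \<in> A \<times> A. g p = g p'} = (\<Sum>p\<in>A. card {p' \<in> A. g p' = g p})"
    using assms by (simp add: card_SigmaI)
  also have "\<dots> = (\<Sum>x\<in>g ` A. \<Sum>p\<in>{p \<in> A. g p = x}. card {p' \<in> A. g p' = g p})"
    by (rule sum.image_gen[OF assms])
  also have "\<dots> = (\<Sum>x\<in>g ` A. (card {p \<in> A. g p = x})\<^sup>2)"
    by (intro sum.cong refl) (simp add: power2_eq_square)
  finally show ?thesis by simp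
qed

lemma abs_entry_le_frob_norm: "\<bar>real_of_int (A$i$j)\<bar> \<le> frob_norm A"
proof -
  have "(A$i$j)\<^sup>2 \<le> nsq A"
    using exhaust_2[of i] exhaust_2[of j] by (auto simp: nsq_def)
  then have "real_of_int ((A$i$j)\<^sup>2) \<le> of_int (nsq A)" by (simp only: of_int_le_iff)
  then have "\<bar>real_of_int (A$i$j)\<bar>\<^sup>2 \<le> (frob_norm A)\<^sup>2" by (simp add: frob_norm_sq)
  then show ?thesis by (rule power2_le_imp_le) simp
qed

lemma abs_comb_le: "\<bar>x\<bar> \<le> f \<Longrightarrow> \<bar>y\<bar> \<le> f \<Longrightarrow> \<bar>x * a + y * b\<bar> \<le> (\<bar>a\<bar> + \<bar>b\<bar>) * (f::real)"
proof -
  assume *: "\<bar>x\<bar> \<le> f" "\<bar>y\<bar> \<le> f"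
  have "\<bar>x * a + y * b\<bar> \<le> \<bar>x\<bar> * \<bar>a\<bar> + \<bar>y\<bar> * \<bar>b\<bar>" using abs_triangle_ineq[of "x * a" "y * b"] by (simp add: abs_mult)
  also have "\<dots> \<le> f * \<bar>a\<bar> + f * \<bar>b\<bar>" using * by (intro add_mono mult_right_mono) auto
  finally show ?thesis by (simp add: algebra_simps)
qed

definition l1norm :: "int^2 \<Rightarrow> real" where "l1norm w = \<bar>of_int (w$1)\<bar> + \<bar>of_int (w$2)\<bar>"

lemma l1norm_ge_1: assumes "coprime (w$1) (w$2)" shows "l1norm w \<ge> 1"
proof -
  have "w$1 \<noteq> 0 \<or> w$2 \<noteq> 0" using assms by auto
  then have "\<bar>w$1\<bar> + \<bar>w$2\<bar> \<ge> 1" by linarith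
  then have "real_of_int (\<bar>w$1\<bar> + \<bar>w$2\<bar>) \<ge> 1" by linarith
  then show ?thesis by (simp add: l1norm_def)
qed

lemma vmax_mult_vec_le: "of_int (vmax (A *v w)) \<le> l1norm w * frob_norm A"
proof -
  have "\<bar>real_of_int ((A *v w)$i)\<bar> \<le> l1norm w * frob_norm A" for i
    using exhaust_2[of i] abs_comb_le[OF abs_entry_le_frob_norm[of A i 1] abs_entry_le_frob_norm[of A i 2], of
      "of_int (w$1)" "of_int (w$2)"]
    by (auto simp: l1norm_def)
  from this[of 1] this[of 2] show ?thesis by (simp add: vmax_def max_def)
qed

lemma abs_vec_mult_le: "\<bar>real_of_int ((v v* A)$i)\<bar> \<le> l1norm v * frob_norm A"
  using exhaust_2[of i] abs_comb_le[OF abs_entry_le_frob_norm[of A 1 i] abs_entry_le_frob_norm[of A 2 i], of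
    "of_int (v$1)" "of_int (v$2)"]
  by (auto simp: l1norm_def mult.commute)

lemma vsq_le_vmax: "vsq y \<le> 2 * (vmax y)\<^sup>2"
proof -
  have "(y$1)\<^sup>2 \<le> (vmax y)\<^sup>2" "(y$2)\<^sup>2 \<le> (vmax y)\<^sup>2"
    using vmax_ge[of y] by (auto simp: abs_le_square_iff[symmetric] vmax_def)
  then show ?thesis by (simp add: vsq_def)
qed

lemma coprime_mult_vec:
  fixes A :: "int^2^2"
  assumes "det A = 1" "coprime (w$1) (w$2)"
  shows "coprime ((A *v w)$1) ((A *v w)$2)"
proof (rule coprimeI)
  fix c assume c: "c dvd (A *v w)$1" "c dvd (A *v w)$2"
  have "w = adj2 A *v (A *v w)" using adj2_left[OF assms(1)] by (simp add: matrix_vector_mul_assoc)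
  then have "w$1 = A$2$2 * (A *v w)$1 - A$1$2 * (A *v w)$2" "w$2 = A$1$1 * (A *v w)$2 - A$2$1 * (A *v w)$1"
    by (metis (no_types) mult_vec22_nth adj2_nth mult_minus_left add.commute uminus_add_conv_diff)+
  then have "c dvd w$1" "c dvd w$2" using c by (metis dvd_diff dvd_mult)+
  then show "c dvd 1" using assms(2) by (meson coprime_common_divisor)
qed

lemma int_dot_mult:
  fixes g h :: "int^2^2"
  shows "int_dot (v v* (g ** h)) w = int_dot (v v* g) (h *v w)"
  by (simp add: int_dot_def sum_2 algebra_simps)

text \<open>Cutting [0, 1) into m intervals and translating all of them to [0, 1 / m) turns the
  integral into an integral over the shift u of sums over the grid with points u + k / m.\<close>

lemma set_integral_le_grid:
  fixes g :: "real \<Rightarrow> real" and m :: nat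
  assumes g: "\<And>\<theta>. g \<theta> \<ge> 0" and W: "W \<subseteq> {0..1}" and m: "m > 0" and B: "B \<ge> 0"
    and grid: "\<And>\<Theta> \<phi>. finite \<Theta> \<Longrightarrow> \<Theta> \<subseteq> {0..<1} \<Longrightarrow> \<Theta> \<subseteq> W \<Longrightarrow> \<Theta> \<subseteq> grid \<phi> (real m) \<Longrightarrow> (\<Sum>\<theta>\<in>\<Theta>. g \<theta>) \<le> B"
  shows "(LINT \<theta>:W|lborel. g \<theta>) \<le> B / real m"
proof -
  define F where "F \<theta> = indicator W \<theta> * g \<theta>" for \<theta>
  have LINT: "(LINT \<theta>:W|lborel. g \<theta>) = integral\<^sup>L lborel F"
    by (simp add: set_lebesgue_integral_def F_def[abs_def])
  show ?thesis
  proof (cases "integrable lborel F")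
    \<comment> \<open>A function that is not integrable has integral 0 by convention. In the other
      case integrability supplies measurability.\<close>
    case False
    then show ?thesis using B m by (simp add: LINT not_integrable_integral_eq)
  next
    case True
    note [measurable] = borel_measurable_integrable[OF True]
    define I where "I k = {real k / real m..<real (Suc k) / real m}" for k :: nat
    have pieces: "(\<Sum>k<m. indicator (I k) u) = (indicator {0..<1} u :: real)" for u
    proof -
      have "(\<Sum>k<j. indicator (I k) u) = (indicator {0..<real j / real m} u :: real)" for j
      proof (induction j)
        case (Suc j)
        have "indicator {d..<e} u + indicator {0..<d} u = (indicator {0..<e} u :: real)" if "0 \<le> d" "d \<le> e"
          for d e :: real
          using that by (auto simp: indicator_def)
        from this[of "real j / real m" "real (Suc j) / real m"] show ?case
          using Suc by (simp add: I_def divide_right_mono add.commute)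
      qed simp
      from this[of m] show ?thesis using m by simp
    qed
    have int: "integrable lborel (\<lambda>u. indicator A u *\<^sub>R F u)" if "A \<in> sets borel" for A
      using True that by (intro integrable_mult_indicator) auto
    have shift: "integrable lborel (\<lambda>u. indicator {0..<1 / real m} u * F (real k / real m + 1 * u))" for k :: nat
    proof -
      have "integrable lborel (\<lambda>u. indicator (I k) (real k / real m + 1 * u) *\<^sub>R F (real k / real m + 1 * u))"
      proof (rule lborel_integrable_real_affine[of "\<lambda>u. indicator (I k) u *\<^sub>R F u" 1])
        show "integrable lborel (\<lambda>u. indicator (I k) u *\<^sub>R F u)" by (rule int) (simp add: I_def)
      qed simp
      moreover have "indicator (I k) (real k / real m + 1 * u) *\<^sub>R F (real k / real m + 1 * u)
          = indicator {0..<1 / real m} u * F (real k / real m + 1 * u)" for u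
        by (auto simp: I_def indicator_def add_divide_distrib)
      ultimately show ?thesis by (simp only:)
    qed
    \<comment> \<open>The endpoint 1 has measure 0; dropping it puts the grid points into [0,
      1).\<close>
    have "AE u in lborel. F u = indicator {0..<1} u * F u"
    proof -
      have "F u = indicator {0..<1} u * F u" if "u \<noteq> 1" for u
        using W that by (cases "u \<in> W") (fastforce simp: F_def indicator_def)+
      then show ?thesis by (intro AE_mp[OF AE_lborel_singleton[of 1] AE_I2]) blast
    qed
    then have "integral\<^sup>L lborel F = (\<integral>u. indicator {0..<1} u * F u \<partial>lborel)"
      by (intro integral_cong_AE) auto
    also have "\<dots> = (\<integral>u. (\<Sum>k<m. indicator (I k) u *\<^sub>R F u) \<partial>lborel)"
      by (simp only: pieces[symmetric] sum_distrib_right real_scaleR_def)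
    also have "\<dots> = (\<Sum>k<m. \<integral>u. indicator (I k) u *\<^sub>R F u \<partial>lborel)"
      by (intro Bochner_Integration.integral_sum int) (simp add: I_def)
    also have "\<dots> = (\<Sum>k<m. \<integral>u. indicator {0..<1 / real m} u * F (real k / real m + 1 * u) \<partial>lborel)"
    proof (rule sum.cong[OF refl])
      fix k
      have "(\<integral>u. indicator (I k) u *\<^sub>R F u \<partial>lborel)
          = (\<integral>u. indicator (I k) (real k / real m + 1 * u) *\<^sub>R F (real k / real m + 1 * u) \<partial>lborel)"
        using lborel_integral_real_affine[of 1 "\<lambda>u. indicator (I k) u *\<^sub>R F u" "real k / real m"] by simp
      also have "\<dots> = (\<integral>u. indicator {0..<1 / real m} u * F (real k / real m + 1 * u) \<partial>lborel)"
        by (intro Bochner_Integration.integral_cong) (auto simp: I_def indicator_def add_divide_distrib)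
      finally show "(\<integral>u. indicator (I k) u *\<^sub>R F u \<partial>lborel)
          = (\<integral>u. indicator {0..<1 / real m} u * F (real k / real m + 1 * u) \<partial>lborel)" .
    qed
    also have "\<dots> = (\<integral>u. (\<Sum>k<m. indicator {0..<1 / real m} u * F (real k / real m + 1 * u)) \<partial>lborel)"
      by (intro Bochner_Integration.integral_sum[symmetric] shift)
    also have "\<dots> \<le> (\<integral>u. B * indicator {0..<1 / real m} u \<partial>lborel)"
    proof (rule integral_mono)
      show "integrable lborel (\<lambda>u. \<Sum>k<m. indicator {0..<1 / real m} u * F (real k / real m + 1 * u))"
        by (intro Bochner_Integration.integrable_sum shift)
      show "integrable lborel (\<lambda>u. B * indicator {0..<1 / real m} u :: real)"
        by (intro integrable_mult_right integrable_real_indicator) auto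
      fix u :: real
      show "(\<Sum>k<m. indicator {0..<1 / real m} u * F (real k / real m + 1 * u)) \<le> B * indicator {0..<1 / real m} u"
      proof (cases "u \<in> {0..<1 / real m}")
        case True
        define t where "t k = real k / real m + u" for k :: nat
        have inj: "inj_on t A" for A using m by (auto simp: inj_on_def t_def)
        let ?\<Theta> = "t ` {k. k < m \<and> t k \<in> W}"
        have t01: "0 \<le> t k" "t k < 1" if "k < m" for k
        proof -
          have "real k / real m + 1 / real m \<le> 1"
            using that m by (simp add: add_divide_distrib[symmetric])
          then show "t k < 1" using True by (simp add: t_def)
          show "0 \<le> t k" using True by (simp add: t_def)
        qed
        have tg: "t k \<in> grid u (real m)" for k
          unfolding grid_def t_def by (rule image_eqI[of _ _ "int k"]) simp_all
        have "(\<Sum>k<m. indicator {0..<1 / real m} u * F (real k / real m + 1 * u)) = (\<Sum>k<m. if t k \<in> W then g (t k) else 0)"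
          using True by (intro sum.cong refl) (simp add: F_def t_def indicator_def)
        also have "\<dots> = (\<Sum>k\<in>{k. k < m \<and> t k \<in> W}. g (t k))"
          by (simp add: sum.inter_filter[symmetric] lessThan_def)
        also have "\<dots> = (\<Sum>\<theta>\<in>?\<Theta>. g \<theta>)" by (simp add: sum.reindex[OF inj])
        also have "\<dots> \<le> B" using t01 tg by (intro grid[of _ u]) auto
        finally have "(\<Sum>k<m. indicator {0..<1 / real m} u * F (real k / real m + 1 * u)) \<le> B" .
        moreover have "B * indicator {0..<1 / real m} u = B" using True by simp
        ultimately show ?thesis by (simp only:)
      qed simp
    qed
    also have "\<dots> = B / real m" using m by simp
    finally show ?thesis by (simp only: LINT)
  qed
qed

context free_nonparabolic
begin

lemma frob_norm_le_vmax:
  assumes "coprime (w$1) (w$2)"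
  obtains C where "C > 0" "\<And>\<gamma>. \<gamma> \<in> \<Gamma> \<Longrightarrow> frob_norm \<gamma> \<le> C * of_int (vmax (\<gamma> *v w))"
proof -
  obtain C where C: "C > 0" "\<And>\<gamma>. \<gamma> \<in> \<Gamma> \<Longrightarrow> nsq \<gamma> \<le> C * vsq (\<gamma> *v w)"
    using column_bound[OF assms] by blast
  define D where "D = sqrt (real_of_int (2 * C))"
  have "frob_norm \<gamma> \<le> D * of_int (vmax (\<gamma> *v w))" if \<gamma>: "\<gamma> \<in> \<Gamma>" for \<gamma>
  proof -
    have v: "vmax (\<gamma> *v w) \<ge> 0" by (simp add: vmax_def)
    have "nsq \<gamma> \<le> C * (2 * (vmax (\<gamma> *v w))\<^sup>2)"
      using C vsq_le_vmax by (meson \<gamma> mult_left_mono order_trans less_imp_le)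
    then have "real_of_int (nsq \<gamma>) \<le> real_of_int (2 * C * (vmax (\<gamma> *v w))\<^sup>2)" by (simp only: of_int_le_iff)
    then have "frob_norm \<gamma> \<le> sqrt (real_of_int (2 * C * (vmax (\<gamma> *v w))\<^sup>2))"
      unfolding frob_norm_eq_sqrt by (rule real_sqrt_le_mono)
    also have "\<dots> = D * of_int (vmax (\<gamma> *v w))" using v by (simp add: D_def real_sqrt_mult)
    finally show ?thesis .
  qed
  moreover have "D > 0" using C(1) by (simp add: D_def)
  ultimately show ?thesis using that by blast
qed

text \<open>Summation of \<open>card_torus_close_pairs\<close> over y = \<omega> w. For most terms
  the size of \<open>P\<close> is enough. The term q r Y / \<open>vmax y\<close> is averaged:
  \<open>vmax y\<close> is at least of order |\<omega>|, and 1 / |\<omega>| \<le> Y^(2 s - 1)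
  |\<omega>|^(-2 s) for s > 1/2, so the Poincare series saves a full factor Y.\<close>

lemma row_bound:
  assumes Z: "\<And>F. finite F \<Longrightarrow> F \<subseteq> \<Gamma> \<Longrightarrow> (\<Sum>\<gamma>\<in>F. frob_norm \<gamma> powr (- 2 * s)) \<le> Z"
    and "Z > 0" "s > 1 / 2" and w: "coprime (w$1) (w$2)"
  obtains C where "C > 0" "\<And>P Y \<Theta> \<phi> M r K q a \<theta>. P \<subseteq> \<Gamma> \<Longrightarrow> (\<And>\<omega>. \<omega> \<in> P \<Longrightarrow> frob_norm \<omega> < Y) \<Longrightarrow> Y \<ge> 1 \<Longrightarrow>
    finite \<Theta> \<Longrightarrow> \<Theta> \<subseteq> {0..<1} \<Longrightarrow> \<Theta> \<subseteq> grid \<phi> M \<Longrightarrow> M > 0 \<Longrightarrow>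
    r > 0 \<Longrightarrow> 4 * r * (l1norm w * Y) < 1 \<Longrightarrow> l1norm w * Y \<le> K * (r * M) \<Longrightarrow> K > 0 \<Longrightarrow>
    q > 0 \<Longrightarrow> coprime a q \<Longrightarrow> \<bar>of_int q * \<theta> - of_int a\<bar> \<le> 1 / of_int q \<Longrightarrow>
    (\<Sum>y\<in>(\<lambda>\<omega>. \<omega> *v w) ` P. real (card {(y', \<theta>') \<in> ((\<lambda>\<omega>. \<omega> *v w) ` P) \<times> \<Theta>. torus_close r y \<theta> y' \<theta>'}))
      \<le> C * (8 + 2 * K) * (1 + ln Y) * (r * M) * Y powr (2 * s) * (1 + Y / of_int q + r * Y\<^sup>2 + of_int q * r)"
proof -
  obtain C0 where C0: "C0 > 0" "\<And>\<gamma>. \<gamma> \<in> \<Gamma> \<Longrightarrow> frob_norm \<gamma> \<le> C0 * of_int (vmax (\<gamma> *v w))"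
    using frob_norm_le_vmax[OF w] by blast
  define cw where "cw = l1norm w"
  have cw: "cw \<ge> 1" unfolding cw_def by (rule l1norm_ge_1[OF w])
  define C where "C = (2 + 2 * ln cw) * 192 * Z * (2 + 3 * cw + 6 * cw\<^sup>2 + 3 * cw * C0)"
  have lncw: "ln cw \<ge> 0" using cw by simp
  have main: "(\<Sum>y\<in>V. real (card {(y', \<theta>') \<in> V \<times> \<Theta>. torus_close r y \<theta> y' \<theta>'}))
      \<le> C * (8 + 2 * K) * (1 + ln Y) * (r * M) * Y powr (2 * s) * (1 + Y / of_int q + r * Y\<^sup>2 + of_int q * r)"
    if P: "P \<subseteq> \<Gamma>" "\<And>\<omega>. \<omega> \<in> P \<Longrightarrow> frob_norm \<omega> < Y" and Y: "Y \<ge> 1"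
      and \<Theta>: "finite \<Theta>" "\<Theta> \<subseteq> {0..<1}" "\<Theta> \<subseteq> grid \<phi> M" "M > 0"
      and r: "r > 0" "4 * r * (cw * Y) < 1" "cw * Y \<le> K * (r * M)" "K > 0"
      and q: "q > 0" "coprime a q" "\<bar>of_int q * \<theta> - of_int a\<bar> \<le> 1 / of_int q"
      and V: "V = (\<lambda>\<omega>. \<omega> *v w) ` P"
    for P Y \<Theta> \<phi> M r K q a \<theta> V
  proof -
    let ?q = "real_of_int q"
    have qp: "?q > 0" using q(1) by simp
    have finP: "finite P" by (rule finite_subset[OF _ finite_frob_norm_le[of Y]]) (use P(2) in \<open>auto intro: less_imp_le\<close>)
    have finV: "finite V" using finP by (simp add: V)
    have Vc: "coprime (y$1) (y$2)" and Vle: "of_int (vmax y) \<le> cw * Y" if yV: "y \<in> V" for y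
    proof -
      obtain \<omega> where \<omega>: "\<omega> \<in> P" "y = \<omega> *v w" using yV V by blast
      show "coprime (y$1) (y$2)" unfolding \<omega>(2) by (rule coprime_mult_vec[OF \<Gamma>_det w]) (use \<omega>(1) P(1) in blast)
      have "of_int (vmax y) \<le> cw * frob_norm \<omega>" unfolding \<omega>(2) cw_def by (rule vmax_mult_vec_le)
      also have "\<dots> \<le> cw * Y" using cw P(2)[OF \<omega>(1)] by (intro mult_left_mono) auto
      finally show "of_int (vmax y) \<le> cw * Y" .
    qed
    have cardP: "real (card P) \<le> Z * Y powr (2 * s)"
      by (rule card_le_of_poincare[OF Z _ P(1)]) (use P(2) Y assms(3) in \<open>auto intro: less_imp_le\<close>)
    have cardV: "real (card V) \<le> Z * Y powr (2 * s)" using cardP card_image_le[OF finP, of "\<lambda>\<omega>. \<omega> *v w"] V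
      by (simp add: order_trans[OF of_nat_mono])
    have sumV: "(\<Sum>y\<in>V. 1 / real_of_int (vmax y)) \<le> C0 * (Y powr (2 * s - 1) * Z)"
    proof -
      have vpos: "real_of_int (vmax (\<omega> *v w)) \<ge> 1" if "\<omega> \<in> P" for \<omega>
        using vmax_ge_1[OF Vc[of "\<omega> *v w"]] that V by simp
      have "(\<Sum>y\<in>V. 1 / real_of_int (vmax y)) \<le> (\<Sum>\<omega>\<in>P. 1 / real_of_int (vmax (\<omega> *v w)))"
        unfolding V using sum_image_le[OF finP, of "\<lambda>y. 1 / real_of_int (vmax y)" "\<lambda>\<omega>. \<omega> *v w"] vpos
        by (force simp: comp_def)
      also have "\<dots> \<le> (\<Sum>\<omega>\<in>P. C0 * (Y powr (2 * s - 1) * frob_norm \<omega> powr (- 2 * s)))"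
      proof (rule sum_mono)
        fix \<omega> assume \<omega>: "\<omega> \<in> P"
        have \<omega>\<Gamma>: "\<omega> \<in> \<Gamma>" using \<omega> P(1) by blast
        have f: "frob_norm \<omega> > 0" by (rule frob_norm_pos[OF \<Gamma>_det[OF \<omega>\<Gamma>]])
        have "1 / real_of_int (vmax (\<omega> *v w)) \<le> C0 * (1 / frob_norm \<omega>)"
          using C0(2)[OF \<omega>\<Gamma>] f vpos[OF \<omega>] by (simp add: field_simps)
        also have "1 / frob_norm \<omega> = frob_norm \<omega> powr (2 * s - 1) * frob_norm \<omega> powr (- 2 * s)"
        proof -
          have "frob_norm \<omega> powr (2 * s - 1) * frob_norm \<omega> powr (- 2 * s) = frob_norm \<omega> powr (-1)"
            by (simp flip: powr_add)
          then show ?thesis using f by (simp add: powr_minus_divide)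
        qed
        also have "C0 * (frob_norm \<omega> powr (2 * s - 1) * frob_norm \<omega> powr (- 2 * s))
            \<le> C0 * (Y powr (2 * s - 1) * frob_norm \<omega> powr (- 2 * s))"
          using C0(1) f P(2)[OF \<omega>] assms(3) by (intro mult_left_mono mult_right_mono powr_mono2) auto
        finally show "1 / real_of_int (vmax (\<omega> *v w)) \<le> C0 * (Y powr (2 * s - 1) * frob_norm \<omega> powr (- 2 * s))" .
      qed
      also have "\<dots> = C0 * (Y powr (2 * s - 1) * (\<Sum>\<omega>\<in>P. frob_norm \<omega> powr (- 2 * s)))"
        unfolding sum_distrib_left ..
      also have "\<dots> \<le> C0 * (Y powr (2 * s - 1) * Z)" using C0(1) by (intro mult_left_mono Z finP P(1)) auto
      finally show ?thesis .
    qed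
    define A where "A = 192 * (8 + 2 * K) * (r * M)"
    have A: "A \<ge> 0" using r \<Theta>(4) by (simp add: A_def)
    have lnY: "1 + 2 * ln (cw * Y) \<le> (2 + 2 * ln cw) * (1 + ln Y)"
    proof -
      have "ln (cw * Y) = ln cw + ln Y" using cw Y by (simp add: ln_mult)
      moreover have "0 \<le> ln cw * ln Y" using lncw Y by simp
      ultimately show ?thesis using Y by (simp add: algebra_simps)
    qed
    let ?B = "2 + 3 * (cw * Y) / ?q + 6 * r * (cw * Y)\<^sup>2"
    have B0: "?B \<ge> 0" using cw Y qp r(1) by simp
    have "(\<Sum>y\<in>V. real (card {(y', \<theta>') \<in> V \<times> \<Theta>. torus_close r y \<theta> y' \<theta>'}))
        \<le> (\<Sum>y\<in>V. (1 + 2 * ln (cw * Y)) * (A * (2 + 3 * (cw * Y) / ?q + 3 * ?q * r * (cw * Y) / of_int (vmax y) + 6 *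
          r * (cw * Y)\<^sup>2)))"
      unfolding A_def by (intro sum_mono card_torus_close_pairs[where \<phi> = \<phi> and a = a] finV Vc Vle \<Theta> r q)
    also have "\<dots> = (\<Sum>y\<in>V. (1 + 2 * ln (cw * Y)) * A * ?B + (1 + 2 * ln (cw * Y)) * A * (3 * ?q * r * (cw * Y)) *
      (1 / of_int (vmax y)))"
    proof (rule sum.cong[OF refl])
      fix y
      have alg: "L * (A * (b1 + b2 + b3 / v + b4)) = L * A * (b1 + b2 + b4) + L * A * b3 * (1 / v)"
        for L b1 b2 b3 b4 v :: real
        by (simp add: algebra_simps)
      show "(1 + 2 * ln (cw * Y)) * (A * (2 + 3 * (cw * Y) / ?q + 3 * ?q * r * (cw * Y) / of_int (vmax y) + 6 * r *
        (cw * Y)\<^sup>2))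
        = (1 + 2 * ln (cw * Y)) * A * ?B + (1 + 2 * ln (cw * Y)) * A * (3 * ?q * r * (cw * Y)) * (1 / of_int (vmax y))"
        by (rule alg)
    qed
    also have "\<dots> = (1 + 2 * ln (cw * Y)) * A * (real (card V) * ?B + (3 * ?q * r * (cw * Y)) *
      (\<Sum>y\<in>V. 1 / of_int (vmax y)))"
    proof -
      have alg: "(\<Sum>y\<in>V. L * B + L * b * f y) = L * (real (card V) * B + b * (\<Sum>y\<in>V. f y))"
        for L B b :: real and f
        by (simp add: sum.distrib sum_distrib_left[symmetric] distrib_left)
      show ?thesis by (rule alg)
    qed
    also have "\<dots> \<le> ((2 + 2 * ln cw) * (1 + ln Y)) * A *
        ((Z * Y powr (2 * s)) * ?B + (3 * ?q * r * (cw * Y)) * (C0 * (Y powr (2 * s - 1) * Z)))"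
    proof -
      have c0: "0 \<le> 3 * ?q * r * (cw * Y)" using cw Y qp r(1) by simp
      have "0 \<le> 1 / real_of_int (vmax y)" for y by (simp add: vmax_def)
      then have S0: "0 \<le> (\<Sum>y\<in>V. 1 / real_of_int (vmax y))" by (intro sum_nonneg)
      show ?thesis
      proof (rule mult_mono)
        show "(1 + 2 * ln (cw * Y)) * A \<le> (2 + 2 * ln cw) * (1 + ln Y) * A"
          by (rule mult_right_mono[OF lnY A])
        show "real (card V) * ?B + (3 * ?q * r * (cw * Y)) * (\<Sum>y\<in>V. 1 / of_int (vmax y))
            \<le> (Z * Y powr (2 * s)) * ?B + (3 * ?q * r * (cw * Y)) * (C0 * (Y powr (2 * s - 1) * Z))"
          by (rule add_mono[OF mult_right_mono[OF cardV B0] mult_left_mono[OF sumV c0]])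
        show "0 \<le> (2 + 2 * ln cw) * (1 + ln Y) * A" using lncw ln_ge_zero[OF Y] A by (intro mult_nonneg_nonneg) auto
        show "0 \<le> real (card V) * ?B + (3 * ?q * r * (cw * Y)) * (\<Sum>y\<in>V. 1 / of_int (vmax y))"
          by (rule add_nonneg_nonneg[OF mult_nonneg_nonneg[OF of_nat_0_le_iff B0] mult_nonneg_nonneg[OF c0 S0]])
      qed
    qed
    also have "(3 * ?q * r * (cw * Y)) * (C0 * (Y powr (2 * s - 1) * Z))
      = (Z * Y powr (2 * s)) * (3 * cw * C0 * (?q * r))"
    proof -
      have "Y * Y powr (2 * s - 1) = Y powr (2 * s)" using Y by (simp add: powr_diff)
      then have "Z * Y powr (2 * s) = Z * (Y * Y powr (2 * s - 1))" by simp
      then show ?thesis by (simp only: mult_ac)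
    qed
    also have "(Z * Y powr (2 * s)) * ?B + (Z * Y powr (2 * s)) * (3 * cw * C0 * (?q * r))
        = (Z * Y powr (2 * s)) * (?B + 3 * cw * C0 * (?q * r))" by (simp add: distrib_left)
    also have "((2 + 2 * ln cw) * (1 + ln Y)) * A * ((Z * Y powr (2 * s)) * (?B + 3 * cw * C0 * (?q * r)))
        \<le> ((2 + 2 * ln cw) * (1 + ln Y)) * A * ((Z * Y powr (2 * s)) *
          ((2 + 3 * cw + 6 * cw\<^sup>2 + 3 * cw * C0) * (1 + Y / ?q + r * Y\<^sup>2 + ?q * r)))"
    proof (intro mult_left_mono)
      define c1 c2 c3 c4 where c: "c1 = (2::real)" "c2 = 3 * cw" "c3 = 6 * cw\<^sup>2" "c4 = 3 * cw * C0"
      define x2 x3 x4 where x: "x2 = Y / ?q" "x3 = r * Y\<^sup>2" "x4 = ?q * r"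
      have c0: "c1 \<ge> 0" "c2 \<ge> 0" "c3 \<ge> 0" "c4 \<ge> 0" using cw C0(1) by (simp_all add: c)
      have x0: "x2 \<ge> 0" "x3 \<ge> 0" "x4 \<ge> 0" using Y qp r(1) by (simp_all add: x)
      have "c1 + c2 * x2 + c3 * x3 + c4 * x4 \<le> (c1 + c2 + c3 + c4) * (1 + x2 + x3 + x4)"
      proof -
        have "(c1 + c2 + c3 + c4) * (1 + x2 + x3 + x4) = (c1 + c2 * x2 + c3 * x3 + c4 * x4)
          + (c1 * (x2 + x3 + x4) + c2 * (1 + x3 + x4) + c3 * (1 + x2 + x4) + c4 * (1 + x2 + x3))"
          by (simp add: algebra_simps)
        moreover have "0 \<le> c1 * (x2 + x3 + x4) + c2 * (1 + x3 + x4) + c3 * (1 + x2 + x4) + c4 * (1 + x2 + x3)"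
          using c0 x0 by (intro add_nonneg_nonneg mult_nonneg_nonneg) auto
        ultimately show ?thesis by linarith
      qed
      then show "?B + 3 * cw * C0 * (?q * r) \<le> (2 + 3 * cw + 6 * cw\<^sup>2 + 3 * cw * C0) * (1 + Y / ?q + r * Y\<^sup>2 + ?q * r)"
        unfolding c x by (simp add: power_mult_distrib mult_ac)
    qed (use assms(2) lncw A Y in auto)
    also have "\<dots> = C * (8 + 2 * K) * (1 + ln Y) * (r * M) * Y powr (2 * s) * (1 + Y / ?q + r * Y\<^sup>2 + ?q * r)"
      unfolding C_def A_def by (simp only: mult_ac)
    finally show ?thesis .
  qed
  have "C > 0" unfolding C_def using cw lncw C0(1) assms(2) by (intro mult_pos_pos add_pos_nonneg) auto
  with main show ?thesis unfolding cw_def by (intro that[of C]) blast+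
qed

end

section \<open>The mean square over a grid\<close>

lemma floor_half:
  fixes x :: real
  assumes "x \<ge> 1"
  shows "x / 2 \<le> real (nat \<lfloor>x\<rfloor>)"
proof -
  have "1 \<le> \<lfloor>x\<rfloor>" using assms by simp
  then have "real (nat \<lfloor>x\<rfloor>) = of_int \<lfloor>x\<rfloor>" "1 \<le> real_of_int \<lfloor>x\<rfloor>" by simp_all
  then show ?thesis using floor_correct[of x] by linarith
qed

context free_nonparabolic
begin

text \<open>The pairs (\<gamma>, \<xi>) are grouped by the vector v \<gamma> \<xi>, with
  multiplicity. The vectors \<omega> w are distinct by \<open>column_inj\<close> and have
  multiplicity 1.\<close>

lemma exp_sum_eq:
  fixes v w :: "int^2" and N \<sigma> :: real
  assumes "finite \<Xi>" "finite P" "P \<subseteq> \<Gamma>" "coprime (w$1) (w$2)"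
  defines "A \<equiv> {\<gamma>\<in>\<Gamma>. frob_norm \<gamma> < N powr \<sigma>} \<times> \<Xi>" and "g \<equiv> \<lambda>(\<gamma>, \<xi>). v v* (\<gamma> ** \<xi>)"
  shows "exp_sum \<Gamma> v w \<sigma> N \<Xi> P \<theta> = (\<Sum>x\<in>g ` A. of_real (real (card {p \<in> A. g p = x})) *
    (\<Sum>y\<in>(\<lambda>\<omega>. \<omega> *v w) ` P. unit_exp (of_int (int_dot x y) * \<theta>)))"
proof -
  let ?G = "{\<gamma>\<in>\<Gamma>. frob_norm \<gamma> < N powr \<sigma>}"
  define f where "f x = (\<Sum>y\<in>(\<lambda>\<omega>. \<omega> *v w) ` P. unit_exp (of_int (int_dot x y) * \<theta>))" for x
  have inj: "inj_on (\<lambda>\<omega>. \<omega> *v w) P"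
    using column_inj[OF _ _ _ assms(4)] assms(3) by (meson inj_onI subsetD)
  have f_eq: "f x = (\<Sum>\<omega>\<in>P. unit_exp (of_int (int_dot x (\<omega> *v w)) * \<theta>))" for x
    unfolding f_def by (subst sum.reindex[OF inj]) simp
  have finA: "finite A" unfolding A_def using finite_frob_norm_less assms(1) by (intro finite_cartesian_product) auto
  have "exp_sum \<Gamma> v w \<sigma> N \<Xi> P \<theta> = (\<Sum>\<xi>\<in>\<Xi>. \<Sum>\<omega>\<in>P. \<Sum>\<gamma>\<in>?G. unit_exp (of_int (int_dot (v v* (\<gamma> ** \<xi>)) (\<omega> *v w)) * \<theta>))"
    unfolding exp_sum_def int_dot_mult ..
  also have "\<dots> = (\<Sum>\<xi>\<in>\<Xi>. \<Sum>\<gamma>\<in>?G. \<Sum>\<omega>\<in>P. unit_exp (of_int (int_dot (v v* (\<gamma> ** \<xi>)) (\<omega> *v w)) * \<theta>))"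
    by (intro sum.cong refl sum.swap)
  also have "\<dots> = (\<Sum>\<gamma>\<in>?G. \<Sum>\<xi>\<in>\<Xi>. \<Sum>\<omega>\<in>P. unit_exp (of_int (int_dot (v v* (\<gamma> ** \<xi>)) (\<omega> *v w)) * \<theta>))"
    by (rule sum.swap)
  also have "\<dots> = (\<Sum>p\<in>A. f (g p))"
    unfolding A_def sum.cartesian_product' f_eq g_def by simp
  also have "\<dots> = (\<Sum>x\<in>g ` A. \<Sum>p\<in>{p \<in> A. g p = x}. f (g p))" by (rule sum.image_gen[OF finA])
  also have "\<dots> = (\<Sum>x\<in>g ` A. of_real (real (card {p \<in> A. g p = x})) * f x)"
    by (intro sum.cong refl) simp
  finally show ?thesis unfolding f_def .
qed

text \<open>The sum counts pairs with equal vectors v \<gamma> \<xi>. By \<open>row_inj\<close> the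
  products \<gamma> \<xi> are then equal, and the hypothesis on \<open>D\<close>, the conclusion of
  \<open>energy_bound\<close>, counts these.\<close>

lemma sum_multiplicity_sq_le:
  fixes v :: "int^2" and N \<sigma> s D :: real
  assumes D: "\<And>A B R1 R2. A \<subseteq> \<Gamma> \<Longrightarrow> B \<subseteq> \<Gamma> \<Longrightarrow> R1 \<ge> 1 \<Longrightarrow> R2 \<ge> 1 \<Longrightarrow>
    (\<And>a. a \<in> A \<Longrightarrow> frob_norm a < R1) \<Longrightarrow> (\<And>b. b \<in> B \<Longrightarrow> frob_norm b < R2) \<Longrightarrow>
    real (card {(a, b, a', b') \<in> A \<times> B \<times> A \<times> B. a ** b = a' ** b'})
      \<le> D * ((1 + ln R1) * (1 + ln R2)) * (R1 * R2) powr (2 * s)" "D > 0"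
    and \<Xi>: "\<Xi> \<subseteq> \<Gamma>" "\<And>\<xi>. \<xi> \<in> \<Xi> \<Longrightarrow> frob_norm \<xi> < N powr (1/2)" and v: "coprime (v$1) (v$2)"
    and N: "N \<ge> 1" and \<sigma>: "0 < \<sigma>" "\<sigma> < 1"
  defines "A \<equiv> {\<gamma>\<in>\<Gamma>. frob_norm \<gamma> < N powr \<sigma>} \<times> \<Xi>" and "g \<equiv> \<lambda>(\<gamma>, \<xi>). v v* (\<gamma> ** \<xi>)"
  shows "(\<Sum>x\<in>g ` A. (real (card {p \<in> A. g p = x}))\<^sup>2) \<le> D * (1 + ln N)\<^sup>2 * N powr (s * (1 + 2 * \<sigma>))"
proof -
  let ?G = "{\<gamma>\<in>\<Gamma>. frob_norm \<gamma> < N powr \<sigma>}"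
  let ?Q = "{(a, b, a', b') \<in> ?G \<times> \<Xi> \<times> ?G \<times> \<Xi>. a ** b = a' ** b'}"
  have fin\<Xi>: "finite \<Xi>"
    by (rule finite_subset[OF _ finite_frob_norm_le[of "N powr (1/2)"]]) (use \<Xi>(2) in \<open>auto intro: less_imp_le\<close>)
  have finG: "finite ?G" by (rule finite_frob_norm_less)
  have finA: "finite A" unfolding A_def using finG fin\<Xi> by simp
  have finQ: "finite ?Q"
    by (rule finite_subset[of _ "?G \<times> \<Xi> \<times> ?G \<times> \<Xi>"]) (use finG fin\<Xi> in auto)
  have "(\<Sum>x\<in>g ` A. (real (card {p \<in> A. g p = x}))\<^sup>2) = real (\<Sum>x\<in>g ` A. (card {p \<in> A. g p = x})\<^sup>2)"
    by simp
  also have "\<dots> = real (card {(p, p') \<in> A \<times> A. g p = g p'})" by (simp only: sum_card_fibres_sq[OF finA])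
  also have "\<dots> \<le> real (card ?Q)"
  proof (intro of_nat_mono card_inj_on_le[OF _ _ finQ])
    show "inj_on (\<lambda>((a, b), (a', b')). (a, b, a', b')) {(p, p') \<in> A \<times> A. g p = g p'}" by (auto intro: inj_onI)
    show "(\<lambda>((a, b), (a', b')). (a, b, a', b')) ` {(p, p') \<in> A \<times> A. g p = g p'} \<subseteq> ?Q"
    proof clarsimp
      fix a b a' b' assume ab: "(a, b) \<in> A" "(a', b') \<in> A" "g (a, b) = g (a', b')"
      have "a ** b \<in> \<Gamma>" "a' ** b' \<in> \<Gamma>" using ab(1,2) \<Xi>(1) by (auto simp: A_def intro!: \<Gamma>_mult)
      then have "a ** b = a' ** b'" using ab(3) v by (intro row_inj[of _ _ v]) (auto simp: g_def)
      then show "a \<in> \<Gamma> \<and> frob_norm a < N powr \<sigma> \<and> b \<in> \<Xi> \<and> a' \<in> \<Gamma> \<and> frob_norm a' < N powr \<sigma> \<and> b' \<in> \<Xi> \<and> a ** b = a' ** b'"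
        using ab(1,2) by (simp add: A_def)
    qed
  qed
  also have "\<dots> \<le> D * ((1 + ln (N powr \<sigma>)) * (1 + ln (N powr (1/2)))) * (N powr \<sigma> * N powr (1/2)) powr (2 * s)"
    using \<Xi> N \<sigma> by (intro D) (auto simp: ge_one_powr_ge_zero)
  also have "(N powr \<sigma> * N powr (1/2)) powr (2 * s) = N powr (s * (1 + 2 * \<sigma>))"
    by (simp add: powr_powr algebra_simps flip: powr_add)
  also have "D * ((1 + ln (N powr \<sigma>)) * (1 + ln (N powr (1/2)))) * N powr (s * (1 + 2 * \<sigma>))
      \<le> D * ((1 + ln N) * (1 + ln N)) * N powr (s * (1 + 2 * \<sigma>))"
  proof -
    have "ln (N powr \<sigma>) \<le> ln N" "0 \<le> ln (N powr \<sigma>)" "ln (N powr (1/2)) \<le> ln N" "0 \<le> ln (N powr (1/2))"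
      using N \<sigma> by (auto simp: ln_powr mult_left_le_one_le)
    then show ?thesis using D(2) by (intro mult_right_mono mult_left_mono mult_mono) auto
  qed
  finally show ?thesis by (simp add: power2_eq_square)
qed

text \<open>Approximations of order \<open>N powr (1 - 4 * \<sigma> / 3)\<close> make the sum of \<open>1 / q\<close> over \<open>\<Theta>\<close> about
  \<open>N powr (4 * \<sigma> / 3)\<close>. For \<open>q \<le> Q\<close> this loss is less than \<open>N powr (2 * \<delta> * \<sigma>)\<close>, and for \<open>q > Q\<close> the row sums of
  \<open>k\<close> are small enough for Schur's test.\<close>

lemma grid_bound:
  fixes v w :: "int^2"
  assumes dim: "hausdorff_dim (limit_set \<Gamma>) = ereal \<delta>" "\<delta> > 5 / 6"
    and vw: "coprime (v$1) (v$2)" "coprime (w$1) (w$2)" and \<sigma>: "0 < \<sigma>" "\<sigma> < 1 / 4"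
  obtains C where "C > 0" "\<forall>\<^sub>F N :: real in at_top. \<forall>\<Xi> P U \<Theta> \<phi>.
    \<Xi> \<subseteq> \<Gamma> \<longrightarrow> (\<forall>\<xi>\<in>\<Xi>. frob_norm \<xi> < N powr (1/2)) \<longrightarrow>
    P \<subseteq> \<Gamma> \<longrightarrow> (\<forall>\<omega>\<in>P. frob_norm \<omega> < N powr (1/2 - \<sigma>)) \<longrightarrow>
    finite \<Theta> \<longrightarrow> \<Theta> \<subseteq> {0..<1} \<longrightarrow> \<Theta> \<subseteq> grid \<phi> (real (nat \<lceil>N\<rceil>)) \<longrightarrow>
    (\<forall>\<theta>\<in>\<Theta>. cmod (exp_sum \<Gamma> v w \<sigma> N \<Xi> P \<theta>) \<le> U) \<longrightarrow> U \<ge> 0 \<longrightarrow>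
    (\<Sum>\<theta>\<in>\<Theta>. (cmod (exp_sum \<Gamma> v w \<sigma> N \<Xi> P \<theta>))\<^sup>2)
      \<le> C * (N * (N powr (\<delta> + \<delta> * \<sigma>) * U + N powr (2 * \<delta> + 1 - \<sigma>)))"
proof -
  \<comment> \<open>\<kappa> \<le> \<sigma> / 3 is used for q r \<le> t and for Q \<le> N^(4
    \<sigma> / 3), and \<kappa> \<le> 1/2 - 2 \<sigma> gives t \<ge> 1. The excess of s over
    \<delta> and the logarithms are paid from \<kappa>.\<close>
  define \<kappa> where "\<kappa> = min (\<sigma> / 3) (1 / 2 - 2 * \<sigma>)"
  have \<kappa>: "\<kappa> > 0" "\<kappa> \<le> \<sigma> / 3" "\<kappa> \<le> 1 / 2 - 2 * \<sigma>" using \<sigma> unfolding \<kappa>_def by linarith+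
  have "(INF s \<in> {s. 0 < s \<and> hausdorff_measure s (limit_set \<Gamma>) = 0}. ereal s) < ereal (\<delta> + \<kappa> / 4)"
    using dim(1) \<kappa> by (simp add: hausdorff_dim_def)
  then obtain s where s: "0 < s" "hausdorff_measure s (limit_set \<Gamma>) = 0" "s < \<delta> + \<kappa> / 4"
    unfolding INF_less_iff by auto
  have "hausdorff_dim (limit_set \<Gamma>) \<le> ereal s"
    unfolding hausdorff_dim_def using s by (intro INF_lower) auto
  then have s\<delta>: "\<delta> \<le> s" using dim(1) by simp
  obtain Z where Z: "Z > 0"
    "\<And>F. finite F \<Longrightarrow> F \<subseteq> \<Gamma> \<Longrightarrow> (\<Sum>\<gamma>\<in>F. frob_norm \<gamma> powr (- 2 * s)) \<le> Z"
    using poincare_series_bounded[OF s(1,2)] by blast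
  obtain D where D: "D > 0" "\<And>A B R1 R2. A \<subseteq> \<Gamma> \<Longrightarrow> B \<subseteq> \<Gamma> \<Longrightarrow> R1 \<ge> 1 \<Longrightarrow> R2 \<ge> 1 \<Longrightarrow>
    (\<And>a. a \<in> A \<Longrightarrow> frob_norm a < R1) \<Longrightarrow> (\<And>b. b \<in> B \<Longrightarrow> frob_norm b < R2) \<Longrightarrow>
    real (card {(a, b, a', b') \<in> A \<times> B \<times> A \<times> B. a ** b = a' ** b'})
      \<le> D * ((1 + ln R1) * (1 + ln R2)) * (R1 * R2) powr (2 * s)"
    using energy_bound[OF Z(2) Z(1) s(1)] by blast
  have "s > 1 / 2" using s\<delta> dim(2) by simp
  obtain C1 where C1: "C1 > 0" "\<And>P Y \<Theta> \<phi> M r K q a \<theta>. P \<subseteq> \<Gamma> \<Longrightarrow> (\<And>\<omega>. \<omega> \<in> P \<Longrightarrow> frob_norm \<omega> < Y) \<Longrightarrow> Y \<ge> 1 \<Longrightarrow>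
    finite \<Theta> \<Longrightarrow> \<Theta> \<subseteq> {0..<1} \<Longrightarrow> \<Theta> \<subseteq> grid \<phi> M \<Longrightarrow> M > 0 \<Longrightarrow>
    r > 0 \<Longrightarrow> 4 * r * (l1norm w * Y) < 1 \<Longrightarrow> l1norm w * Y \<le> K * (r * M) \<Longrightarrow> K > 0 \<Longrightarrow>
    q > 0 \<Longrightarrow> coprime a q \<Longrightarrow> \<bar>of_int q * \<theta> - of_int a\<bar> \<le> 1 / of_int q \<Longrightarrow>
    (\<Sum>y\<in>(\<lambda>\<omega>. \<omega> *v w) ` P. real (card {(y', \<theta>') \<in> ((\<lambda>\<omega>. \<omega> *v w) ` P) \<times> \<Theta>. torus_close r y \<theta> y' \<theta>'}))
      \<le> C1 * (8 + 2 * K) * (1 + ln Y) * (r * M) * Y powr (2 * s) * (1 + Y / of_int q + r * Y\<^sup>2 + of_int q * r)"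
  proof (rule row_bound[OF Z(2) Z(1) \<open>s > 1 / 2\<close> vw(2)], goal_cases)
    case (3 C)
    show ?case by (rule 3(1)[OF 3(2,3)])
  qed
  define cv cw where "cv = l1norm v" "cw = l1norm w"
  note c_def = this
  have c: "cv \<ge> 1" "cw \<ge> 1" unfolding c_def using vw by (auto intro: l1norm_ge_1)
  define K where "K = 3 * cv * cw"
  have K: "K > 0" using c by (simp add: K_def)
  define R where "R = C1 * (8 + 2 * K)"
  have R: "R > 0" using C1(1) K by (simp add: R_def)
  define C2 where "C2 = D * (144 * cv\<^sup>2) * (4 * R)"
  have C2: "C2 > 0" using D(1) c R by (simp add: C2_def)
  define C where "C = C2 + sqrt (18 * C2)"
  have C: "C > 0" using C2 by (simp add: C_def add_pos_pos)
  have ev1: "\<forall>\<^sub>F N :: real in at_top. (1 + ln N) ^ 4 \<le> N powr (\<kappa> / 4)" using \<kappa>(1) by real_asymp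
  have ev2: "\<forall>\<^sub>F N :: real in at_top. 4 * cw / (3 * cv) * N powr (- 2 * \<sigma>) < 1"
  proof -
    have "4 * cw / (3 * cv) > 0" using c by simp
    then show ?thesis using \<sigma>(1) by real_asymp
  qed
  have ev3: "\<forall>\<^sub>F N :: real in at_top. N \<ge> 1" by (rule eventually_ge_at_top)
  have main: "(\<Sum>\<theta>\<in>\<Theta>. (cmod (exp_sum \<Gamma> v w \<sigma> N \<Xi> P \<theta>))\<^sup>2)
      \<le> C * (N * (N powr (\<delta> + \<delta> * \<sigma>) * U + N powr (2 * \<delta> + 1 - \<sigma>)))"
    if N: "(1 + ln N) ^ 4 \<le> N powr (\<kappa> / 4)" "4 * cw / (3 * cv) * N powr (- 2 * \<sigma>) < 1" "N \<ge> 1"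
      and \<Xi>: "\<Xi> \<subseteq> \<Gamma>" "\<And>\<xi>. \<xi> \<in> \<Xi> \<Longrightarrow> frob_norm \<xi> < N powr (1/2)"
      and P: "P \<subseteq> \<Gamma>" "\<And>\<omega>. \<omega> \<in> P \<Longrightarrow> frob_norm \<omega> < N powr (1/2 - \<sigma>)"
      and \<Theta>: "finite \<Theta>" "\<Theta> \<subseteq> {0..<1}" "\<Theta> \<subseteq> grid \<phi> (real (nat \<lceil>N\<rceil>))"
      and U: "\<And>\<theta>. \<theta> \<in> \<Theta> \<Longrightarrow> cmod (exp_sum \<Gamma> v w \<sigma> N \<Xi> P \<theta>) \<le> U" "U \<ge> 0"
    for N :: real and \<Xi> P U \<Theta> \<phi>
  proof -
    define l where "l = 1 + ln N"
    have l: "l \<ge> 1" using N(3) by (simp add: l_def)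
    define M where "M = real (nat \<lceil>N\<rceil>)"
    have M: "N \<le> M" "M \<le> 2 * N" "M > 0" using N(3) by (simp_all add: M_def) linarith+
    define X Y where "X = N powr (1/2 + \<sigma>)" "Y = N powr (1/2 - \<sigma>)"
    note XY_def = this
    have X: "X \<ge> 1" and Y: "Y \<ge> 1" using N(3) \<sigma> by (auto simp: XY_def ge_one_powr_ge_zero)
    have NXY: "N = X * Y" using N(3) by (simp add: XY_def flip: powr_add)
    \<comment> \<open>The coordinates of x = v \<gamma> \<xi> are at most cv X in absolute value,
      and the large sieve asks for |x| h \<le> 1/6. The resulting r is of order 1 / X, so r M is of
      order Y.\<close>
    define h where "h = 1 / (6 * cv * X)"
    have cvX: "cv * X \<ge> 1" using c X mult_mono[of 1 cv 1 X] by simp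
    have h: "0 < h" "h < 1 / 2" using cvX c X by (auto simp: h_def field_simps)
    define r where "r = 2 * h"
    have r: "r > 0" "r = 1 / (3 * cv * X)" using h by (simp_all add: r_def h_def)
    have rX: "r \<le> 1 / X" using c X by (simp add: r(2) field_simps)
    define T where "T = exp_sum \<Gamma> v w \<sigma> N \<Xi> P"
    define V where "V = (\<lambda>\<omega>. \<omega> *v w) ` P"
    define A where "A = {\<gamma>\<in>\<Gamma>. frob_norm \<gamma> < N powr \<sigma>} \<times> \<Xi>"
    define g where "g = (\<lambda>(\<gamma> :: int^2^2, \<xi> :: int^2^2). v v* (\<gamma> ** \<xi>))"
    define \<mu> where "\<mu> x = real (card {p \<in> A. g p = x})" for x
    have fin\<Xi>: "finite \<Xi>"
      by (rule finite_subset[OF _ finite_frob_norm_le[of "N powr (1/2)"]]) (use \<Xi>(2) in \<open>auto intro: less_imp_le\<close>)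
    have finP: "finite P"
      by (rule finite_subset[OF _ finite_frob_norm_le[of "N powr (1/2 - \<sigma>)"]]) (use P(2) in \<open>auto intro: less_imp_le\<close>)
    have finV: "finite V" using finP by (simp add: V_def)
    have finA: "finite A" unfolding A_def using finite_frob_norm_less fin\<Xi> by (intro finite_cartesian_product) auto
    have T: "T \<theta> = (\<Sum>x\<in>g ` A. of_real (\<mu> x) * (\<Sum>y\<in>V. unit_exp (of_int (int_dot x y) * \<theta>)))" for \<theta>
      unfolding T_def \<mu>_def V_def A_def g_def by (rule exp_sum_eq[OF fin\<Xi> finP P(1) vw(2)])
    define E where "E = D * l\<^sup>2 * N powr (s * (1 + 2 * \<sigma>))"
    have E: "(\<Sum>x\<in>g ` A. (\<mu> x)\<^sup>2) \<le> E" unfolding E_def \<mu>_def A_def g_def l_def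
      using \<sigma> by (intro sum_multiplicity_sq_le[OF D(2) D(1) \<Xi> vw(1) N(3)]) auto
    have E0: "E \<ge> 0" using D(1) by (simp add: E_def)
    have small: "\<bar>real_of_int (x$i)\<bar> * h \<le> 1 / 6" if "x \<in> g ` A" for x i
    proof -
      obtain \<gamma> \<xi> where x: "x = v v* (\<gamma> ** \<xi>)" "frob_norm \<gamma> < N powr \<sigma>" "\<xi> \<in> \<Xi>"
        using \<open>x \<in> g ` A\<close> by (auto simp: g_def A_def)
      have "frob_norm (\<gamma> ** \<xi>) \<le> N powr \<sigma> * N powr (1/2)"
        using x(2) \<Xi>(2)[OF x(3)] by (intro order_trans[OF frob_norm_mult] mult_mono) auto
      also have "\<dots> = X" by (simp add: XY_def add.commute flip: powr_add)
      finally have "\<bar>real_of_int (x$i)\<bar> \<le> cv * X"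
        unfolding x(1) c_def using l1norm_ge_1[OF vw(1)] by (intro order_trans[OF abs_vec_mult_le] mult_left_mono) auto
      then have "\<bar>real_of_int (x$i)\<bar> * h \<le> (cv * X) * h" using h by (intro mult_right_mono) auto
      also have "\<dots> = 1 / 6" using c X by (simp add: h_def)
      finally show ?thesis .
    qed
    define k where "k \<theta> \<theta>' = real (card {(y, y') \<in> V \<times> V. torus_close r y \<theta> y' \<theta>'})" for \<theta> \<theta>'
    have k0: "k \<theta> \<theta>' \<ge> 0" and k_sym: "k \<theta> \<theta>' = k \<theta>' \<theta>" for \<theta> \<theta>'
      unfolding k_def using card_close_sym by auto
    have h2: "4 / h\<^sup>2 = 144 * cv\<^sup>2 * X\<^sup>2" using c X by (simp add: h_def power_mult_distrib power_divide)
    have bil: "(\<Sum>\<theta>\<in>\<Theta>'. (cmod (T \<theta>))\<^sup>2)\<^sup>2 \<le> E * (144 * cv\<^sup>2 * X\<^sup>2) * (\<Sum>\<theta>\<in>\<Theta>'. \<Sum>\<theta>'\<in>\<Theta>'. cmod (T \<theta>) * cmod (T \<theta>') * k \<theta> \<theta>')"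
      if "\<Theta>' \<subseteq> \<Theta>" for \<Theta>'
    proof -
      have fin: "finite \<Theta>'" using that \<Theta>(1) by (rule finite_subset)
      have "(\<Sum>\<theta>\<in>\<Theta>'. (cmod (T \<theta>))\<^sup>2)\<^sup>2 \<le> (\<Sum>x\<in>g ` A. (\<mu> x)\<^sup>2) *
          (4 / h\<^sup>2 * (\<Sum>\<theta>\<in>\<Theta>'. \<Sum>\<theta>'\<in>\<Theta>'. cmod (T \<theta>) * cmod (T \<theta>') * k \<theta> \<theta>'))"
        unfolding k_def r_def by (rule bilinear_bound[OF _ finV fin h small T]) (use finA in auto)
      also have "\<dots> \<le> E * (4 / h\<^sup>2 * (\<Sum>\<theta>\<in>\<Theta>'. \<Sum>\<theta>'\<in>\<Theta>'. cmod (T \<theta>) * cmod (T \<theta>') * k \<theta> \<theta>'))"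
        using k0 by (intro mult_right_mono E mult_nonneg_nonneg sum_nonneg) auto
      finally show ?thesis by (simp only: h2 mult.assoc)
    qed
    \<comment> \<open>For denominators up to N^(1 - \<eta> \<sigma>), the bound q r \<le> t asks for
      \<eta> > 1, and the sum of 1 / q, of order N^(\<eta> \<sigma>), for \<eta> < 2 \<delta>. As
      \<delta> > 5/6, all of (1, 5/3) is allowed up to small losses; 4/3 is its midpoint.\<close>
    define B where "B = nat \<lfloor>N powr (1 - 4 * \<sigma> / 3)\<rfloor>"
    have B'1: "N powr (1 - 4 * \<sigma> / 3) \<ge> 1" using N(3) \<sigma> by (simp add: ge_one_powr_ge_zero)
    have B: "B \<ge> 1" "real B \<le> N powr (1 - 4 * \<sigma> / 3)" "N powr (1 - 4 * \<sigma> / 3) / 2 \<le> real B"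
      using B'1 floor_half[OF B'1] unfolding B_def by linarith+
    have "\<forall>\<theta>. \<exists>a q. coprime a q \<and> 0 < q \<and> q \<le> int B \<and> \<bar>of_int q * \<theta> - of_int a\<bar> < 1 / real B"
      using Dirichlet_approx_coprime[of B] B(1) by (metis less_le_trans zero_less_one)
    then obtain a q where aq: "\<And>\<theta>. coprime (a \<theta>) (q \<theta>)" "\<And>\<theta>. 0 < q \<theta>" "\<And>\<theta>. q \<theta> \<le> int B"
      "\<And>\<theta>. \<bar>of_int (q \<theta>) * \<theta> - of_int (a \<theta>)\<bar> < 1 / real B" by metis
    \<comment> \<open>This is Y / Q, so for q > Q the term Y / q of a row sum is at most t, as are
      the three other terms.\<close>
    define t where "t = N powr (1/2 - 2 * \<sigma> - \<kappa>)"
    define Q where "Q = N powr (\<sigma> + \<kappa>)"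
    have Q1: "Q \<ge> 1" using N(3) \<sigma> \<kappa> by (simp add: Q_def ge_one_powr_ge_zero)
    have YQt: "Y / Q = t" unfolding XY_def Q_def t_def powr_diff[symmetric] by (simp add: algebra_simps)
    have t1: "t \<ge> 1" using N(3) \<kappa> by (simp add: t_def ge_one_powr_ge_zero)
    have row: "(\<Sum>\<theta>'\<in>\<Theta>'. k \<theta> \<theta>') \<le> R * l * Y * Y powr (2 * s) * (Y / of_int (q \<theta>) + 3 * t)"
      if "\<Theta>' \<subseteq> \<Theta>" for \<theta> \<Theta>'
    proof -
      let ?q = "real_of_int (q \<theta>)"
      have qp: "?q > 0" "?q \<le> real B" using aq(2)[of \<theta>] aq(3)[of \<theta>] by linarith+
      have fin: "finite \<Theta>'" using that \<Theta>(1) by (rule finite_subset)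
      have "1 / real B \<le> 1 / ?q" using qp by (intro divide_left_mono) auto
      then have approx: "\<bar>?q * \<theta> - of_int (a \<theta>)\<bar> \<le> 1 / ?q" using aq(4)[of \<theta>] by linarith
      have "4 * r * (cw * Y) = 4 * cw / (3 * cv) * N powr (- 2 * \<sigma>)"
      proof -
        have "Y / X = N powr (- 2 * \<sigma>)" unfolding XY_def powr_diff[symmetric] by (simp add: algebra_simps)
        then show ?thesis unfolding r(2) using c X by (simp add: field_simps)
      qed
      then have c1: "4 * r * (l1norm w * Y) < 1" using N(2) by (simp add: c_def)
      have "cw * N \<le> cw * M" using M c by simp
      then have c2: "l1norm w * Y \<le> K * (r * M)"
        unfolding c_def[symmetric] r(2) K_def NXY using c X by (simp add: field_simps)
      have "(\<Sum>\<theta>'\<in>\<Theta>'. k \<theta> \<theta>') = (\<Sum>y\<in>V. real (card {(y', \<theta>') \<in> V \<times> \<Theta>'. torus_close r y \<theta> y' \<theta>'}))"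
        unfolding k_def by (rule row_sum_eq[OF finV fin])
      also have "\<dots> \<le> C1 * (8 + 2 * K) * (1 + ln Y) * (r * M) * Y powr (2 * s) * (1 + Y / ?q + r * Y\<^sup>2 + ?q * r)"
        unfolding V_def
      proof (rule C1(2)[OF P(1) _ Y fin _ _ M(3) r(1) c1 c2 K aq(2) aq(1) approx])
        show "\<And>\<omega>. \<omega> \<in> P \<Longrightarrow> frob_norm \<omega> < Y" using P(2) by (simp add: XY_def)
        show "\<Theta>' \<subseteq> {0..<1}" "\<Theta>' \<subseteq> grid \<phi> M" using that \<Theta> by (auto simp: M_def)
      qed
      also have "\<dots> \<le> R * l * Y * Y powr (2 * s) * (Y / ?q + 3 * t)"
        unfolding R_def[symmetric]
      proof (intro mult_mono)
        have "Y \<le> N" using NXY X Y by simp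
        then show "1 + ln Y \<le> l" using Y by (simp add: l_def)
        have "r * M \<le> (1 / (3 * cv * X)) * (2 * N)" unfolding r(2) using M c X by (intro mult_left_mono) auto
        also have "\<dots> = 2 / (3 * cv) * Y" unfolding NXY using X by simp
        also have "\<dots> \<le> 1 * Y" using c Y by (intro mult_right_mono) (auto simp: field_simps)
        finally show "r * M \<le> Y" by simp
        have "r * Y\<^sup>2 \<le> 1 / X * Y\<^sup>2" using rX by (intro mult_right_mono) auto
        also have "\<dots> = N powr ((1/2 - \<sigma>) + (1/2 - \<sigma>) - (1/2 + \<sigma>))"
          unfolding powr_diff[of N _ "1/2 + \<sigma>"] powr_add[of N "1/2 - \<sigma>"] XY_def[symmetric] by (simp add: power2_eq_square)
        also have "\<dots> \<le> t" unfolding t_def using N(3) \<kappa> \<sigma> by (intro powr_mono) auto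
        finally have 1: "r * Y\<^sup>2 \<le> t" .
        have "?q * r \<le> N powr (1 - 4 * \<sigma> / 3) * (1 / X)" using qp B(2) rX r(1) by (intro mult_mono) auto
        also have "\<dots> = N powr (1 - 4 * \<sigma> / 3 - (1/2 + \<sigma>))"
          unfolding XY_def powr_diff[of N _ "1/2 + \<sigma>"] by (simp only: times_divide_eq_right mult_1_right)
        also have "\<dots> \<le> t" unfolding t_def using N(3) \<kappa> \<sigma> by (intro powr_mono) auto
        finally have 2: "?q * r \<le> t" .
        show "1 + Y / ?q + r * Y\<^sup>2 + ?q * r \<le> Y / ?q + 3 * t" using 1 2 t1 by linarith
      qed (use R l Y M r qp in auto)
      finally show ?thesis .
    qed
    define W where "W = R * l * Y * Y powr (2 * s)"
    have W0: "W \<ge> 0" using R l Y by (simp add: W_def)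
    define \<Theta>1 where "\<Theta>1 = {\<theta> \<in> \<Theta>. of_int (q \<theta>) \<le> Q}"
    define \<Theta>2 where "\<Theta>2 = {\<theta> \<in> \<Theta>. \<not> of_int (q \<theta>) \<le> Q}"
    define I1 where "I1 = (\<Sum>\<theta>\<in>\<Theta>1. (cmod (T \<theta>))\<^sup>2)"
    define I2 where "I2 = (\<Sum>\<theta>\<in>\<Theta>2. (cmod (T \<theta>))\<^sup>2)"
    have I0: "I1 \<ge> 0" "I2 \<ge> 0" unfolding I1_def I2_def by (intro sum_nonneg; simp)+
    define F where "F = E * (144 * cv\<^sup>2 * X\<^sup>2)"
    have F0: "F \<ge> 0" using E0 by (simp add: F_def)
    have sum_split: "(\<Sum>\<theta>\<in>\<Theta>. (cmod (T \<theta>))\<^sup>2) = I1 + I2"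
    proof -
      have "\<Theta> = \<Theta>1 \<union> \<Theta>2" "\<Theta>1 \<inter> \<Theta>2 = {}" by (auto simp: \<Theta>1_def \<Theta>2_def)
      moreover have "finite \<Theta>1" "finite \<Theta>2" using \<Theta>(1) by (auto simp: \<Theta>1_def \<Theta>2_def)
      ultimately show ?thesis unfolding I1_def I2_def by (metis sum.union_disjoint)
    qed
    have X2: "X\<^sup>2 = N powr (1 + 2 * \<sigma>)"
      unfolding XY_def power2_eq_square powr_add[symmetric] by (simp add: algebra_simps)
    have Y2s: "Y powr (2 * s) = N powr (s * (1 - 2 * \<sigma>))" by (simp add: XY_def powr_powr algebra_simps)
    have l34: "l ^ 3 \<le> N powr (\<kappa> / 4)" "l ^ 4 \<le> N powr (\<kappa> / 4)"
      using N(1) l power_increasing[of 3 4 l] by (auto simp: l_def)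
    have "I2 \<le> F * (W * (4 * t))"
    proof (cases "I2 = 0")
      case True
      then show ?thesis using F0 W0 t1 by simp
    next
      \<comment> \<open>Schur's test bounds the square of I2 by a multiple of I2, which is then
        cancelled.\<close>
      case False
      have "I2\<^sup>2 \<le> F * (\<Sum>\<theta>\<in>\<Theta>2. \<Sum>\<theta>'\<in>\<Theta>2. cmod (T \<theta>) * cmod (T \<theta>') * k \<theta> \<theta>')"
        unfolding I2_def F_def by (rule bil) (auto simp: \<Theta>2_def)
      also have "\<dots> \<le> F * (W * (4 * t) * I2)"
        unfolding I2_def
      proof (intro mult_left_mono schur_bound k0 k_sym F0)
        fix \<theta> assume "\<theta> \<in> \<Theta>2"
        then have "Q < of_int (q \<theta>)" by (simp add: \<Theta>2_def)
        then have "Y / of_int (q \<theta>) \<le> Y / Q" using Q1 Y by (intro divide_left_mono) auto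
        then have "W * (Y / of_int (q \<theta>) + 3 * t) \<le> W * (4 * t)" using YQt W0 by (intro mult_left_mono) auto
        with row[of \<Theta>2 \<theta>] show "(\<Sum>\<theta>'\<in>\<Theta>2. k \<theta> \<theta>') \<le> W * (4 * t)" by (auto simp: W_def \<Theta>2_def)
      qed
      finally have "I2 * I2 \<le> (F * (W * (4 * t))) * I2" by (simp add: power2_eq_square mult_ac)
      then show ?thesis using False I0 by (simp add: mult_le_cancel_right)
    qed
    also have "F * (W * (4 * t)) = C2 * l ^ 3 * N powr (2 * s + 2 - \<sigma> - \<kappa>)"
    proof -
      have "F * (W * (4 * t)) = C2 * l ^ 3 * (N powr (s * (1 + 2 * \<sigma>)) * N powr (1 + 2 * \<sigma>) * Y *
        N powr (s * (1 - 2 * \<sigma>)) * t)"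
        unfolding F_def W_def E_def C2_def X2 Y2s by (simp add: power2_eq_square power3_eq_cube mult_ac)
      also have "N powr (s * (1 + 2 * \<sigma>)) * N powr (1 + 2 * \<sigma>) * Y * N powr (s * (1 - 2 * \<sigma>)) * t
          = N powr (2 * s + 2 - \<sigma> - \<kappa>)"
        unfolding XY_def t_def powr_add[symmetric] by (simp add: algebra_simps)
      finally show ?thesis .
    qed
    also have "\<dots> \<le> C2 * N powr (\<kappa> / 4) * N powr (2 * s + 2 - \<sigma> - \<kappa>)"
      using l34 C2 by (intro mult_right_mono mult_left_mono) auto
    also have "\<dots> = C2 * N powr (\<kappa> / 4 + (2 * s + 2 - \<sigma> - \<kappa>))"
      by (simp only: powr_add[of _ "\<kappa> / 4"] mult.assoc)
    \<comment> \<open>As s < \<delta> + \<kappa> / 4, the losses of \<kappa> / 4 from the logarithms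
      and \<kappa> / 2 from 2 s stay below the gain \<kappa>.\<close>
    also have "\<dots> \<le> C2 * N powr (1 + (2 * \<delta> + 1 - \<sigma>))"
      using C2 N(3) s(3) \<kappa> by (intro mult_left_mono powr_mono) auto
    also have "\<dots> = C2 * (N * N powr (2 * \<delta> + 1 - \<sigma>))" using N(3) by (simp only: powr_add) simp
    finally have I2: "I2 \<le> C2 * (N * N powr (2 * \<delta> + 1 - \<sigma>))" .
    have "I1\<^sup>2 \<le> F * (\<Sum>\<theta>\<in>\<Theta>1. \<Sum>\<theta>'\<in>\<Theta>1. cmod (T \<theta>) * cmod (T \<theta>') * k \<theta> \<theta>')"
      unfolding I1_def F_def by (rule bil) (auto simp: \<Theta>1_def)
    \<comment> \<open>The row sums are of order Y / q, too large for a uniform bound when q is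
      small. With |T| \<le> U only the sum of 1 / q remains.\<close>
    also have "\<dots> \<le> F * (\<Sum>\<theta>\<in>\<Theta>1. \<Sum>\<theta>'\<in>\<Theta>1. U * U * k \<theta> \<theta>')"
      using U k0 F0 by (intro mult_left_mono sum_mono mult_right_mono mult_mono) (auto simp: T_def \<Theta>1_def)
    also have "\<dots> = F * (U\<^sup>2 * (\<Sum>\<theta>\<in>\<Theta>1. \<Sum>\<theta>'\<in>\<Theta>1. k \<theta> \<theta>'))"
      unfolding sum_distrib_left power2_eq_square ..
    also have "\<dots> \<le> F * (U\<^sup>2 * (\<Sum>\<theta>\<in>\<Theta>1. W * (4 * Y) * (1 / of_int (q \<theta>))))"
    proof (intro mult_left_mono sum_mono F0)
      fix \<theta> assume \<theta>: "\<theta> \<in> \<Theta>1"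
      then have "Y / Q \<le> Y / of_int (q \<theta>)" using Y Q1 aq(2)[of \<theta>] by (intro divide_left_mono) (auto simp: \<Theta>1_def)
      then have "Y / of_int (q \<theta>) + 3 * t \<le> 4 * Y * (1 / of_int (q \<theta>))" using YQt by simp
      then have "W * (Y / of_int (q \<theta>) + 3 * t) \<le> W * (4 * Y * (1 / of_int (q \<theta>)))" using W0 by (rule mult_left_mono)
      with row[of \<Theta>1 \<theta>] show "(\<Sum>\<theta>'\<in>\<Theta>1. k \<theta> \<theta>') \<le> W * (4 * Y) * (1 / of_int (q \<theta>))"
        by (auto simp: W_def \<Theta>1_def mult.assoc)
    qed simp
    also have "\<dots> = F * (U\<^sup>2 * (W * (4 * Y) * (\<Sum>\<theta>\<in>\<Theta>1. 1 / of_int (q \<theta>))))"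
      by (simp only: sum_distrib_left)
    also have "\<dots> \<le> F * (U\<^sup>2 * (W * (4 * Y) * (18 * l * N powr (4 * \<sigma> / 3))))"
    proof (intro mult_left_mono F0)
      have "(\<Sum>\<theta>\<in>\<Theta>1. 1 / of_int (q \<theta>)) \<le> 4 * M / real B * (1 + ln Q) + 2 * Q"
        using \<Theta> M B Q1 aq by (intro sum_reciprocal_denominators[of _ \<phi> M _ _ q a]) (auto simp: \<Theta>1_def M_def)
      also have "\<dots> \<le> (16 * N powr (4 * \<sigma> / 3)) * l + 2 * (N powr (4 * \<sigma> / 3) * l)"
      proof (intro add_mono mult_mono mult_left_mono)
        have "4 * M / real B \<le> 4 * (2 * N) / (N powr (1 - 4 * \<sigma> / 3) / 2)"
          using M B N(3) by (intro frac_le) auto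
        also have "\<dots> = 16 * (N powr 1 / N powr (1 - 4 * \<sigma> / 3))" using N(3) by simp
        also have "\<dots> = 16 * N powr (4 * \<sigma> / 3)" unfolding powr_diff[symmetric] by simp
        finally show "4 * M / real B \<le> 16 * N powr (4 * \<sigma> / 3)" .
        have "ln Q = (\<sigma> + \<kappa>) * ln N" using N(3) by (simp add: Q_def ln_powr)
        also have "\<dots> \<le> 1 * ln N" using \<sigma> \<kappa> N(3) by (intro mult_right_mono) auto
        finally show "1 + ln Q \<le> l" by (simp add: l_def)
        have "Q \<le> N powr (4 * \<sigma> / 3)" unfolding Q_def using N(3) \<kappa> by (intro powr_mono) auto
        also have "\<dots> \<le> N powr (4 * \<sigma> / 3) * l" using mult_left_mono[OF l, of "N powr (4 * \<sigma> / 3)"] by simp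
        finally show "Q \<le> N powr (4 * \<sigma> / 3) * l" .
      qed (use Q1 in auto)
      finally show "(\<Sum>\<theta>\<in>\<Theta>1. 1 / of_int (q \<theta>)) \<le> 18 * l * N powr (4 * \<sigma> / 3)" by simp
    qed (use W0 Y in auto)
    also have "\<dots> = (18 * C2) * U\<^sup>2 * l ^ 4 * N powr (2 * s + 2 + 4 * \<sigma> / 3)"
    proof -
      have "F * (U\<^sup>2 * (W * (4 * Y) * (18 * l * N powr (4 * \<sigma> / 3)))) = (18 * C2) * U\<^sup>2 * l ^ 4 *
          (N powr (s * (1 + 2 * \<sigma>)) * N powr (1 + 2 * \<sigma>) * Y * N powr (s * (1 - 2 * \<sigma>)) * Y * N powr (4 * \<sigma> / 3))"
        unfolding F_def W_def E_def C2_def X2 Y2s by (simp add: power2_eq_square power4_eq_xxxx mult_ac)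
      also have "N powr (s * (1 + 2 * \<sigma>)) * N powr (1 + 2 * \<sigma>) * Y * N powr (s * (1 - 2 * \<sigma>)) * Y * N powr (4 * \<sigma> / 3)
          = N powr (2 * s + 2 + 4 * \<sigma> / 3)"
        unfolding XY_def powr_add[symmetric] by (simp add: algebra_simps)
      finally show ?thesis .
    qed
    also have "\<dots> \<le> (18 * C2) * U\<^sup>2 * N powr (\<kappa> / 4) * N powr (2 * s + 2 + 4 * \<sigma> / 3)"
      using l34 C2 by (intro mult_right_mono mult_left_mono) auto
    also have "\<dots> = (18 * C2) * U\<^sup>2 * N powr (\<kappa> / 4 + (2 * s + 2 + 4 * \<sigma> / 3))"
      by (simp only: powr_add[of _ "\<kappa> / 4"] mult.assoc)
    also have "\<dots> \<le> (18 * C2) * U\<^sup>2 * N powr (2 * (1 + (\<delta> + \<delta> * \<sigma>)))"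
    proof (intro mult_left_mono powr_mono)
      define d where "d = \<delta> * \<sigma>"
      \<comment> \<open>Required is 4 \<sigma> / 3 + 3 \<kappa> / 4 \<le> 2 \<delta> \<sigma>. By
        \<kappa> \<le> \<sigma> / 3 the left side is at most 19 \<sigma> / 12, and \<delta> > 5/6
        makes the right side at least 20 \<sigma> / 12.\<close>
      have "5 / 6 * \<sigma> \<le> d" unfolding d_def using dim(2) \<sigma> by (intro mult_right_mono) auto
      then show "\<kappa> / 4 + (2 * s + 2 + 4 * \<sigma> / 3) \<le> 2 * (1 + (\<delta> + \<delta> * \<sigma>))"
        unfolding d_def[symmetric] using s(3) \<kappa> \<sigma> by argo
    qed (use C2 N(3) in auto)
    also have "\<dots> = (sqrt (18 * C2) * (N * (N powr (\<delta> + \<delta> * \<sigma>) * U)))\<^sup>2"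
    proof -
      have "N powr (2 * (1 + (\<delta> + \<delta> * \<sigma>))) = (N powr (1 + (\<delta> + \<delta> * \<sigma>)))\<^sup>2"
        using N(3) by (simp add: powr_powr mult.commute flip: powr_numeral)
      also have "N powr (1 + (\<delta> + \<delta> * \<sigma>)) = N * N powr (\<delta> + \<delta> * \<sigma>)" using N(3) by (simp only: powr_add) simp
      finally show ?thesis using C2 by (simp add: power_mult_distrib)
    qed
    finally have "I1 \<le> sqrt (18 * C2) * (N * (N powr (\<delta> + \<delta> * \<sigma>) * U))"
      using C2 N(3) U(2) by (elim power2_le_imp_le) simp
    with I2 have "I1 + I2 \<le> sqrt (18 * C2) * (N * (N powr (\<delta> + \<delta> * \<sigma>) * U)) + C2 * (N * N powr (2 * \<delta> + 1 - \<sigma>))"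
      by linarith
    also have "\<dots> \<le> C * (N * (N powr (\<delta> + \<delta> * \<sigma>) * U)) + C * (N * N powr (2 * \<delta> + 1 - \<sigma>))"
      using C2 N(3) U(2) by (intro add_mono mult_right_mono) (auto simp: C_def)
    also have "\<dots> = C * (N * (N powr (\<delta> + \<delta> * \<sigma>) * U + N powr (2 * \<delta> + 1 - \<sigma>)))" by (simp add: distrib_left)
    finally show ?thesis using sum_split by (simp add: T_def)
  qed
  show ?thesis
  proof (rule that[OF C])
    show "\<forall>\<^sub>F N :: real in at_top. \<forall>\<Xi> P U \<Theta> \<phi>.
      \<Xi> \<subseteq> \<Gamma> \<longrightarrow> (\<forall>\<xi>\<in>\<Xi>. frob_norm \<xi> < N powr (1/2)) \<longrightarrow>
      P \<subseteq> \<Gamma> \<longrightarrow> (\<forall>\<omega>\<in>P. frob_norm \<omega> < N powr (1/2 - \<sigma>)) \<longrightarrow>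
      finite \<Theta> \<longrightarrow> \<Theta> \<subseteq> {0..<1} \<longrightarrow> \<Theta> \<subseteq> grid \<phi> (real (nat \<lceil>N\<rceil>)) \<longrightarrow>
      (\<forall>\<theta>\<in>\<Theta>. cmod (exp_sum \<Gamma> v w \<sigma> N \<Xi> P \<theta>) \<le> U) \<longrightarrow> U \<ge> 0 \<longrightarrow>
      (\<Sum>\<theta>\<in>\<Theta>. (cmod (exp_sum \<Gamma> v w \<sigma> N \<Xi> P \<theta>))\<^sup>2)
        \<le> C * (N * (N powr (\<delta> + \<delta> * \<sigma>) * U + N powr (2 * \<delta> + 1 - \<sigma>)))"
      using ev1 ev2 ev3
    proof eventually_elim
      case (elim N)
      show ?case
        by (intro allI impI, rule main[OF elim]) blast+
    qed
  qed
qed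

end

text \<open>The trivial bound, which makes the supremum of |S| a genuine upper bound.\<close>

lemma norm_exp_sum_le:
  "cmod (exp_sum \<Gamma> v w \<sigma> N \<Xi> P \<theta>)
    \<le> real (card \<Xi>) * (real (card P) * (real (card {\<gamma>\<in>\<Gamma>. frob_norm \<gamma> < N powr \<sigma>}) * 1))"
  unfolding exp_sum_def by (intro sum_norm_bound) simp

theorem theorem7p1:
  fixes \<Gamma> S :: "(int^2^2) set" and v\<^sub>0 w\<^sub>0 :: "int^2" and \<delta> \<sigma> c\<^sub>1 c\<^sub>2 :: real
  assumes "subgroup \<Gamma> SL2Z"
    and "finite S" and "free_generating_set SL2Z \<Gamma> S"
    and "\<And>\<gamma>. \<gamma> \<in> \<Gamma> \<Longrightarrow> \<not> parabolic \<gamma>"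
    and "hausdorff_dim (limit_set \<Gamma>) = ereal \<delta>" and "\<delta> > 5/6"
    and "primitive_vec v\<^sub>0" and "primitive_vec w\<^sub>0"
    and "0 < \<sigma>" and "\<sigma> < 1/4"
    and "c\<^sub>1 > 0" and "c\<^sub>2 > 0"
  shows "\<exists>C>0. \<forall>\<^sub>F N :: real in at_top. \<forall>\<Xi> P x y Q K.
    \<Xi> \<subseteq> \<Gamma> \<longrightarrow>
    (\<forall>\<xi>\<in>\<Xi>. frob_norm \<xi> < N powr (1/2) \<and> ends_with_letter SL2Z S x \<xi>) \<longrightarrow>
    real (card \<Xi>) \<ge> c\<^sub>1 * N powr \<delta> \<longrightarrow>
    P \<subseteq> \<Gamma> \<longrightarrow>
    (\<forall>\<omega>\<in>P. frob_norm \<omega> < N powr (1/2 - \<sigma>) \<and> starts_with_letter SL2Z S y \<omega>) \<longrightarrow>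
    y \<noteq> inv_letter x \<longrightarrow>
    real (card P) \<ge> c\<^sub>2 * N powr (\<delta> * (1 - 2 * \<sigma>)) \<longrightarrow>
    Q < N powr (1/2) \<longrightarrow> K < N powr (1/2) \<longrightarrow>
    (LINT \<theta>:W_region N Q K|lborel. (cmod (exp_sum \<Gamma> v\<^sub>0 w\<^sub>0 \<sigma> N \<Xi> P \<theta>))\<^sup>2)
      \<le> C * (ln N * (N powr (\<delta> + \<delta> * \<sigma>) * sup_norm_on (W_region N Q K) (exp_sum \<Gamma> v\<^sub>0 w\<^sub>0 \<sigma> N \<Xi> P)
                   + N powr (2 * \<delta> + 1 - \<sigma>)))"
proof -
  interpret free_nonparabolic \<Gamma> S
    by (rule free_nonparabolic.intro) (fact assms)+
  obtain C where C: "C > 0" "\<forall>\<^sub>F N :: real in at_top. \<forall>\<Xi> P U \<Theta> \<phi>.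
    \<Xi> \<subseteq> \<Gamma> \<longrightarrow> (\<forall>\<xi>\<in>\<Xi>. frob_norm \<xi> < N powr (1/2)) \<longrightarrow>
    P \<subseteq> \<Gamma> \<longrightarrow> (\<forall>\<omega>\<in>P. frob_norm \<omega> < N powr (1/2 - \<sigma>)) \<longrightarrow>
    finite \<Theta> \<longrightarrow> \<Theta> \<subseteq> {0..<1} \<longrightarrow> \<Theta> \<subseteq> grid \<phi> (real (nat \<lceil>N\<rceil>)) \<longrightarrow>
    (\<forall>\<theta>\<in>\<Theta>. cmod (exp_sum \<Gamma> v\<^sub>0 w\<^sub>0 \<sigma> N \<Xi> P \<theta>) \<le> U) \<longrightarrow> U \<ge> 0 \<longrightarrow>
    (\<Sum>\<theta>\<in>\<Theta>. (cmod (exp_sum \<Gamma> v\<^sub>0 w\<^sub>0 \<sigma> N \<Xi> P \<theta>))\<^sup>2)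
      \<le> C * (N * (N powr (\<delta> + \<delta> * \<sigma>) * U + N powr (2 * \<delta> + 1 - \<sigma>)))"
  proof (rule grid_bound[OF assms(5,6) assms(7,8)[unfolded primitive_vec_def] assms(9,10)], goal_cases)
    case (1 C)
    show ?case by (rule 1(1)[OF 1(2,3)])
  qed
  have bound: "(LINT \<theta>:W|lborel. (cmod (exp_sum \<Gamma> v\<^sub>0 w\<^sub>0 \<sigma> N \<Xi> P \<theta>))\<^sup>2)
      \<le> C * (ln N * (N powr (\<delta> + \<delta> * \<sigma>) * sup_norm_on W (exp_sum \<Gamma> v\<^sub>0 w\<^sub>0 \<sigma> N \<Xi> P)
                   + N powr (2 * \<delta> + 1 - \<sigma>)))"
    if N: "N \<ge> 3" and W: "W \<subseteq> {0..1}"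
      and grid: "\<And>U \<Theta> \<phi>. finite \<Theta> \<Longrightarrow> \<Theta> \<subseteq> {0..<1} \<Longrightarrow> \<Theta> \<subseteq> grid \<phi> (real (nat \<lceil>N\<rceil>)) \<Longrightarrow>
        (\<And>\<theta>. \<theta> \<in> \<Theta> \<Longrightarrow> cmod (exp_sum \<Gamma> v\<^sub>0 w\<^sub>0 \<sigma> N \<Xi> P \<theta>) \<le> U) \<Longrightarrow> U \<ge> 0 \<Longrightarrow>
        (\<Sum>\<theta>\<in>\<Theta>. (cmod (exp_sum \<Gamma> v\<^sub>0 w\<^sub>0 \<sigma> N \<Xi> P \<theta>))\<^sup>2)
          \<le> C * (N * (N powr (\<delta> + \<delta> * \<sigma>) * U + N powr (2 * \<delta> + 1 - \<sigma>)))"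
    for N \<Xi> P W
  proof -
    let ?T = "exp_sum \<Gamma> v\<^sub>0 w\<^sub>0 \<sigma> N \<Xi> P"
    define U where "U = sup_norm_on W ?T"
    have TU: "cmod (?T \<theta>) \<le> U" if "\<theta> \<in> W" for \<theta>
    proof -
      have "bdd_above ((\<lambda>\<theta>. cmod (?T \<theta>)) ` W)" using norm_exp_sum_le by (intro bdd_aboveI2)
      then have "cmod (?T \<theta>) \<le> (SUP \<theta>\<in>W. cmod (?T \<theta>))" using that by (rule cSUP_upper[rotated])
      with that show ?thesis by (auto simp: U_def sup_norm_on_def)
    qed
    have U0: "U \<ge> 0"
    proof (cases "W = {}")
      case False
      then obtain \<theta> where "\<theta> \<in> W" by blast
      from TU[OF this] norm_ge_zero show ?thesis by (rule order_trans[rotated])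
    qed (simp add: U_def sup_norm_on_def)
    define G where "G = N powr (\<delta> + \<delta> * \<sigma>) * U + N powr (2 * \<delta> + 1 - \<sigma>)"
    have G0: "G \<ge> 0" using U0 by (simp add: G_def)
    \<comment> \<open>The grid has at least N points per unit length, so the division by their
      number removes the factor N of the grid estimate.\<close>
    have m: "nat \<lceil>N\<rceil> > 0" "N \<le> real (nat \<lceil>N\<rceil>)" using N by linarith+
    have "(LINT \<theta>:W|lborel. (cmod (?T \<theta>))\<^sup>2) \<le> C * (N * G) / real (nat \<lceil>N\<rceil>)"
    proof (rule set_integral_le_grid[OF _ W m(1)])
      show "0 \<le> C * (N * G)" using C(1) N G0 by simp
      fix \<Theta> \<phi> assume "finite \<Theta>" "\<Theta> \<subseteq> {0..<1}" "\<Theta> \<subseteq> W" "\<Theta> \<subseteq> grid \<phi> (real (nat \<lceil>N\<rceil>))"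
      then show "(\<Sum>\<theta>\<in>\<Theta>. (cmod (?T \<theta>))\<^sup>2) \<le> C * (N * G)"
        unfolding G_def using TU U0 by (intro grid) auto
    qed simp
    also have "\<dots> \<le> C * (N * G) / N" using C(1) N G0 m by (intro divide_left_mono) auto
    also have "\<dots> = C * (1 * G)" using N by simp
    \<comment> \<open>The logarithms of the proof are already absorbed into powers of N; for N \<ge>
      3 the factor ln N of the claim is at least 1.\<close>
    also have "\<dots> \<le> C * (ln N * G)"
    proof -
      have "exp 1 \<le> N" using N exp_le by linarith
      then have "1 \<le> ln N" using N by (simp add: ln_ge_iff)
      then show ?thesis using C(1) G0 by (intro mult_left_mono mult_right_mono) auto
    qed
    finally show ?thesis by (simp only: G_def U_def)
  qed
  have W: "W_region N Q K \<subseteq> {0..1}" for N Q K by (auto simp: W_region_def)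
  show ?thesis
  proof (intro exI[of _ C] conjI C(1))
    show "\<forall>\<^sub>F N :: real in at_top. \<forall>\<Xi> P x y Q K.
      \<Xi> \<subseteq> \<Gamma> \<longrightarrow>
      (\<forall>\<xi>\<in>\<Xi>. frob_norm \<xi> < N powr (1/2) \<and> ends_with_letter SL2Z S x \<xi>) \<longrightarrow>
      real (card \<Xi>) \<ge> c\<^sub>1 * N powr \<delta> \<longrightarrow>
      P \<subseteq> \<Gamma> \<longrightarrow>
      (\<forall>\<omega>\<in>P. frob_norm \<omega> < N powr (1/2 - \<sigma>) \<and> starts_with_letter SL2Z S y \<omega>) \<longrightarrow>
      y \<noteq> inv_letter x \<longrightarrow>
      real (card P) \<ge> c\<^sub>2 * N powr (\<delta> * (1 - 2 * \<sigma>)) \<longrightarrow>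
      Q < N powr (1/2) \<longrightarrow> K < N powr (1/2) \<longrightarrow>
      (LINT \<theta>:W_region N Q K|lborel. (cmod (exp_sum \<Gamma> v\<^sub>0 w\<^sub>0 \<sigma> N \<Xi> P \<theta>))\<^sup>2)
        \<le> C * (ln N * (N powr (\<delta> + \<delta> * \<sigma>) * sup_norm_on (W_region N Q K) (exp_sum \<Gamma> v\<^sub>0 w\<^sub>0 \<sigma> N \<Xi> P)
                     + N powr (2 * \<delta> + 1 - \<sigma>)))"
      using C(2) eventually_ge_at_top[of "3::real"]
    proof eventually_elim
      case (elim N)
      show ?case
        by (intro allI impI, rule bound[OF elim(2) W], rule elim(1)[rule_format]) blast+
    qed
  qed
qed

end
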